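(* Let $N\ge 2$, let $\Omega\subset\mathbb{R}^N$ be a bounded radial domain and $m\in\mathbb{N}$. Assume that $f_i\in C^1([0,\infty)\times\mathbb{R}^m)$, $(r,u_1,\ldots,u_m)\mapsto f_i(r,u_1,\ldots,u_m)\in\mathbb{R}$, $i=1,\ldots,m$, satisfy $$\frac{\partial}{\partial u_i} f_j>0\quad\text{on }(0,\infty)^{m+1},\quad i,j\in\{1,\ldots,m\},\ i\neq j.$$ Let $u_1,\ldots,u_m:\mathbb{R}^N\to\mathbb{R}$ be continuous bounded functions satisfying in weak sense $$Iu_i=f_i(|x|,u_1,\ldots,u_m)\ \text{ in }\Omega,\ i=1,\ldots,m,\qquad u_1=\ldots=u_m=0\ \text{ in }\mathbb{R}^N\setminus\Omega.$$ If $u_i>0$ in $\Omega$ for $i=1,\ldots,m$, if $$u_i(x_1,x')\ge u_i(-x_1,x')\quad\text{for all }x_1>0,\ x'\in\mathbb{R}^{N-1},\ i=1,\ldots,m,$$ and if there are $x_1>0$, $x'\in\mathbb{R}^{N-1}$ with $u_1(x_1,x')>u_1(-x_1,x')$, then there is $p\in S^{N-1}$ such that $u_1,\ldots,u_m$ are foliated Schwarz symmetric in $\Omega$ with respect to $p$ and strictly decreasing in the polar angle.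
   Context: $S^{N-1}=\{x\in\mathbb{R}^N:|x|=1\}$. A radial domain is an open connected set invariant under all rotations about the origin. Kernel and operator: $k:\mathbb{R}^N\to[0,\infty]$, $k(z)=k_0(|z|)$, where $k_0:[0,\infty)\to[0,\infty]$ is monotone decreasing (nonincreasing) with $\int_0^\infty\min\{1,r^2\}k_0(r)r^{N-1}\,dr<\infty$ and $\int_0^\infty k_0(r)r^{N-1}\,dr=\infty$. The operator $I$ is given, for $u\in C^2(\mathbb{R}^N)\cap L^\infty(\mathbb{R}^N)$, by $Iu(x)=\lim_{\epsilon\to0^+}\int_{\mathbb{R}^N\setminus B_\epsilon(x)}(u(x)-u(y))k(x-y)\,dy$. Set $\mathcal{E}_k(u,v)=\frac12\int_{\mathbb{R}^N}\int_{\mathbb{R}^N}(u(x)-u(y))(v(x)-v(y))k(x-y)\,dx\,dy$ and, for $\Omega$ open, $\mathcal{D}_k(\Omega)=\{u\in L^2(\mathbb{R}^N): u=0 \text{ on }\mathbb{R}^N\setminus\Omega,\ \mathcal{E}_k(u,u)<\infty\}$. The functions $u_1,\dots,u_m$ satisfy the system in weak sense if $u_i\in\mathcal{D}_k(\Omega)$ and $\mathcal{E}_k(u_i,\phi)=\int_\Omega f_i(|x|,u_1(x),\ldots,u_m(x))\phi(x)\,dx$ for all $\phi\in\mathcal{D}_k(\Omega)$, $i=1,\ldots,m$. A function $u$ is foliated Schwarz symmetric with respect to $p\in S^{N-1}$ in $\Omega$ if for every $r>0$ with $rS^{N-1}\subset\Omega$ and every $c\in\mathbb{R}$, the set $\{x\in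 rS^{N-1}:u(x)\ge c\}$ is equal to $rS^{N-1}$ or to a geodesic ball in $rS^{N-1}$ centered at $rp$ (the empty set and $\{rp\}$ count as degenerate geodesic balls). Equivalently (for continuous $u$), in $\Omega$ the function $u$ depends only on $|x|$ and the polar angle $\theta=\arccos(\frac{x}{|x|}\cdot p)$ and is nonincreasing in $\theta$. It is strictly decreasing in the polar angle if $u(x)>u(y)$ whenever $x,y\in rS^{N-1}\subset\Omega$, $r>0$, and $x\cdot p>y\cdot p$. *)

theory Defs
  imports "HOL-Analysis.Analysis"
begin

definition radial_domain :: "(real^'n) set \<Rightarrow> bool" where
  "radial_domain \<Omega> \<longleftrightarrow> open \<Omega> \<and> connected \<Omega> \<and>
     (\<forall>A::real^'n^'n. rotation_matrix A \<longrightarrow> (\<lambda>x. A *v x) ` \<Omega> = \<Omega>)"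

(* Derivatives are taken within S, hence one-sided at boundary points of S. *)
definition C1_on :: "'a::real_normed_vector set \<Rightarrow> ('a \<Rightarrow> 'b::real_normed_vector) \<Rightarrow> bool" where
  "C1_on S f \<longleftrightarrow> (\<exists>f' :: 'a \<Rightarrow> 'a \<Rightarrow>\<^sub>L 'b.
     (\<forall>x\<in>S. (f has_derivative blinfun_apply (f' x)) (at x within S)) \<and> continuous_on S f')"

definition partial_deriv :: "'m \<Rightarrow> (real^'m \<Rightarrow> real) \<Rightarrow> real^'m \<Rightarrow> real" where
  "partial_deriv i g v = deriv (\<lambda>t. g (\<chi> l. if l = i then t else v $ l)) (v $ i)"

(* k is extended-valued, so there are two forms of E_k: the quadratic one takes values in
   [0,infinity] and expresses finite energy, the bilinear one is real-valued and is meant for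
   functions of finite energy. In the latter enn2real replaces the value infinity by 0; for a
   monotone kernel profile with the first integrability property of admissible_profile, k is
   finite away from 0, so this only concerns the diagonal x = y, where the integrand
   vanishes anyway. *)
definition energy :: "(real^'n \<Rightarrow> ennreal) \<Rightarrow> (real^'n \<Rightarrow> real) \<Rightarrow> ennreal" where
  "energy k u = (1/2) *
     (\<integral>\<^sup>+y. (\<integral>\<^sup>+x. ennreal ((u x - u y)\<^sup>2) * k (x - y) \<partial>lebesgue) \<partial>lebesgue)"

definition energy_form ::
  "(real^'n \<Rightarrow> ennreal) \<Rightarrow> (real^'n \<Rightarrow> real) \<Rightarrow> (real^'n \<Rightarrow> real) \<Rightarrow> real" where
  "energy_form k u v = (1/2) *
     (LINT y|lebesgue. (LINT x|lebesgue. (u x - u y) * (v x - v y) * enn2real (k (x - y))))"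

(* The profile is only constrained on [0,infinity). *)
definition admissible_profile :: "nat \<Rightarrow> (real \<Rightarrow> ennreal) \<Rightarrow> bool" where
  "admissible_profile N k\<^sub>0 \<longleftrightarrow> antimono_on {0..} k\<^sub>0 \<and>
     (\<integral>\<^sup>+r\<in>{0..}. ennreal (min 1 (r\<^sup>2)) * k\<^sub>0 r * ennreal (r ^ (N - 1)) \<partial>lborel) < \<infinity> \<and>
     (\<integral>\<^sup>+r\<in>{0..}. k\<^sub>0 r * ennreal (r ^ (N - 1)) \<partial>lborel) = \<infinity>"

definition radial_kernel :: "(real \<Rightarrow> ennreal) \<Rightarrow> real^'n \<Rightarrow> ennreal" where
  "radial_kernel k\<^sub>0 z = k\<^sub>0 (norm z)"

(* All representatives of the L^2 classes belong to this set, so vanishing outside Omega is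
   required almost everywhere. *)
definition energy_space :: "(real^'n \<Rightarrow> ennreal) \<Rightarrow> (real^'n) set \<Rightarrow> (real^'n \<Rightarrow> real) set" where
  "energy_space k \<Omega> = {u. u \<in> borel_measurable lebesgue \<and> integrable lebesgue (\<lambda>x. (u x)\<^sup>2) \<and>
     (AE x in lebesgue. x \<notin> \<Omega> \<longrightarrow> u x = 0) \<and> energy k u < \<infinity>}"

definition weak_solution ::
  "(real^'n \<Rightarrow> ennreal) \<Rightarrow> (real^'n) set \<Rightarrow> ('m \<Rightarrow> real \<times> (real^'m) \<Rightarrow> real) \<Rightarrow>
   ('m \<Rightarrow> real^'n \<Rightarrow> real) \<Rightarrow> bool" where
  "weak_solution k \<Omega> f u \<longleftrightarrow> (\<forall>i. u i \<in> energy_space k \<Omega> \<and>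
     (\<forall>\<phi>\<in>energy_space k \<Omega>.
        energy_form k (u i) \<phi> = (LINT x:\<Omega>|lebesgue. f i (norm x, \<chi> l. u l x) * \<phi> x)))"

definition reflect_coord :: "'n \<Rightarrow> real^'n \<Rightarrow> real^'n" where
  "reflect_coord e x = (\<chi> l. if l = e then - (x $ l) else x $ l)"

(* Geodesic (great-circle) distance of x and q on the sphere of radius r. *)
definition sphere_dist :: "real \<Rightarrow> real^'n \<Rightarrow> real^'n \<Rightarrow> real" where
  "sphere_dist r x q = r * arccos ((x \<bullet> q) / r\<^sup>2)"

(* Superlevel sets of the form u >= c of continuous functions are closed, so geodesic balls
   are taken closed; the degenerate cases are the empty set and radius 0. *)
definition foliated_schwarz ::
  "real^'n \<Rightarrow> (real^'n) set \<Rightarrow> (real^'n \<Rightarrow> real) \<Rightarrow> bool" where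
  "foliated_schwarz p \<Omega> u \<longleftrightarrow> (\<forall>r>0. sphere 0 r \<subseteq> \<Omega> \<longrightarrow> (\<forall>c.
     {x \<in> sphere 0 r. u x \<ge> c} = sphere 0 r \<or>
     {x \<in> sphere 0 r. u x \<ge> c} = {} \<or>
     (\<exists>\<rho>\<ge>0. {x \<in> sphere 0 r. u x \<ge> c} = {x \<in> sphere 0 r. sphere_dist r x (r *\<^sub>R p) \<le> \<rho>})))"

definition strictly_decreasing_polar ::
  "real^'n \<Rightarrow> (real^'n) set \<Rightarrow> (real^'n \<Rightarrow> real) \<Rightarrow> bool" where
  "strictly_decreasing_polar p \<Omega> u \<longleftrightarrow> (\<forall>r>0. sphere 0 r \<subseteq> \<Omega> \<longrightarrow>
     (\<forall>x\<in>sphere 0 r. \<forall>y\<in>sphere 0 r. x \<bullet> p > y \<bullet> p \<longrightarrow> u x > u y))"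

end

(* Rotating planes, entirely in the weak setting. For a vector nu let R be the reflection at the
   hyperplane orthogonal to nu, H the half space where x.nu > 0, and w_i = u_i - u_i o R. Testing the
   equation with odd functions turns the kernel k(x-y) into k(x-y) - k(x-Ry), which is nonnegative
   on H x H and positive near the diagonal, since a monotone nonintegrable kernel is unbounded at 0.
   This gives a maximum principle for sets of small measure (coercivity of the energy on functions
   with small support), a strong maximum principle (barrier: a multiple of the bump
   (1 - |x-x0|^2/rho^2)_+), and, by cooperativity, the alternative that if all w_i are nonnegative
   on H, then either all w_i are positive on the intersection of H with Omega or all of them vanish.

   Let S be the set of nu <> 0 for which all w_i are positive there. It is open, and it contains the
   coordinate vector of the hypothesis. Let p be the direction of a maximum point of u_1 on some
   sphere in Omega. Positivity of w_1 gives nu.p >= 0 on S, hence nu.p > 0 as S is open. Moreover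
   S is closed in the half space nu.p > 0: if nu_k in S tends to nu and w vanishes for nu, then
   the reflection R at nu maps S to itself, so R nu_k lies in S and tends to R nu = -nu,
   contradicting -nu.p < 0. Hence S is the whole half space, and reflecting x to y with
   nu = x - y yields the symmetry and the strict monotonicity. *)
theory Submission
  imports Defs
begin

text \<open>The u_i are only continuous, so I w_i need not exist at a given point; every argument at
  a touching point is replaced by a test with an odd function. The integrals stay on the whole
  space: sign conditions are written as 0 <= (x . \<nu>) w_i(x), which is invariant under the
  reflection, and replacing y by its mirror image in the second variable alone produces the
  difference of the two kernels. This difference is needed only for pairs of odd functions with
  disjoint supports, where the diagonal drops out. Openness of S is obtained without a boundary
  lemma of Hopf type: the measure threshold in the small-volume principle is the same for all \<nu>,
  and for normals tending to a member of S the set where some w_i has the wrong sign has measure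
  tending to 0. Normals are not normalised, so S is a cone, and connectedness of a convex open half
  space replaces that of a hemisphere. Cooperativity holds only for positive arguments and f is only
  C^1; what enters the estimates is a Lipschitz bound on bounded sets in which the other components
  appear only through their wrong-sign parts.\<close>

section \<open>Reflections at hyperplanes through the origin\<close>

definition mirror :: "'a::euclidean_space \<Rightarrow> 'a \<Rightarrow> 'a" where
  "mirror \<nu> x = x - (2 * (x \<bullet> \<nu>) / (\<nu> \<bullet> \<nu>)) *\<^sub>R \<nu>"

text \<open>For \<nu> = 0 the quotient in \<open>mirror\<close> is 0 by the convention for division,
  so \<open>mirror 0\<close> is the identity; linearity, isometry and involution hold for every
  \<nu>.\<close>

lemma linear_mirror: "linear (mirror \<nu>)"
  by (rule linearI) (simp_all add: mirror_def algebra_simps add_divide_distrib)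

lemma mirror_diff: "mirror \<nu> (x - y) = mirror \<nu> x - mirror \<nu> y"
  by (rule linear_diff[OF linear_mirror])

lemma mirror_add: "mirror \<nu> (x + y) = mirror \<nu> x + mirror \<nu> y"
  by (rule linear_add[OF linear_mirror])

lemma mirror_inner [simp]: "mirror \<nu> x \<bullet> \<nu> = - (x \<bullet> \<nu>)"
  by (cases "\<nu> = 0") (simp_all add: mirror_def inner_diff_left)

lemma mirror_mirror [simp]: "mirror \<nu> (mirror \<nu> x) = x"
proof -
  have "mirror \<nu> (mirror \<nu> x) = mirror \<nu> x - (2 * (mirror \<nu> x \<bullet> \<nu>) / (\<nu> \<bullet> \<nu>)) *\<^sub>R \<nu>"
    by (simp only: mirror_def[of \<nu> "mirror \<nu> x"])
  also have "\<dots> = x" by (simp only: mirror_inner) (simp add: mirror_def)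
  finally show ?thesis .
qed

lemma mirror_inner_commute: "mirror \<nu> x \<bullet> y = x \<bullet> mirror \<nu> y"
  by (simp add: mirror_def inner_diff_left inner_diff_right inner_commute)

lemma norm_mirror [simp]: "norm (mirror \<nu> x) = norm x"
  unfolding norm_eq_sqrt_inner by (subst mirror_inner_commute) simp

lemma mirror_eq_0_iff [simp]: "mirror \<nu> x = 0 \<longleftrightarrow> x = 0"
  by (metis norm_mirror norm_eq_zero)

lemma mirror_eq_self: "x \<bullet> \<nu> = 0 \<Longrightarrow> mirror \<nu> x = x"
  by (simp add: mirror_def)

lemma continuous_on_mirror [continuous_intros]:
  "continuous_on S h \<Longrightarrow> continuous_on S (\<lambda>x. mirror \<nu> (h x))"
  by (rule continuous_on_compose2[OF linear_continuous_on[of "mirror \<nu>" UNIV]])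
    (simp_all add: linear_conv_bounded_linear[symmetric] linear_mirror)

lemma measurable_mirror [measurable]: "mirror \<nu> \<in> borel_measurable borel"
  by (intro borel_measurable_continuous_onI continuous_intros)

text \<open>Points of equal norm are exchanged by the reflection at their bisecting hyperplane,
  which has normal x - y: the identity |x - y|^2 = 2 x . (x - y) makes the coefficient in
  \<open>mirror\<close> equal to 1.\<close>

lemma mirror_swap:
  assumes "norm x = norm y" shows "mirror (x - y) x = y"
proof (cases "x = y")
  case False
  have xx: "x \<bullet> x = y \<bullet> y" using assms by (simp add: norm_eq)
  have e: "(x - y) \<bullet> (x - y) = 2 * (x \<bullet> (x - y))"
    by (simp add: inner_diff_left inner_diff_right xx inner_commute)
  have ne: "(x - y) \<bullet> (x - y) \<noteq> 0" using False by simp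
  have q: "2 * (x \<bullet> (x - y)) / ((x - y) \<bullet> (x - y)) = 1"
    by (subst e[symmetric], rule divide_self, rule ne)
  show ?thesis unfolding mirror_def q by simp
qed (simp add: mirror_def)

text \<open>Reflecting the normal conjugates the reflection. This is what lets S inherit a symmetry
  shared by all u_i.\<close>

lemma mirror_conj: "mirror (mirror \<nu> \<mu>) x = mirror \<nu> (mirror \<mu> (mirror \<nu> x))"
proof -
  have n: "mirror \<nu> \<mu> \<bullet> mirror \<nu> \<mu> = \<mu> \<bullet> \<mu>" by (subst mirror_inner_commute) simp
  have s: "mirror \<nu> (c *\<^sub>R z) = c *\<^sub>R mirror \<nu> z" for c z by (rule linear_cmul[OF linear_mirror])
  have "mirror \<nu> (mirror \<mu> (mirror \<nu> x)) = mirror \<nu> (mirror \<nu> x - (2 * (mirror \<nu> x \<bullet> \<mu>) / (\<mu> \<bullet> \<mu>)) *\<^sub>R \<mu>)"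
    by (simp only: mirror_def[of \<mu>])
  also have "\<dots> = x - (2 * (x \<bullet> mirror \<nu> \<mu>) / (\<mu> \<bullet> \<mu>)) *\<^sub>R mirror \<nu> \<mu>"
    by (simp add: mirror_diff s mirror_inner_commute)
  also have "\<dots> = mirror (mirror \<nu> \<mu>) x"
    by (simp only: mirror_def[of "mirror \<nu> \<mu>"] n)
  finally show ?thesis by simp
qed

text \<open>The extra term has the sign of (x . \<nu>)(y . \<nu>): of y and its mirror image, the
  one on the same side as x is the nearer one. All kernel comparisons come from this.\<close>

lemma norm_diff_mirror_sq:
  "(norm (x - mirror \<nu> y))\<^sup>2 = (norm (x - y))\<^sup>2 + 4 * (x \<bullet> \<nu>) * (y \<bullet> \<nu>) / (\<nu> \<bullet> \<nu>)"
proof (cases "\<nu> = 0")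
  case False
  have "(norm (x - mirror \<nu> y))\<^sup>2 = x \<bullet> x - 2 * (x \<bullet> mirror \<nu> y) + mirror \<nu> y \<bullet> mirror \<nu> y"
    by (simp add: power2_norm_eq_inner inner_diff_left inner_diff_right inner_commute)
  also have "mirror \<nu> y \<bullet> mirror \<nu> y = y \<bullet> y" by (subst mirror_inner_commute) simp
  also have "x \<bullet> mirror \<nu> y = x \<bullet> y - 2 * (y \<bullet> \<nu>) / (\<nu> \<bullet> \<nu>) * (x \<bullet> \<nu>)"
    by (simp add: mirror_def inner_diff_right)
  also have "x \<bullet> x - 2 * (x \<bullet> y - 2 * (y \<bullet> \<nu>) / (\<nu> \<bullet> \<nu>) * (x \<bullet> \<nu>)) + y \<bullet> y =
      (x - y) \<bullet> (x - y) + 4 * (x \<bullet> \<nu>) * (y \<bullet> \<nu>) / (\<nu> \<bullet> \<nu>)"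
    by (simp add: inner_diff_left inner_diff_right inner_commute algebra_simps)
  finally show ?thesis by (simp add: power2_norm_eq_inner)
qed (simp add: mirror_def)

lemma norm_diff_mirror_ge:
  assumes "0 \<le> (x \<bullet> \<nu>) * (y \<bullet> \<nu>)"
  shows "norm (x - y) \<le> norm (x - mirror \<nu> y)"
proof -
  have "0 \<le> 4 * (x \<bullet> \<nu>) * (y \<bullet> \<nu>) / (\<nu> \<bullet> \<nu>)" using assms by (simp add: mult.assoc)
  then have "(norm (x - y))\<^sup>2 \<le> (norm (x - mirror \<nu> y))\<^sup>2" by (simp add: norm_diff_mirror_sq)
  then show ?thesis by (simp add: power2_le_iff_abs_le)
qed

lemma norm_diff_mirror_le:
  assumes "(x \<bullet> \<nu>) * (y \<bullet> \<nu>) \<le> 0"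
  shows "norm (x - mirror \<nu> y) \<le> norm (x - y)"
  using norm_diff_mirror_ge[of x \<nu> "mirror \<nu> y"] assms by simp

lemma tendsto_mirror:
  assumes "(\<nu> \<longlongrightarrow> \<nu>0) F" "(h \<longlongrightarrow> x) F" "\<nu>0 \<noteq> 0"
  shows "((\<lambda>k. mirror (\<nu> k) (h k)) \<longlongrightarrow> mirror \<nu>0 x) F"
  unfolding mirror_def using assms by (intro tendsto_intros) auto

subsection \<open>Invariance of Lebesgue measure under linear isometries\<close>

lemma nn_integral_lborel_translate:
  fixes h :: "'a::euclidean_space \<Rightarrow> ennreal"
  assumes [measurable]: "h \<in> borel_measurable borel"
  shows "(\<integral>\<^sup>+x. h (c + x) \<partial>lborel) = (\<integral>\<^sup>+x. h x \<partial>lborel)"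
  by (subst (2) lborel_distr_plus[of c, symmetric]) (simp add: nn_integral_distr)

text \<open>Uniqueness of the translation-invariant measure up to a factor; comparing on the unit
  ball, which \<open>T\<close> preserves, shows that the factor is 1.\<close>
lemma nn_integral_lborel_isometry:
  fixes h :: "'a::euclidean_space \<Rightarrow> ennreal" and T :: "'a \<Rightarrow> 'a"
  assumes [measurable]: "h \<in> borel_measurable borel" "T \<in> borel_measurable borel"
    and add: "\<And>x y. T (x + y) = T x + T y" and TT: "\<And>x. T (T x) = x"
    and norm: "\<And>x. norm (T x) = norm x"
  shows "(\<integral>\<^sup>+x. h (T x) \<partial>lborel) = (\<integral>\<^sup>+x. h x \<partial>lborel)"
proof -
  define b :: "'a \<Rightarrow> ennreal" where "b = indicator (ball 0 1)"
  define c where "c = (\<integral>\<^sup>+x. b x \<partial>lborel)"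
  have b_meas [measurable]: "b \<in> borel_measurable borel" unfolding b_def
    by (rule borel_measurable_indicator) simp
  have c_eq: "c = ennreal (unit_ball_vol (DIM('a)))"
    by (simp add: c_def b_def emeasure_ball)
  have bT: "b (T x) = b x" and bm: "b (- x) = b x" for x by (auto simp: b_def indicator_def norm)
  have "(\<integral>\<^sup>+x. h (T x) \<partial>lborel) * c = (\<integral>\<^sup>+x. (\<integral>\<^sup>+y. h (T x) * b y \<partial>lborel) \<partial>lborel)"
    by (simp add: c_def nn_integral_cmult nn_integral_multc)
  also have "\<dots> = (\<integral>\<^sup>+x. (\<integral>\<^sup>+y. h (T x) * b (- T x + y) \<partial>lborel) \<partial>lborel)"
    by (intro nn_integral_cong nn_integral_lborel_translate[symmetric, where h="\<lambda>y. h _ * b y"]) measurable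
  also have "\<dots> = (\<integral>\<^sup>+y. (\<integral>\<^sup>+x. h (T x) * b (- T x + y) \<partial>lborel) \<partial>lborel)"
    by (rule lborel_pair.Fubini') measurable
  also have "\<dots> = (\<integral>\<^sup>+y. (\<integral>\<^sup>+x. h (y + T x) * b (T x) \<partial>lborel) \<partial>lborel)"
  proof (rule nn_integral_cong)
    fix y
    \<comment> \<open>Shifting x by T y turns T x into y + T x, by additivity and the involution;
      \<open>b\<close> then no longer involves y and the two integrations separate.\<close>
    have "(\<integral>\<^sup>+x. h (T x) * b (- T x + y) \<partial>lborel) =
        (\<integral>\<^sup>+x. h (T (T y + x)) * b (- T (T y + x) + y) \<partial>lborel)"
      by (rule nn_integral_lborel_translate[symmetric]) measurable
    also have "\<dots> = (\<integral>\<^sup>+x. h (y + T x) * b (T x) \<partial>lborel)"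
      by (simp add: add TT bm)
    finally show "(\<integral>\<^sup>+x. h (T x) * b (- T x + y) \<partial>lborel) = \<dots>" .
  qed
  also have "\<dots> = (\<integral>\<^sup>+x. (\<integral>\<^sup>+y. h (y + T x) * b (T x) \<partial>lborel) \<partial>lborel)"
    by (rule lborel_pair.Fubini') measurable
  also have "\<dots> = (\<integral>\<^sup>+x. (\<integral>\<^sup>+y. h y \<partial>lborel) * b x \<partial>lborel)"
  proof (rule nn_integral_cong)
    fix x
    have "(\<integral>\<^sup>+y. h (y + T x) * b (T x) \<partial>lborel) = (\<integral>\<^sup>+y. h (T x + y) \<partial>lborel) * b (T x)"
      by (simp add: nn_integral_multc add.commute)
    then show "(\<integral>\<^sup>+y. h (y + T x) * b (T x) \<partial>lborel) = (\<integral>\<^sup>+y. h y \<partial>lborel) * b x"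
      by (simp add: nn_integral_lborel_translate bT)
  qed
  also have "\<dots> = (\<integral>\<^sup>+y. h y \<partial>lborel) * c" by (simp add: c_def nn_integral_cmult)
  finally have eq: "(\<integral>\<^sup>+x. h (T x) \<partial>lborel) * c = (\<integral>\<^sup>+y. h y \<partial>lborel) * c" .
  have c: "c \<noteq> 0" "c \<noteq> top" by (simp_all add: c_eq ennreal_eq_0_iff not_le)
  show ?thesis using arg_cong[OF eq, of "\<lambda>t. t / c"] by (simp only: mult_divide_eq_ennreal[OF c])
qed

lemma distr_lborel_mirror: "distr lborel borel (mirror \<nu>) = lborel"
proof (rule measure_eqI)
  fix A assume "A \<in> sets (distr lborel borel (mirror \<nu>))"
  then have [measurable]: "A \<in> sets borel" by simp
  have "emeasure (distr lborel borel (mirror \<nu>)) A = (\<integral>\<^sup>+x. indicator A x \<partial>distr lborel borel (mirror \<nu>))"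
    by simp
  also have "\<dots> = (\<integral>\<^sup>+x. indicator A (mirror \<nu> x) \<partial>lborel)" by (rule nn_integral_distr) measurable
  also have "\<dots> = (\<integral>\<^sup>+x. indicator A x \<partial>lborel)"
    by (rule nn_integral_lborel_isometry) (simp_all add: mirror_add)
  also have "\<dots> = emeasure lborel A" by simp
  finally show "emeasure (distr lborel borel (mirror \<nu>)) A = emeasure lborel A" .
qed simp

lemma integrable_mirror_iff:
  fixes h :: "'a::euclidean_space \<Rightarrow> real"
  assumes [measurable]: "h \<in> borel_measurable borel"
  shows "integrable lborel (\<lambda>x. h (mirror \<nu> x)) \<longleftrightarrow> integrable lborel h"
  using integrable_distr_eq[of "mirror \<nu>" lborel borel h] by (simp add: distr_lborel_mirror)

lemma integral_mirror:
  fixes h :: "'a::euclidean_space \<Rightarrow> real"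
  assumes [measurable]: "h \<in> borel_measurable borel"
  shows "(LINT x|lborel. h (mirror \<nu> x)) = (LINT x|lborel. h x)"
  using integral_distr[of "mirror \<nu>" lborel borel h] by (simp add: distr_lborel_mirror)

subsection \<open>Measure-preserving maps of the product\<close>

abbreviation lborel2 :: "('a::euclidean_space \<times> 'a) measure" where
  "lborel2 \<equiv> lborel \<Otimes>\<^sub>M lborel"

lemma integral_preserving:
  fixes h :: "'a::euclidean_space \<times> 'a \<Rightarrow> real"
  assumes "distr lborel2 lborel2 T = lborel2" "T \<in> measurable lborel2 lborel2"
    "h \<in> borel_measurable lborel2"
  shows "integrable lborel2 (\<lambda>p. h (T p)) \<longleftrightarrow> integrable lborel2 h"
    "(LINT p|lborel2. h (T p)) = (LINT p|lborel2. h p)"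
  using integrable_distr_eq[of T lborel2 lborel2 h] integral_distr[of T lborel2 lborel2 h] assms by simp_all

text \<open>Reflecting the second variable alone is the substitution that turns K(x - y) into K(x -
  Ry).\<close>

lemma distr_mirror_snd: "distr lborel2 lborel2 (\<lambda>(x, y). (x, mirror \<nu> y)) = lborel2"
proof -
  have "distr lborel borel (\<lambda>x. x) \<Otimes>\<^sub>M distr lborel borel (mirror \<nu>)
      = distr lborel2 (borel \<Otimes>\<^sub>M borel) (\<lambda>(x, y). (x, mirror \<nu> y))"
    by (rule pair_measure_distr) (simp_all add: distr_lborel_mirror lborel.sigma_finite_measure_axioms)
  moreover have "distr lborel borel (\<lambda>x::'a. x) = lborel" by (rule distr_id2) simp
  moreover have "distr lborel2 (borel \<Otimes>\<^sub>M borel) (\<lambda>(x, y). (x, mirror \<nu> y)) =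
      distr lborel2 lborel2 (\<lambda>(x, y). (x, mirror \<nu> y))"
    by (rule distr_cong) (simp_all cong: sets_pair_measure_cong)
  ultimately show ?thesis by (simp add: distr_lborel_mirror)
qed

lemma distr_mirror_both: "distr lborel2 lborel2 (\<lambda>(x, y). (mirror \<nu> x, mirror \<nu> y)) = lborel2"
proof -
  have "distr lborel borel (mirror \<nu>) \<Otimes>\<^sub>M distr lborel borel (mirror \<nu>)
      = distr lborel2 (borel \<Otimes>\<^sub>M borel) (\<lambda>(x, y). (mirror \<nu> x, mirror \<nu> y))"
    by (rule pair_measure_distr) (simp_all add: distr_lborel_mirror lborel.sigma_finite_measure_axioms)
  moreover have "distr lborel2 (borel \<Otimes>\<^sub>M borel) (\<lambda>(x, y). (mirror \<nu> x, mirror \<nu> y)) =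
      distr lborel2 lborel2 (\<lambda>(x, y). (mirror \<nu> x, mirror \<nu> y))"
    by (rule distr_cong) (simp_all cong: sets_pair_measure_cong)
  ultimately show ?thesis by (simp add: distr_lborel_mirror)
qed

text \<open>The coordinates z = y - x and x: the kernel then depends on z alone, so estimates for
  fixed z can be integrated against the moment of K.\<close>

lemma distr_shear: "distr lborel2 lborel2 (\<lambda>(z, x). (x, x + z)) = (lborel2 :: ('a::euclidean_space \<times> 'a) measure)"
proof (rule measure_eqI)
  let ?T = "\<lambda>(z, x). (x, x + z :: 'a)"
  fix A :: "('a \<times> 'a) set" assume "A \<in> sets (distr lborel2 lborel2 ?T)"
  then have A [measurable]: "A \<in> sets (borel \<Otimes>\<^sub>M borel)" by (simp cong: sets_pair_measure_cong)
  have [measurable]: "A \<in> sets lborel2" by (simp cong: sets_pair_measure_cong)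
  have T [measurable]: "?T \<in> measurable lborel2 lborel2" by (simp cong: measurable_cong_sets sets_pair_measure_cong)
  have "emeasure (distr lborel2 lborel2 ?T) A = (\<integral>\<^sup>+p. indicator A p \<partial>distr lborel2 lborel2 ?T)"
    by simp
  also have "\<dots> = (\<integral>\<^sup>+p. indicator A (?T p) \<partial>lborel2)" by (rule nn_integral_distr) measurable
  also have "\<dots> = (\<integral>\<^sup>+x. (\<integral>\<^sup>+z. indicator A (x, x + z) \<partial>lborel) \<partial>lborel)"
    by (subst lborel_pair.nn_integral_snd[symmetric]) (auto simp: case_prod_beta)
  also have "\<dots> = (\<integral>\<^sup>+x. (\<integral>\<^sup>+y. indicator A (x, y) \<partial>lborel) \<partial>lborel)"
    by (intro nn_integral_cong nn_integral_lborel_translate) measurable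
  also have "\<dots> = emeasure lborel2 A"
    by (subst lborel.nn_integral_fst) auto
  finally show "emeasure (distr lborel2 lborel2 ?T) A = emeasure lborel2 A" .
qed simp

subsection \<open>Energy forms of singular kernels\<close>

lemma integrable_lborel_translate:
  fixes h :: "'a::euclidean_space \<Rightarrow> real"
  assumes "integrable lborel h"
  shows "integrable lborel (\<lambda>x. h (c + x))" "(LINT x|lborel. h (c + x)) = (LINT x|lborel. h x)"
proof -
  have [measurable]: "h \<in> borel_measurable borel" using assms by auto
  show "integrable lborel (\<lambda>x. h (c + x))"
    using integrable_distr_eq[of "(+) c" lborel borel h] assms by (simp add: lborel_distr_plus)
  show "(LINT x|lborel. h (c + x)) = (LINT x|lborel. h x)"
    using integral_distr[of "(+) c" lborel borel h] by (simp add: lborel_distr_plus)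
qed

lemma integrable_product:
  fixes f g :: "'a::euclidean_space \<Rightarrow> real"
  assumes f: "integrable lborel f" and g: "integrable lborel g"
  shows "integrable lborel2 (\<lambda>p. f (fst p) * g (snd p))"
    "(LINT p|lborel2. f (fst p) * g (snd p)) = (LINT x|lborel. f x) * (LINT x|lborel. g x)"
proof -
  have [measurable]: "f \<in> borel_measurable borel" "g \<in> borel_measurable borel" using f g by auto
  show int: "integrable lborel2 (\<lambda>p. f (fst p) * g (snd p))"
  proof (rule lborel_pair.Fubini_integrable)
    show "integrable lborel (\<lambda>x. LINT y|lborel. norm (f (fst (x, y)) * g (snd (x, y))))"
      using f by (simp add: abs_mult)
    show "AE x in lborel. integrable lborel (\<lambda>y. f (fst (x, y)) * g (snd (x, y)))"
      using g by simp
  qed measurable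
  have "(LINT p|lborel2. f (fst p) * g (snd p)) = (LINT x|lborel. LINT y|lborel. f x * g y)"
    using lborel_pair.integral_fst'[OF int] by simp
  then show "(LINT p|lborel2. f (fst p) * g (snd p)) = (LINT x|lborel. f x) * (LINT x|lborel. g x)"
    by simp
qed

text \<open>A real-valued stand-in for k. Its value at the origin carries no information, hence z =
  0 is excluded in \<open>K_anti\<close>; the energy integrand vanishes on the diagonal
  anyway.\<close>

locale singular_kernel =
  fixes K :: "'a::euclidean_space \<Rightarrow> real"
  assumes K_nonneg: "0 \<le> K z"
    and K_meas [measurable]: "K \<in> borel_measurable borel"
    and K_anti: "z \<noteq> 0 \<Longrightarrow> norm z \<le> norm w \<Longrightarrow> K w \<le> K z"
    and K_nonint: "(\<integral>\<^sup>+z. ennreal (K z) \<partial>lborel) = \<infinity>"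
    and K_moment: "integrable lborel (\<lambda>z. min 1 ((norm z)\<^sup>2) * K z)"
begin

text \<open>Radial symmetry is monotonicity in the norm, used in both directions.\<close>

lemma K_cong: "norm z = norm w \<Longrightarrow> K z = K w"
  by (cases "z = 0") (auto intro!: antisym K_anti)

lemma K_minus: "K (- z) = K z"
  by (rule K_cong) simp

lemma K_mirror: "K (mirror \<nu> x - mirror \<nu> y) = K (x - y)"
  by (rule K_cong) (simp add: mirror_diff[symmetric])

lemma K_mirror_same_side:
  "0 \<le> (x \<bullet> \<nu>) * (y \<bullet> \<nu>) \<Longrightarrow> x \<noteq> y \<Longrightarrow> K (x - mirror \<nu> y) \<le> K (x - y)"
  by (intro K_anti norm_diff_mirror_ge) auto

lemma K_mirror_opposite_sides:
  "(x \<bullet> \<nu>) * (y \<bullet> \<nu>) \<le> 0 \<Longrightarrow> x \<noteq> mirror \<nu> y \<Longrightarrow> K (x - y) \<le> K (x - mirror \<nu> y)"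
  by (intro K_anti norm_diff_mirror_le) auto

text \<open>A bound off the origin would make K integrable: it would control K on the unit ball, and
  outside the unit ball the integrand of \<open>K_moment\<close> is K itself.\<close>

lemma K_unbounded: "\<exists>\<rho>>0. \<forall>z. z \<noteq> 0 \<longrightarrow> norm z < \<rho> \<longrightarrow> c < K z"
proof (rule ccontr)
  assume neg: "\<not> ?thesis"
  \<comment> \<open>Failure of the claim supplies points of arbitrarily small norm where K is at
    most c; monotonicity carries this bound outwards.\<close>
  have le: "K z \<le> c" if z: "z \<noteq> 0" for z
  proof -
    obtain w where "w \<noteq> 0" "norm w < norm z" "K w \<le> c"
      using neg z by (metis not_less zero_less_norm_iff)
    then show ?thesis using K_anti[of w z] by simp
  qed
  define c' where "c' = max c (K 0)"
  have le': "K z \<le> c'" for z using le[of z] by (cases "z = 0") (auto simp: c'_def)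
  have "integrable lborel (\<lambda>z. c' * indicat_real (ball 0 1) z + min 1 ((norm z)\<^sup>2) * K z)"
    by (intro Bochner_Integration.integrable_add K_moment integrable_mult_right integrable_real_indicator)
      (auto simp: emeasure_ball)
  then have "integrable lborel K"
  proof (rule Bochner_Integration.integrable_bound)
    show "AE z in lborel. norm (K z) \<le> norm (c' * indicat_real (ball 0 1) z + min 1 ((norm z)\<^sup>2) * K z)"
    proof (rule AE_I2)
      fix z
      have c': "0 \<le> c'" using K_nonneg[of 0] by (simp add: c'_def)
      have "K z \<le> c' * indicat_real (ball 0 1) z + min 1 ((norm z)\<^sup>2) * K z"
      proof (cases "norm z < 1")
        case True
        then show ?thesis using le'[of z] K_nonneg[of z] by (simp add: add_increasing2)
      next
        case False
        then have "1 \<le> (norm z)\<^sup>2" by (simp add: one_le_power)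
        then show ?thesis using c' by (simp add: min_def)
      qed
      then show "norm (K z) \<le> norm (c' * indicat_real (ball 0 1) z + min 1 ((norm z)\<^sup>2) * K z)"
        using K_nonneg[of z] by simp
    qed
  qed simp
  then have "(\<integral>\<^sup>+z. ennreal (K z) \<partial>lborel) < \<infinity>"
    by (subst nn_integral_eq_integral) (auto simp: K_nonneg)
  then show False using K_nonint by simp
qed

text \<open>Density of the energy form on the product space. One integral over the product, instead
  of an iterated one, makes the changes of variables of the product directly applicable.\<close>

definition den :: "('a \<Rightarrow> real) \<Rightarrow> ('a \<Rightarrow> real) \<Rightarrow> 'a \<times> 'a \<Rightarrow> real" where
  "den u v p = (u (fst p) - u (snd p)) * (v (fst p) - v (snd p)) * K (fst p - snd p)"

definition fin_energy :: "('a \<Rightarrow> real) \<Rightarrow> bool" where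
  "fin_energy u \<longleftrightarrow> u \<in> borel_measurable borel \<and> integrable lborel2 (den u u)"

definition E :: "('a \<Rightarrow> real) \<Rightarrow> ('a \<Rightarrow> real) \<Rightarrow> real" where
  "E u v = (LINT p|lborel2. den u v p) / 2"

lemma den_measurable [measurable]:
  assumes [measurable]: "u \<in> borel_measurable borel" "v \<in> borel_measurable borel"
  shows "den u v \<in> borel_measurable lborel2"
  unfolding den_def by measurable

lemma den_nonneg: "0 \<le> den u u p"
  by (simp add: den_def K_nonneg)

lemma den_integrable:
  assumes "fin_energy u" "fin_energy v"
  shows "integrable lborel2 (den u v)"
proof (rule Bochner_Integration.integrable_bound)
  show "integrable lborel2 (\<lambda>p. den u u p + den v v p)"
    using assms by (intro Bochner_Integration.integrable_add) (auto simp: fin_energy_def)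
  show "AE p in lborel2. norm (den u v p) \<le> norm (den u u p + den v v p)"
  proof (rule AE_I2)
    fix p
    have ab: "\<bar>a * b\<bar> \<le> a * a + b * b" for a b :: real
      using zero_le_power2[of "a - b"] zero_le_power2[of "a + b"]
      by (simp add: power2_eq_square algebra_simps abs_le_iff)
    show "norm (den u v p) \<le> norm (den u u p + den v v p)"
      using mult_right_mono[OF ab[of "u (fst p) - u (snd p)" "v (fst p) - v (snd p)"] K_nonneg[of "fst p - snd p"]]
        den_nonneg[of u p] den_nonneg[of v p]
      by (simp add: den_def abs_mult K_nonneg distrib_right)
  qed
  show "den u v \<in> borel_measurable lborel2"
    using assms by (intro den_measurable) (auto simp: fin_energy_def)
qed

lemma fin_energyI:
  assumes "u \<in> borel_measurable borel" "integrable lborel2 G" "\<And>x y. den u u (x, y) \<le> G (x, y)"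
  shows "fin_energy u"
  unfolding fin_energy_def
proof
  show "integrable lborel2 (den u u)"
  proof (rule Bochner_Integration.integrable_bound[OF assms(2)])
    show "AE p in lborel2. norm (den u u p) \<le> norm (G p)"
    proof (rule AE_I2)
      fix p show "norm (den u u p) \<le> norm (G p)"
        using assms(3)[of "fst p" "snd p"] den_nonneg[of u p] by simp
    qed
  qed (use assms(1) in measurable)
qed fact

lemma fin_energy_add:
  assumes u: "fin_energy u" and v: "fin_energy v"
  shows "fin_energy (\<lambda>x. u x + v x)"
proof (rule fin_energyI)
  have [measurable]: "u \<in> borel_measurable borel" "v \<in> borel_measurable borel"
    using u v by (auto simp: fin_energy_def)
  show "(\<lambda>x. u x + v x) \<in> borel_measurable borel" by measurable
  show "integrable lborel2 (\<lambda>p. den u u p + 2 * den u v p + den v v p)"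
    using den_integrable u v by auto
  show "den (\<lambda>x. u x + v x) (\<lambda>x. u x + v x) (x, y) \<le>
      den u u (x, y) + 2 * den u v (x, y) + den v v (x, y)" for x y
    by (simp add: den_def algebra_simps)
qed

lemma fin_energy_scale:
  assumes u: "fin_energy u"
  shows "fin_energy (\<lambda>x. c * u x)"
proof (rule fin_energyI)
  have [measurable]: "u \<in> borel_measurable borel" using u by (auto simp: fin_energy_def)
  show "(\<lambda>x. c * u x) \<in> borel_measurable borel" by measurable
  show "integrable lborel2 (\<lambda>p. c * c * den u u p)" using den_integrable u by auto
  show "den (\<lambda>x. c * u x) (\<lambda>x. c * u x) (x, y) \<le> c * c * den u u (x, y)" for x y
    by (simp add: den_def algebra_simps)
qed

lemma fin_energy_diff:
  "fin_energy u \<Longrightarrow> fin_energy v \<Longrightarrow> fin_energy (\<lambda>x. u x - v x)"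
  using fin_energy_add[OF _ fin_energy_scale[of v "-1"]] by simp

lemma E_add_left:
  assumes "fin_energy u" "fin_energy v" "fin_energy \<phi>"
  shows "E (\<lambda>x. u x + v x) \<phi> = E u \<phi> + E v \<phi>"
proof -
  have "(LINT p|lborel2. den (\<lambda>x. u x + v x) \<phi> p) = (LINT p|lborel2. den u \<phi> p + den v \<phi> p)"
    by (simp add: den_def algebra_simps)
  also have "\<dots> = (LINT p|lborel2. den u \<phi> p) + (LINT p|lborel2. den v \<phi> p)"
    using assms by (intro Bochner_Integration.integral_add den_integrable)
  finally show ?thesis by (simp add: E_def add_divide_distrib)
qed

lemma E_scale_left: "E (\<lambda>x. c * u x) \<phi> = c * E u \<phi>"
proof -
  have "den (\<lambda>x. c * u x) \<phi> = (\<lambda>p. c * den u \<phi> p)" by (auto simp: den_def algebra_simps)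
  then show ?thesis by (simp add: E_def)
qed

lemma E_diff_left:
  assumes "fin_energy u" "fin_energy v" "fin_energy \<phi>"
  shows "E (\<lambda>x. u x - v x) \<phi> = E u \<phi> - E v \<phi>"
  using E_add_left[OF assms(1) fin_energy_scale[OF assms(2), of "-1"] assms(3)]
    E_scale_left[of "-1" v \<phi>] by simp

lemma E_self_nonneg: "0 \<le> E u u"
  by (simp add: E_def den_nonneg)

lemma preserving_measurable:
  "(\<lambda>(x, y). (x, mirror \<nu> y)) \<in> measurable lborel2 lborel2"
  "(\<lambda>(x, y). (mirror \<nu> x, mirror \<nu> y)) \<in> measurable lborel2 lborel2"
  "(\<lambda>(z, x). (x, x + z)) \<in> measurable lborel2 lborel2"
  by measurable

lemmas integral_mirror_snd = integral_preserving[OF distr_mirror_snd preserving_measurable(1)]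
lemmas integral_mirror_both = integral_preserving[OF distr_mirror_both preserving_measurable(2)]
lemmas integral_shear = integral_preserving[OF distr_shear preserving_measurable(3)]

lemma den_mirror:
  "den (\<lambda>x. u (mirror \<nu> x)) (\<lambda>x. v (mirror \<nu> x)) = (\<lambda>p. den u v ((\<lambda>(x, y). (mirror \<nu> x, mirror \<nu> y)) p))"
  by (auto simp: den_def K_mirror)

lemma fin_energy_mirror:
  assumes "fin_energy u" shows "fin_energy (\<lambda>x. u (mirror \<nu> x))"
proof -
  have [measurable]: "u \<in> borel_measurable borel" using assms by (simp add: fin_energy_def)
  have "integrable lborel2 (den u u)" using assms by (simp add: fin_energy_def)
  then have "integrable lborel2 (\<lambda>p. den u u ((\<lambda>(x, y). (mirror \<nu> x, mirror \<nu> y)) p))"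
    by (subst integral_mirror_both) measurable
  then show ?thesis by (simp add: fin_energy_def den_mirror)
qed

lemma E_mirror:
  assumes [measurable]: "u \<in> borel_measurable borel" "v \<in> borel_measurable borel"
  shows "E (\<lambda>x. u (mirror \<nu> x)) (\<lambda>x. v (mirror \<nu> x)) = E u v"
  unfolding E_def den_mirror by (subst integral_mirror_both) simp_all

text \<open>The form is invariant under the reflection, which can therefore be moved onto the test
  function. Consequently E(u - u o R, \<phi>) = 2 E(u, \<phi>) for odd \<phi> when all energies are
  finite.\<close>

lemma E_mirror_odd:
  assumes [measurable]: "u \<in> borel_measurable borel" "\<phi> \<in> borel_measurable borel"
    and odd: "\<And>x. \<phi> (mirror \<nu> x) = - \<phi> x"
  shows "E (\<lambda>x. u (mirror \<nu> x)) \<phi> = - E u \<phi>"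
proof -
  have "E (\<lambda>x. u (mirror \<nu> x)) \<phi> = E (\<lambda>x. u (mirror \<nu> (mirror \<nu> x))) (\<lambda>x. \<phi> (mirror \<nu> x))"
    by (rule E_mirror[symmetric]) measurable
  also have "\<dots> = E u (\<lambda>x. - \<phi> x)" by (simp add: odd)
  also have "\<dots> = - E u \<phi>" by (simp add: E_def den_def algebra_simps flip: Bochner_Integration.integral_minus)
  finally show ?thesis .
qed

section \<open>Odd functions with disjoint supports and odd negative parts\<close>

text \<open>Disjointness removes the products a(x) \<psi>(x) and leaves only cross terms.
  Substituting Ry for y changes the sign of the cross terms and turns K(x - y) into K(x - Ry);
  averaging both expressions gives the kernel difference. The 4 collects this average and the factor
  1/2 in \<open>E\<close>.\<close>

lemma E_disjoint_odd:
  fixes a \<psi> :: "'a \<Rightarrow> real"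
  assumes fe: "fin_energy a" "fin_energy \<psi>"
    and odd: "\<And>x. a (mirror \<nu> x) = - a x" "\<And>x. \<psi> (mirror \<nu> x) = - \<psi> x"
    and disj: "\<And>x. a x * \<psi> x = 0"
  defines "F \<equiv> \<lambda>p. (a (fst p) * \<psi> (snd p) + a (snd p) * \<psi> (fst p)) *
      (K (fst p - snd p) - K (fst p - mirror \<nu> (snd p)))"
  shows "integrable lborel2 F" "E a \<psi> = - (LINT p|lborel2. F p) / 4"
proof -
  let ?T = "\<lambda>(x, y). (x, mirror \<nu> y)"
  have int: "integrable lborel2 (den a \<psi>)" by (rule den_integrable[OF fe])
  have m: "den a \<psi> \<in> borel_measurable lborel2" using int by auto
  have intT: "integrable lborel2 (\<lambda>p. den a \<psi> (?T p))"
    by (subst integral_mirror_snd(1)[OF m]) (rule int)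
  have eqT: "(LINT p|lborel2. den a \<psi> (?T p)) = (LINT p|lborel2. den a \<psi> p)"
    by (rule integral_mirror_snd(2)[OF m])
  have F: "F = (\<lambda>p. - den a \<psi> p - den a \<psi> (?T p))"
  proof
    fix p :: "'a \<times> 'a"
    obtain x y where p: "p = (x, y)" by (cases p)
    have "(a x - a y) * (\<psi> x - \<psi> y) = - (a x * \<psi> y + a y * \<psi> x)"
      using disj[of x] disj[of y] by (auto simp: algebra_simps)
    moreover have "(a x - a (mirror \<nu> y)) * (\<psi> x - \<psi> (mirror \<nu> y)) = a x * \<psi> y + a y * \<psi> x"
      using disj[of x] disj[of y] by (auto simp: odd algebra_simps)
    ultimately show "F p = - den a \<psi> p - den a \<psi> (?T p)"
      by (simp add: F_def den_def p algebra_simps)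
  qed
  show "integrable lborel2 F" unfolding F using int intT by simp
  show "E a \<psi> = - (LINT p|lborel2. F p) / 4" unfolding F E_def using int intT eqT by simp
qed

lemma odd_zero:
  fixes a :: "'a \<Rightarrow> real"
  assumes "\<And>x. a (mirror \<nu> x) = - a x" "x \<bullet> \<nu> = 0"
  shows "a x = 0"
  using assms(1)[of x] mirror_eq_self[OF assms(2)] by simp

text \<open>On the same side of the hyperplane both factors are nonnegative, on opposite sides both
  are nonpositive, and on the hyperplane odd functions vanish. At x = y and x = Ry a kernel argument
  is 0 and monotonicity is silent, but there the cross terms vanish by disjointness.\<close>

lemma odd_kernel_nonneg:
  fixes a \<psi> :: "'a \<Rightarrow> real"
  assumes odd: "\<And>x. a (mirror \<nu> x) = - a x" "\<And>x. \<psi> (mirror \<nu> x) = - \<psi> x"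
    and disj: "\<And>x. a x * \<psi> x = 0"
    and sign: "\<And>x. 0 \<le> (x \<bullet> \<nu>) * a x" "\<And>x. 0 \<le> (x \<bullet> \<nu>) * \<psi> x"
  shows "0 \<le> (a x * \<psi> y + a y * \<psi> x) * (K (x - y) - K (x - mirror \<nu> y))"
proof -
  let ?q = "(x \<bullet> \<nu>) * (y \<bullet> \<nu>)"
  have "0 \<le> ((x \<bullet> \<nu>) * a x) * ((y \<bullet> \<nu>) * \<psi> y)" "0 \<le> ((y \<bullet> \<nu>) * a y) * ((x \<bullet> \<nu>) * \<psi> x)"
    by (intro mult_nonneg_nonneg sign)+
  then have q: "0 \<le> ?q * (a x * \<psi> y + a y * \<psi> x)" by (simp add: algebra_simps)
  consider "?q = 0" | "0 < ?q" | "?q < 0" by linarith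
  then show ?thesis
  proof cases
    case 1
    then show ?thesis using odd_zero[where a=a and \<nu>=\<nu>, OF odd(1)] odd_zero[where a=\<psi> and \<nu>=\<nu>, OF odd(2)] by auto
  next
    case 2
    then have "0 \<le> a x * \<psi> y + a y * \<psi> x" using q by (simp add: zero_le_mult_iff)
    moreover have "a x * \<psi> y + a y * \<psi> x = 0" if "x = y" using that disj[of y] by auto
    ultimately show ?thesis using K_mirror_same_side[of x \<nu> y] 2 by (cases "x = y") auto
  next
    case 3
    then have "a x * \<psi> y + a y * \<psi> x \<le> 0"
      using q mult_neg_pos[of ?q "a x * \<psi> y + a y * \<psi> x"] by linarith
    moreover have "a x * \<psi> y + a y * \<psi> x = 0" if "x = mirror \<nu> y" using that disj[of y] odd by auto
    ultimately show ?thesis using K_mirror_opposite_sides[of x \<nu> y] 3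
      by (cases "x = mirror \<nu> y") (auto intro: mult_nonpos_nonpos)
  qed
qed

text \<open>Meant for \<open>h\<close> odd under the reflection: then this is the odd extension of the negative part
  of \<open>h\<close> on the half space \<open>0 < x \<bullet> \<nu>\<close>.\<close>
definition npart :: "'a \<Rightarrow> ('a \<Rightarrow> real) \<Rightarrow> 'a \<Rightarrow> real" where
  "npart \<nu> h x = (if 0 < x \<bullet> \<nu> then max 0 (- h x) else if x \<bullet> \<nu> < 0 then min 0 (- h x) else 0)"

lemma npart_odd:
  assumes "\<And>x. h (mirror \<nu> x) = - h x" shows "npart \<nu> h (mirror \<nu> x) = - npart \<nu> h x"
  by (auto simp: npart_def assms)

lemma npart_sign: "0 \<le> (x \<bullet> \<nu>) * npart \<nu> h x" "0 \<le> (x \<bullet> \<nu>) * (h x + npart \<nu> h x)"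
  by (auto simp: npart_def zero_le_mult_iff)

lemma npart_disjoint:
  assumes "\<And>x. h (mirror \<nu> x) = - h x" shows "(h x + npart \<nu> h x) * npart \<nu> h x = 0"
  using odd_zero[where a=h and \<nu>=\<nu>, OF assms] by (auto simp: npart_def)

lemma abs_npart_le: "\<bar>npart \<nu> h x\<bar> \<le> \<bar>h x\<bar>"
  by (auto simp: npart_def)

text \<open>Taking negative parts is a contraction on each half space but not across the hyperplane:
  if h(x) = h(y) = -1 at points on opposite sides, \<open>npart\<close> takes different values at
  them. There the excess is charged to the pair (x, Ry), where the difference of h is h(x) + h(y)
  and the kernel is larger.\<close>

lemma fin_energy_npart:
  assumes h: "fin_energy h" and odd: "\<And>x. h (mirror \<nu> x) = - h x"
  shows "fin_energy (npart \<nu> h)"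
proof (rule fin_energyI)
  have hm [measurable]: "h \<in> borel_measurable borel" using h by (simp add: fin_energy_def)
  let ?T = "\<lambda>(x, y). (x, mirror \<nu> y)"
  show "npart \<nu> h \<in> borel_measurable borel" unfolding npart_def by measurable
  have "integrable lborel2 (\<lambda>p. den h h (?T p))"
    by (subst integral_mirror_snd) (use h in \<open>auto simp: fin_energy_def\<close>)
  then show "integrable lborel2 (\<lambda>p. den h h p + den h h (?T p))"
    using h by (auto simp: fin_energy_def)
  fix x y
  let ?\<psi> = "npart \<nu> h"
  have sq: "(?\<psi> z)\<^sup>2 \<le> (h z)\<^sup>2" for z using abs_npart_le[of \<nu> h z] by (simp add: abs_le_square_iff)
  have "(?\<psi> x - ?\<psi> y)\<^sup>2 * K (x - y) \<le> (h x - h y)\<^sup>2 * K (x - y) + (h x + h y)\<^sup>2 * K (x - mirror \<nu> y)"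
  proof (cases "0 < (x \<bullet> \<nu>) * (y \<bullet> \<nu>)")
    case True
    then have "\<bar>?\<psi> x - ?\<psi> y\<bar> \<le> \<bar>h x - h y\<bar>" by (auto simp: npart_def zero_less_mult_iff)
    then have "(?\<psi> x - ?\<psi> y)\<^sup>2 \<le> (h x - h y)\<^sup>2" by (simp add: abs_le_square_iff)
    then show ?thesis using K_nonneg[of "x - y"] K_nonneg[of "x - mirror \<nu> y"]
      by (intro add_increasing2) (auto intro: mult_right_mono)
  next
    case opp: False
    show ?thesis
    proof (cases "x = mirror \<nu> y")
      \<comment> \<open>The kernel value at x - Ry is the uncontrolled one at 0, but oddness makes
        h(x) + h(y) vanish and the first term alone suffices.\<close>
      case True
      then have "h x = - h y" "?\<psi> x = - ?\<psi> y" by (simp_all add: odd npart_odd[where h=h and \<nu>=\<nu>, OF odd])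
      then show ?thesis using mult_right_mono[OF sq[of y] K_nonneg[of "x - y"]]
        by (simp add: power2_eq_square algebra_simps)
    next
      case False
      have "(?\<psi> x - ?\<psi> y)\<^sup>2 \<le> 2 * (?\<psi> x)\<^sup>2 + 2 * (?\<psi> y)\<^sup>2"
        using zero_le_power2[of "?\<psi> x + ?\<psi> y"] by (simp add: power2_eq_square algebra_simps)
      also have "\<dots> \<le> 2 * (h x)\<^sup>2 + 2 * (h y)\<^sup>2" using sq[of x] sq[of y] by simp
      also have "\<dots> = (h x - h y)\<^sup>2 + (h x + h y)\<^sup>2" by (simp add: power2_eq_square algebra_simps)
      finally have "(?\<psi> x - ?\<psi> y)\<^sup>2 * K (x - y) \<le> ((h x - h y)\<^sup>2 + (h x + h y)\<^sup>2) * K (x - y)"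
        using K_nonneg by (intro mult_right_mono) auto
      also have "\<dots> \<le> (h x - h y)\<^sup>2 * K (x - y) + (h x + h y)\<^sup>2 * K (x - mirror \<nu> y)"
        using K_mirror_opposite_sides[of x \<nu> y] opp False by (simp add: distrib_right mult_left_mono)
      finally show ?thesis .
    qed
  qed
  then show "den ?\<psi> ?\<psi> (x, y) \<le> den h h (x, y) + den h h (?T (x, y))"
    by (simp add: den_def odd power2_eq_square)
qed

lemma E_npart:
  assumes h: "fin_energy h" and odd: "\<And>x. h (mirror \<nu> x) = - h x"
  defines "\<psi> \<equiv> npart \<nu> h"
  shows "E h \<psi> = E (\<lambda>x. h x + \<psi> x) \<psi> - E \<psi> \<psi>"
  using E_add_left[OF h fin_energy_npart[OF h odd] fin_energy_npart[OF h odd]] by (simp add: \<psi>_def)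

text \<open>The part of h with the right sign meets its negative part \<psi> only through the kernel
  difference, which has a sign. With \<open>E_npart\<close> this yields E(h, \<psi>) <= - E(\<psi>,
  \<psi>).\<close>

lemma E_pos_npart_nonpos:
  assumes h: "fin_energy h" and odd: "\<And>x. h (mirror \<nu> x) = - h x"
  shows "E (\<lambda>x. h x + npart \<nu> h x) (npart \<nu> h) \<le> 0"
proof -
  let ?\<psi> = "npart \<nu> h" and ?a = "\<lambda>x. h x + npart \<nu> h x"
  have odd\<psi>: "?\<psi> (mirror \<nu> x) = - ?\<psi> x" for x by (rule npart_odd[where h=h and \<nu>=\<nu>, OF odd])
  have odda: "?a (mirror \<nu> x) = - ?a x" for x by (simp add: odd odd\<psi>)
  note fe = fin_energy_npart[OF h odd]
  have "0 \<le> (LINT p|lborel2. (?a (fst p) * ?\<psi> (snd p) + ?a (snd p) * ?\<psi> (fst p)) *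
      (K (fst p - snd p) - K (fst p - mirror \<nu> (snd p))))"
    by (intro integral_nonneg_AE AE_I2 odd_kernel_nonneg odda odd\<psi> npart_disjoint odd npart_sign)
  then show ?thesis
    using E_disjoint_odd(2)[OF fin_energy_add[OF h fe] fe odda odd\<psi> npart_disjoint[where h=h and \<nu>=\<nu>, OF odd]] by simp
qed

end

section \<open>Coercivity on small sets and energy bounds by second differences\<close>

context singular_kernel
begin

text \<open>Monotone convergence along the complements of balls of radius 1/(n + 1), since the total
  mass of K is infinite.\<close>

lemma truncated_mass:
  fixes c :: real
  shows "\<exists>s>0. ennreal c \<le> (\<integral>\<^sup>+z. ennreal (K z) * indicator {z. s \<le> norm z} z \<partial>lborel)"
proof -
  define k where "k n z = ennreal (K z) * indicator {z. 1 / real (Suc n) \<le> norm z} z" for n z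
  have "{z::'a. 1 / real (Suc n) \<le> norm z} \<in> sets borel" for n by measurable
  then have k_meas: "k n \<in> borel_measurable lborel" for n unfolding k_def by measurable
  have inc: "incseq k"
  proof (rule incseq_SucI, rule le_funI)
    fix n z
    have "1 / real (Suc (Suc n)) \<le> 1 / real (Suc n)" by (simp add: frac_le)
    then show "k n z \<le> k (Suc n) z" by (auto simp: k_def indicator_def simp del: of_nat_Suc)
  qed
  have sup: "(SUP n. k n z) = ennreal (K z)" if z: "z \<noteq> 0" for z
  proof (rule antisym)
    show "(SUP n. k n z) \<le> ennreal (K z)" by (auto simp: k_def indicator_def intro!: SUP_least)
    obtain n where "1 / real (Suc n) < norm z"
      using reals_Archimedean[of "norm z"] z by (auto simp: inverse_eq_divide)
    then have "k n z = ennreal (K z)" by (simp add: k_def)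
    then show "ennreal (K z) \<le> (SUP n. k n z)" by (metis SUP_upper UNIV_I)
  qed
  have "\<infinity> = (\<integral>\<^sup>+z. ennreal (K z) \<partial>lborel)" using K_nonint by simp
  also have "\<dots> = (\<integral>\<^sup>+z. (SUP n. k n z) \<partial>lborel)"
    using AE_lborel_singleton[of "0::'a"] by (intro nn_integral_cong_AE) (auto simp: sup)
  also have "\<dots> = (SUP n. \<integral>\<^sup>+z. k n z \<partial>lborel)"
    by (rule nn_integral_monotone_convergence_SUP[OF inc k_meas])
  finally have "ennreal c < (SUP n. \<integral>\<^sup>+z. k n z \<partial>lborel)" by (metis ennreal_less_top infinity_ennreal_def)
  then obtain n where "ennreal c < (\<integral>\<^sup>+z. k n z \<partial>lborel)" by (auto simp: less_SUP_iff)
  then show ?thesis by (intro exI[of _ "1 / real (Suc n)"]) (simp add: k_def)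
qed

text \<open>Outside the ball of radius s the kernel is at most M and still has mass c + 1; a set of
  measure at most 1/(M + 1) can take away at most 1 of it, wherever it lies.\<close>

lemma mass_outside_small_set:
  fixes c :: real
  assumes "0 \<le> c"
  shows "\<exists>d>0. \<forall>(U::'a set) x. U \<in> sets borel \<longrightarrow> emeasure lborel U \<le> ennreal d \<longrightarrow>
    ennreal c \<le> (\<integral>\<^sup>+y. ennreal (K (x - y)) * indicator (- U) y \<partial>lborel)"
proof -
  obtain s where s: "0 < s"
    "ennreal (c + 1) \<le> (\<integral>\<^sup>+z. ennreal (K z) * indicator {z. s \<le> norm z} z \<partial>lborel)"
    using truncated_mass by blast
  have s_set [measurable]: "{z::'a. s \<le> norm z} \<in> sets borel" by measurable
  obtain z0 :: 'a where z0: "norm z0 = s" using vector_choose_size[of s] s by auto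
  define M where "M = K z0"
  have M: "K z \<le> M" if "s \<le> norm z" for z unfolding M_def using that z0 s by (intro K_anti) auto
  have M0: "0 \<le> M" by (simp add: M_def K_nonneg)
  show ?thesis
  proof (intro exI[of _ "1 / (M + 1)"] conjI allI impI)
    show "0 < 1 / (M + 1)" using M0 by simp
    fix U :: "'a set" and x :: 'a assume U [measurable]: "U \<in> sets borel" and small: "emeasure lborel U \<le> ennreal (1 / (M + 1))"
    let ?A = "\<integral>\<^sup>+y. ennreal (K (x - y)) * indicator (- U) y \<partial>lborel"
    have "ennreal (c + 1) \<le> (\<integral>\<^sup>+z. ennreal (K z) * indicator {z. s \<le> norm z} z \<partial>lborel)" by (rule s)
    also have "\<dots> = (\<integral>\<^sup>+y. ennreal (K (- x + y)) * indicator {z. s \<le> norm z} (- x + y) \<partial>lborel)"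
      by (rule nn_integral_lborel_translate[symmetric]) measurable
    also have "\<dots> \<le> (\<integral>\<^sup>+y. ennreal (K (x - y)) * indicator (- U) y + ennreal M * indicator U y \<partial>lborel)"
    proof (rule nn_integral_mono)
      fix y
      have "K (- x + y) = K (x - y)" by (rule K_cong) (metis add.commute diff_conv_add_uminus norm_minus_commute)
      then show "ennreal (K (- x + y)) * indicator {z. s \<le> norm z} (- x + y) \<le>
          ennreal (K (x - y)) * indicator (- U) y + ennreal M * indicator U y"
        using M[of "- x + y"] by (auto simp: indicator_def ennreal_leI)
    qed
    also have "\<dots> = ?A + ennreal M * emeasure lborel U"
      by (simp add: nn_integral_add nn_integral_cmult)
    also have "ennreal M * emeasure lborel U \<le> ennreal M * ennreal (1 / (M + 1))"
      by (intro mult_left_mono small) simp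
    also have "\<dots> \<le> 1" using M0 by (simp add: ennreal_mult[symmetric] ennreal_le_1)
    finally have "ennreal c + 1 \<le> ?A + 1" using assms by (simp add: add_left_mono ennreal_plus)
    then show "ennreal c \<le> ?A" by (simp add: add.commute[of _ 1] ennreal_add_left_cancel_le)
  qed
qed

text \<open>A Poincare inequality with an arbitrarily large constant on small supports: for x in U,
  the pairs with y outside U alone already contribute
  \<open>(\<psi> x)\<^sup>2 * K (x - y)\<close>.\<close>

lemma coercive:
  fixes \<mu> :: real
  assumes "0 \<le> \<mu>"
  shows "\<exists>d>0. \<forall>\<psi> U. fin_energy \<psi> \<longrightarrow> U \<in> sets borel \<longrightarrow> (\<forall>x. x \<notin> U \<longrightarrow> \<psi> x = 0) \<longrightarrow>
    emeasure lborel U \<le> ennreal d \<longrightarrow> integrable lborel (\<lambda>x. (\<psi> x)\<^sup>2) \<longrightarrow>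
    \<mu> * (LINT x|lborel. (\<psi> x)\<^sup>2) \<le> E \<psi> \<psi>"
proof -
  obtain d where "0 < d" and d: "\<And>U x. U \<in> sets borel \<Longrightarrow> emeasure lborel U \<le> ennreal d \<Longrightarrow>
    ennreal (2 * \<mu>) \<le> (\<integral>\<^sup>+y. ennreal (K (x - y)) * indicator (- U) y \<partial>lborel)"
    \<comment> \<open>The factor 2 offsets the 1/2 in \<open>E\<close>.\<close>
    using mass_outside_small_set[of "2 * \<mu>"] assms by auto
  show ?thesis
  proof (intro exI[of _ d] conjI allI impI)
    show "0 < d" by fact
    fix \<psi> U assume fe: "fin_energy \<psi>" and U [measurable]: "U \<in> sets borel" and supp: "\<forall>x. x \<notin> U \<longrightarrow> \<psi> x = 0"
      and small: "emeasure lborel U \<le> ennreal d" and int: "integrable lborel (\<lambda>x. (\<psi> x)\<^sup>2)"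
    have [measurable]: "\<psi> \<in> borel_measurable borel" using fe by (simp add: fin_energy_def)
    have "ennreal (2 * \<mu> * (LINT x|lborel. (\<psi> x)\<^sup>2)) = (\<integral>\<^sup>+x. ennreal (2 * \<mu>) * ennreal ((\<psi> x)\<^sup>2) \<partial>lborel)"
      using int assms by (simp add: nn_integral_cmult nn_integral_eq_integral ennreal_mult)
    also have "\<dots> \<le> (\<integral>\<^sup>+x. (\<integral>\<^sup>+y. ennreal (den \<psi> \<psi> (x, y)) \<partial>lborel) \<partial>lborel)"
    proof (rule nn_integral_mono)
      fix x
      have "ennreal (2 * \<mu>) * ennreal ((\<psi> x)\<^sup>2) \<le>
          (\<integral>\<^sup>+y. ennreal (K (x - y)) * indicator (- U) y \<partial>lborel) * ennreal ((\<psi> x)\<^sup>2)"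
        by (intro mult_right_mono d U small) simp
      also have "\<dots> = (\<integral>\<^sup>+y. ennreal (K (x - y)) * indicator (- U) y * ennreal ((\<psi> x)\<^sup>2) \<partial>lborel)"
        by (rule nn_integral_multc[symmetric]) measurable
      also have "\<dots> \<le> (\<integral>\<^sup>+y. ennreal (den \<psi> \<psi> (x, y)) \<partial>lborel)"
      proof (rule nn_integral_mono)
        fix y
        show "ennreal (K (x - y)) * indicator (- U) y * ennreal ((\<psi> x)\<^sup>2) \<le> ennreal (den \<psi> \<psi> (x, y))"
          using supp K_nonneg[of "x - y"]
          by (auto simp: indicator_def den_def power2_eq_square ennreal_mult[symmetric] mult.commute)
      qed
      finally show "ennreal (2 * \<mu>) * ennreal ((\<psi> x)\<^sup>2) \<le> (\<integral>\<^sup>+y. ennreal (den \<psi> \<psi> (x, y)) \<partial>lborel)" .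
    qed
    also have "\<dots> = (\<integral>\<^sup>+p. ennreal (den \<psi> \<psi> p) \<partial>lborel2)"
      by (rule lborel.nn_integral_fst) measurable
    also have "\<dots> = ennreal (2 * E \<psi> \<psi>)"
      using fe by (subst nn_integral_eq_integral) (auto simp: fin_energy_def den_nonneg E_def)
    finally show "\<mu> * (LINT x|lborel. (\<psi> x)\<^sup>2) \<le> E \<psi> \<psi>"
      using E_self_nonneg[of \<psi>] by (simp add: ennreal_le_iff)
  qed
qed

text \<open>Translating in \<open>x\<close> for fixed \<open>z = y - x\<close> moves the difference quotient of \<open>\<psi>\<close> onto \<open>B\<close>, so
  no principal value is needed.\<close>
lemma E_second_difference:
  assumes B: "fin_energy B" and \<psi>: "fin_energy \<psi>" and int\<psi>: "integrable lborel \<psi>"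
    and bound: "\<And>x. \<bar>B x\<bar> \<le> M"
    and diff: "\<And>x z. \<psi> x * (2 * B x - B (x + z) - B (x - z)) \<le> C * \<bar>\<psi> x\<bar> * min 1 ((norm z)\<^sup>2)"
  shows "E B \<psi> \<le> C / 2 * (LINT z|lborel. min 1 ((norm z)\<^sup>2) * K z) * (LINT x|lborel. \<bar>\<psi> x\<bar>)"
proof -
  have [measurable]: "B \<in> borel_measurable borel" "\<psi> \<in> borel_measurable borel"
    using B \<psi> by (auto simp: fin_energy_def)
  let ?T = "\<lambda>(z, x). (x, x + z)"
  let ?I = "LINT x|lborel. \<bar>\<psi> x\<bar>"
  define f where "f = (\<lambda>p. den B \<psi> (?T p))"
  have m: "den B \<psi> \<in> borel_measurable lborel2" by measurable
  have f_int: "integrable lborel2 f"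
    unfolding f_def by (subst integral_shear(1)[OF m]) (rule den_integrable[OF B \<psi>])
  have f_eq: "(LINT p|lborel2. f p) = (LINT p|lborel2. den B \<psi> p)"
    unfolding f_def by (rule integral_shear(2)[OF m])
  have inner: "(LINT x|lborel. f (z, x)) \<le> C * ?I * (min 1 ((norm z)\<^sup>2) * K z)" for z
  proof -
    have bdd: "integrable lborel (\<lambda>x. g x * \<psi> x)"
      if [measurable]: "g \<in> borel_measurable borel" and g: "\<And>x. \<bar>g x\<bar> \<le> 2 * M" for g
    proof (rule Bochner_Integration.integrable_bound)
      show "integrable lborel (\<lambda>x. 2 * M * \<psi> x)" using int\<psi> by simp
      show "AE x in lborel. norm (g x * \<psi> x) \<le> norm (2 * M * \<psi> x)"
      proof (rule AE_I2)
        fix x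
        have "\<bar>g x\<bar> * \<bar>\<psi> x\<bar> \<le> \<bar>2 * M\<bar> * \<bar>\<psi> x\<bar>" using g[of x] by (intro mult_right_mono) auto
        then show "norm (g x * \<psi> x) \<le> norm (2 * M * \<psi> x)" by (simp add: abs_mult)
      qed
    qed measurable
    define g1 where "g1 x = B x - B (x + z)" for x
    define g2 where "g2 x = B (x - z) - B x" for x
    have g_bd: "\<bar>g1 x\<bar> \<le> 2 * M" "\<bar>g2 x\<bar> \<le> 2 * M" for x
      using bound[of x] bound[of "x + z"] bound[of "x - z"] by (auto simp: g1_def g2_def)
    have [measurable]: "g1 \<in> borel_measurable borel" "g2 \<in> borel_measurable borel"
      unfolding g1_def g2_def by measurable
    have i1: "integrable lborel (\<lambda>x. g1 x * \<psi> x)" and i2: "integrable lborel (\<lambda>x. g2 x * \<psi> x)"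
      by (intro bdd g_bd; measurable)+
    \<comment> \<open>\<open>g1\<close> is \<open>g2\<close> shifted by z, so the term carrying
      \<psi>(x + z) becomes one carrying \<psi>(x); what remains is the second difference of
      B.\<close>
    have shift: "(\<lambda>x. g2 (z + x) * \<psi> (z + x)) = (\<lambda>x. g1 x * \<psi> (x + z))"
      by (auto simp: g1_def g2_def add.commute)
    have i3: "integrable lborel (\<lambda>x. g1 x * \<psi> (x + z))"
      and e3: "(LINT x|lborel. g1 x * \<psi> (x + z)) = (LINT x|lborel. g2 x * \<psi> x)"
      using integrable_lborel_translate[OF i2, of z] by (simp_all add: shift)
    have "(LINT x|lborel. f (z, x)) = (LINT x|lborel. (g1 x * \<psi> x - g1 x * \<psi> (x + z)) * K z)"
      by (simp add: f_def den_def g1_def K_minus algebra_simps)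
    also have "\<dots> = (LINT x|lborel. g1 x * \<psi> x - g1 x * \<psi> (x + z)) * K z" by simp
    also have "\<dots> = (LINT x|lborel. g1 x * \<psi> x - g2 x * \<psi> x) * K z"
      using i1 i2 i3 e3 by simp
    also have "\<dots> \<le> (LINT x|lborel. C * min 1 ((norm z)\<^sup>2) * \<bar>\<psi> x\<bar>) * K z"
    proof (intro mult_right_mono integral_mono K_nonneg)
      show "integrable lborel (\<lambda>x. g1 x * \<psi> x - g2 x * \<psi> x)" using i1 i2 by simp
      show "integrable lborel (\<lambda>x. C * min 1 ((norm z)\<^sup>2) * \<bar>\<psi> x\<bar>)" using int\<psi> by simp
      show "g1 x * \<psi> x - g2 x * \<psi> x \<le> C * min 1 ((norm z)\<^sup>2) * \<bar>\<psi> x\<bar>" for x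
        using diff[of x z] by (simp add: g1_def g2_def algebra_simps)
    qed
    also have "\<dots> = C * ?I * (min 1 ((norm z)\<^sup>2) * K z)" by simp
    finally show ?thesis .
  qed
  have "2 * E B \<psi> = (LINT z|lborel. LINT x|lborel. f (z, x))"
    using lborel_pair.integral_fst'[OF f_int] f_eq by (simp add: E_def)
  also have "\<dots> \<le> (LINT z|lborel. C * ?I * (min 1 ((norm z)\<^sup>2) * K z))"
  proof (rule integral_mono)
    show "integrable lborel (\<lambda>z. LINT x|lborel. f (z, x))" by (rule lborel_pair.integrable_fst'[OF f_int])
    show "integrable lborel (\<lambda>z. C * ?I * (min 1 ((norm z)\<^sup>2) * K z))" using K_moment by simp
  qed (rule inner)
  also have "\<dots> = C * ?I * (LINT z|lborel. min 1 ((norm z)\<^sup>2) * K z)" by simp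
  finally show ?thesis by (simp add: algebra_simps)
qed

text \<open>For fixed z the integrand lives where x or x + z is in S, a set of measure at most twice
  that of S; the remaining factor is a multiple of the moment integrand.\<close>

lemma fin_energy_lipschitz:
  assumes [measurable]: "b \<in> borel_measurable borel" "S \<in> sets borel" and S: "emeasure lborel S < \<infinity>"
    and supp: "\<And>x. x \<notin> S \<Longrightarrow> b x = 0"
    and lip: "\<And>x y. (b x - b y)\<^sup>2 \<le> C * min 1 ((norm (x - y))\<^sup>2)"
  shows "fin_energy b"
proof -
  let ?T = "\<lambda>(z, x). (x, x + z)"
  define f where "f = (\<lambda>p. den b b (?T p))"
  have m: "den b b \<in> borel_measurable lborel2" by measurable
  have f_meas [measurable]: "f \<in> borel_measurable lborel2"
    unfolding f_def by (rule measurable_compose[OF preserving_measurable(3) m])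
  have f0: "0 \<le> f p" for p by (simp add: f_def den_nonneg)
  have S_int: "integrable lborel (indicat_real S)" using S by (intro integrable_real_indicator) auto
  note S_int' = integrable_lborel_translate[OF S_int]
  have bd: "f (z, x) \<le> C * min 1 ((norm z)\<^sup>2) * K z * (indicat_real S x + indicat_real S (z + x))" for z x
  proof (cases "x \<in> S \<or> z + x \<in> S")
    case True
    have "f (z, x) \<le> C * min 1 ((norm z)\<^sup>2) * K z"
      using mult_right_mono[OF lip[of x "x + z"] K_nonneg[of z]]
      by (simp add: f_def den_def K_minus power2_eq_square)
    moreover have "0 \<le> C * min 1 ((norm z)\<^sup>2) * K z"
      using f0[of "(z, x)"] calculation by linarith
    ultimately show ?thesis using True
      by (auto simp: indicator_def)
  next
    case False
    then show ?thesis using supp by (auto simp: f_def den_def add.commute)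
  qed
  have bd_int: "integrable lborel (\<lambda>x. C * min 1 ((norm z)\<^sup>2) * K z * (indicat_real S x + indicat_real S (z + x)))" for z
    using S_int S_int'(1)[of z] by simp
  have inner: "integrable lborel (\<lambda>x. f (z, x))" for z
    by (rule Bochner_Integration.integrable_bound[OF bd_int[of z]]) (use bd f0 in \<open>auto intro!: AE_I2 order_trans[OF _ abs_ge_self]\<close>)
  have "integrable lborel2 f"
  proof (rule lborel_pair.Fubini_integrable)
    show "integrable lborel (\<lambda>z. LINT x|lborel. norm (f (z, x)))"
    proof (rule Bochner_Integration.integrable_bound)
      show "integrable lborel (\<lambda>z. 2 * C * measure lborel S * (min 1 ((norm z)\<^sup>2) * K z))"
        using K_moment by simp
      show "AE z in lborel. norm (LINT x|lborel. norm (f (z, x))) \<le>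
          norm (2 * C * measure lborel S * (min 1 ((norm z)\<^sup>2) * K z))"
      proof (rule AE_I2)
        fix z
        have "(LINT x|lborel. f (z, x)) \<le> (LINT x|lborel. C * min 1 ((norm z)\<^sup>2) * K z * (indicat_real S x + indicat_real S (z + x)))"
          by (intro integral_mono inner bd_int bd)
        also have "\<dots> = 2 * C * measure lborel S * (min 1 ((norm z)\<^sup>2) * K z)"
          using S_int S_int'[of z] by simp
        finally show "norm (LINT x|lborel. norm (f (z, x))) \<le> norm (2 * C * measure lborel S * (min 1 ((norm z)\<^sup>2) * K z))"
          using f0 by (simp add: integral_nonneg_AE)
      qed
    qed measurable
  qed (use inner in auto)
  then have "integrable lborel2 (den b b)" unfolding f_def by (subst (asm) integral_shear(1)[OF m])
  then show ?thesis by (simp add: fin_energy_def)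
qed

end

section \<open>The barrier: a truncated paraboloid and its odd extension\<close>

text \<open>A maximum of a concave paraboloid and 0, so its kinks only bend upwards: 2B(x) - B(x +
  z) - B(x - z) is bounded above by a multiple of |z|^2. This one-sided bound is what the barrier
  argument uses.\<close>

definition bump :: "'a::euclidean_space \<Rightarrow> real \<Rightarrow> 'a \<Rightarrow> real" where
  "bump x0 \<rho> x = max 0 (1 - (norm (x - x0))\<^sup>2 / \<rho>\<^sup>2)"

lemma bump_nonneg: "0 \<le> bump x0 \<rho> x" and bump_le_1: "bump x0 \<rho> x \<le> 1"
  by (simp_all add: bump_def)

lemma bump_outside: "0 < \<rho> \<Longrightarrow> \<rho> \<le> norm (x - x0) \<Longrightarrow> bump x0 \<rho> x = 0"
  by (simp add: bump_def power_mono)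

lemma bump_inside:
  assumes "norm (x - x0) < \<rho>" shows "0 < bump x0 \<rho> x"
proof -
  have "0 < \<rho>" using assms norm_ge_zero[of "x - x0"] by linarith
  moreover have "(norm (x - x0))\<^sup>2 < \<rho>\<^sup>2" using assms by (intro power_strict_mono) auto
  ultimately show ?thesis by (simp add: bump_def less_max_iff_disj)
qed

lemma continuous_on_bump: "continuous_on S (bump x0 \<rho>)"
  unfolding bump_def divide_inverse by (intro continuous_intros)

lemma bump_measurable [measurable]: "bump x0 \<rho> \<in> borel_measurable borel"
  by (intro borel_measurable_continuous_onI continuous_on_bump)

text \<open>In terms of the distances to x0 divided by \<rho> and capped at 1, the bump is 1 - s^2,
  so s + t <= 2 yields 4/\<rho>^2; the additional 1 covers |x - y| > 1.\<close>

lemma bump_lipschitz: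
  assumes "0 < \<rho>"
  shows "(bump x0 \<rho> x - bump x0 \<rho> y)\<^sup>2 \<le> (1 + 4 / \<rho>\<^sup>2) * min 1 ((norm (x - y))\<^sup>2)"
proof -
  define s where "s = min 1 (norm (x - x0) / \<rho>)"
  define t where "t = min 1 (norm (y - x0) / \<rho>)"
  have st: "0 \<le> s" "s \<le> 1" "0 \<le> t" "t \<le> 1" using assms by (auto simp: s_def t_def)
  have sq: "max 0 (1 - a\<^sup>2) = 1 - (min 1 a)\<^sup>2" if "0 \<le> a" for a :: real
    using that power_le_one[of a 2] by (cases "a \<le> 1") (auto simp: min_def max_def intro!: antisym one_le_power)
  have bs: "bump x0 \<rho> x = 1 - s\<^sup>2" "bump x0 \<rho> y = 1 - t\<^sup>2"
    using assms sq[of "norm (x - x0) / \<rho>"] sq[of "norm (y - x0) / \<rho>"]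
    by (simp_all add: bump_def s_def t_def power_divide)
  have "\<bar>norm (x - x0) - norm (y - x0)\<bar> \<le> norm (x - y)"
    using norm_triangle_ineq3[of "x - x0" "y - x0"] by simp
  then have "\<bar>norm (x - x0) / \<rho> - norm (y - x0) / \<rho>\<bar> \<le> norm (x - y) / \<rho>"
    using assms by (simp add: diff_divide_distrib[symmetric] divide_right_mono)
  then have d: "\<bar>s - t\<bar> \<le> norm (x - y) / \<rho>" by (auto simp: s_def t_def min_def)
  have "(bump x0 \<rho> x - bump x0 \<rho> y)\<^sup>2 = (s + t)\<^sup>2 * (s - t)\<^sup>2"
    by (simp add: bs power2_eq_square algebra_simps)
  also have "\<dots> \<le> 2\<^sup>2 * (norm (x - y) / \<rho>)\<^sup>2"
  proof (rule mult_mono)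
    show "(s + t)\<^sup>2 \<le> 2\<^sup>2" using st by (intro power_mono) auto
    show "(s - t)\<^sup>2 \<le> (norm (x - y) / \<rho>)\<^sup>2"
      using d assms by (subst abs_le_square_iff[symmetric]) simp
  qed auto
  finally have 1: "(bump x0 \<rho> x - bump x0 \<rho> y)\<^sup>2 \<le> 4 / \<rho>\<^sup>2 * (norm (x - y))\<^sup>2" by (simp add: power_divide)
  have "\<bar>bump x0 \<rho> x - bump x0 \<rho> y\<bar> \<le> 1"
    using bump_nonneg[of x0 \<rho> x] bump_le_1[of x0 \<rho> x] bump_nonneg[of x0 \<rho> y] bump_le_1[of x0 \<rho> y] by linarith
  then have 2: "(bump x0 \<rho> x - bump x0 \<rho> y)\<^sup>2 \<le> 1" by (simp add: abs_square_le_1)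
  show ?thesis
  proof (cases "(norm (x - y))\<^sup>2 \<le> 1")
    case True
    then show ?thesis using 1 by (simp add: min_def distrib_right add_increasing)
  next
    case False
    then show ?thesis using 2 by (simp add: min_def add_increasing2)
  qed
qed

definition odd_bump :: "'a::euclidean_space \<Rightarrow> 'a \<Rightarrow> real \<Rightarrow> 'a \<Rightarrow> real" where
  "odd_bump \<nu> x0 \<rho> x = bump x0 \<rho> x - bump x0 \<rho> (mirror \<nu> x)"

lemma odd_bump_odd: "odd_bump \<nu> x0 \<rho> (mirror \<nu> x) = - odd_bump \<nu> x0 \<rho> x"
  by (simp add: odd_bump_def)

lemma abs_odd_bump_le: "\<bar>odd_bump \<nu> x0 \<rho> x\<bar> \<le> 1"
  using bump_nonneg[of x0 \<rho> x] bump_le_1[of x0 \<rho> x] bump_nonneg[of x0 \<rho> "mirror \<nu> x"] bump_le_1[of x0 \<rho> "mirror \<nu> x"]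
  unfolding odd_bump_def by linarith

lemma odd_bump_half_space:
  assumes \<rho>: "0 < \<rho>" and sep: "\<And>y. norm (y - x0) < \<rho> \<Longrightarrow> 0 < y \<bullet> \<nu>" and x: "0 \<le> x \<bullet> \<nu>"
  shows "odd_bump \<nu> x0 \<rho> x = bump x0 \<rho> x"
proof -
  have "\<not> norm (mirror \<nu> x - x0) < \<rho>" using sep[of "mirror \<nu> x"] x by auto
  then show ?thesis using bump_outside[OF \<rho>, of "mirror \<nu> x" x0] by (simp add: odd_bump_def)
qed

text \<open>For |z| < \<delta> the points x + z and x - z stay where the odd bump is the plain bump.
  The bump lies above its paraboloid and touches it at x, so the parallelogram law gives 2/\<rho>^2.
  For |z| >= \<delta> the crude bound 4 is absorbed by 4/\<delta>^2, where \<delta> <= 1 takes care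
  of the cap in the minimum.\<close>

lemma odd_bump_second_difference:
  assumes \<rho>: "0 < \<rho>" and \<delta>: "0 < \<delta>" "\<delta> \<le> 1"
    and sep: "\<And>y. norm (y - x0) < \<rho> + \<delta> \<Longrightarrow> 0 < y \<bullet> \<nu>" and x: "norm (x - x0) < \<rho>"
  defines "B \<equiv> odd_bump \<nu> x0 \<rho>"
  shows "2 * B x - B (x + z) - B (x - z) \<le> (2 / \<rho>\<^sup>2 + 4 / \<delta>\<^sup>2) * min 1 ((norm z)\<^sup>2)"
proof (cases "norm z < \<delta>")
  case True
  have B: "B y = bump x0 \<rho> y" if "norm (y - x0) < \<rho> + \<delta>" for y
    unfolding B_def using that \<delta> by (intro odd_bump_half_space \<rho>) (auto intro: sep less_imp_le)
  have n: "norm (x + z - x0) < \<rho> + \<delta>" "norm (x - z - x0) < \<rho> + \<delta>"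
    using norm_triangle_ineq[of "x - x0" z] norm_triangle_ineq4[of "x - x0" z] True x
    by (simp_all add: algebra_simps)
  have low: "1 - (norm (y - x0))\<^sup>2 / \<rho>\<^sup>2 \<le> bump x0 \<rho> y" for y by (simp add: bump_def)
  have eq: "bump x0 \<rho> x = 1 - (norm (x - x0))\<^sup>2 / \<rho>\<^sup>2"
    using bump_inside[OF x] by (auto simp: bump_def max_def split: if_splits)
  have par: "(norm (x + z - x0))\<^sup>2 + (norm (x - z - x0))\<^sup>2 = 2 * (norm (x - x0))\<^sup>2 + 2 * (norm z)\<^sup>2"
    by (simp add: power2_norm_eq_inner algebra_simps inner_commute)
  have "2 * B x - B (x + z) - B (x - z) \<le>
      ((norm (x + z - x0))\<^sup>2 + (norm (x - z - x0))\<^sup>2) / \<rho>\<^sup>2 - 2 * (norm (x - x0))\<^sup>2 / \<rho>\<^sup>2"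
    using low[of "x + z"] low[of "x - z"] B[of x] B[OF n(1)] B[OF n(2)] eq x \<delta> by (simp add: add_divide_distrib)
  also have "\<dots> = 2 / \<rho>\<^sup>2 * (norm z)\<^sup>2" by (simp add: par add_divide_distrib)
  also have "\<dots> \<le> (2 / \<rho>\<^sup>2 + 4 / \<delta>\<^sup>2) * (norm z)\<^sup>2" by (intro mult_right_mono) auto
  also have "(norm z)\<^sup>2 = min 1 ((norm z)\<^sup>2)" using True \<delta> power_mono[of "norm z" 1 2] by (simp add: min_def)
  finally show ?thesis .
next
  case False
  have "2 * B x - B (x + z) - B (x - z) \<le> 4"
    using abs_odd_bump_le[of \<nu> x0 \<rho> x] abs_odd_bump_le[of \<nu> x0 \<rho> "x + z"] abs_odd_bump_le[of \<nu> x0 \<rho> "x - z"]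
    unfolding B_def by linarith
  also have "\<dots> = 4 / \<delta>\<^sup>2 * \<delta>\<^sup>2" using \<delta> by simp
  also have "\<dots> \<le> (2 / \<rho>\<^sup>2 + 4 / \<delta>\<^sup>2) * min 1 ((norm z)\<^sup>2)"
    using False \<delta> power_mono[of \<delta> "norm z" 2] power_mono[of \<delta> 1 2] by (intro mult_mono) auto
  finally show ?thesis .
qed

context singular_kernel
begin

lemma fin_energy_bump: "0 < \<rho> \<Longrightarrow> fin_energy (bump x0 \<rho>)"
  by (rule fin_energy_lipschitz[where S = "cball x0 \<rho>" and C = "1 + 4 / \<rho>\<^sup>2"])
    (auto intro: bump_lipschitz bump_outside simp: emeasure_cball dist_norm norm_minus_commute)

lemma fin_energy_odd_bump: "0 < \<rho> \<Longrightarrow> fin_energy (odd_bump \<nu> x0 \<rho>)"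
  unfolding odd_bump_def by (intro fin_energy_diff fin_energy_mirror fin_energy_bump)

text \<open>The second difference is bounded only from above, so the sign of \<psi> on the ball
  matters; on the reflected ball both factors change sign and the product is the same. The constant
  depends on the ball and its margin \<delta> from the hyperplane, not on \<psi>.\<close>

lemma E_odd_bump_le:
  assumes \<rho>: "0 < \<rho>" and \<delta>: "0 < \<delta>" "\<delta> \<le> 1"
    and sep: "\<And>y. norm (y - x0) < \<rho> + \<delta> \<Longrightarrow> 0 < y \<bullet> \<nu>"
  shows "\<exists>C\<ge>0. \<forall>\<psi>. fin_energy \<psi> \<longrightarrow> integrable lborel \<psi> \<longrightarrow> (\<forall>x. \<psi> (mirror \<nu> x) = - \<psi> x) \<longrightarrow>
    (\<forall>x. 0 \<le> (x \<bullet> \<nu>) * \<psi> x) \<longrightarrow>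
    (\<forall>x. \<psi> x \<noteq> 0 \<longrightarrow> norm (x - x0) < \<rho> \<or> norm (mirror \<nu> x - x0) < \<rho>) \<longrightarrow>
    E (odd_bump \<nu> x0 \<rho>) \<psi> \<le> C * (LINT x|lborel. \<bar>\<psi> x\<bar>)"
proof -
  let ?B = "odd_bump \<nu> x0 \<rho>" and ?C = "2 / \<rho>\<^sup>2 + 4 / \<delta>\<^sup>2"
  let ?c = "?C / 2 * (LINT z|lborel. min 1 ((norm z)\<^sup>2) * K z)"
  have c: "0 \<le> ?c" by (intro mult_nonneg_nonneg integral_nonneg_AE AE_I2) (auto simp: K_nonneg)
  show ?thesis
  proof (intro exI[of _ ?c] conjI allI impI c)
    fix \<psi> assume fe: "fin_energy \<psi>" and int: "integrable lborel \<psi>" and odd: "\<forall>x. \<psi> (mirror \<nu> x) = - \<psi> x"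
      and sign: "\<forall>x. 0 \<le> (x \<bullet> \<nu>) * \<psi> x"
      and supp: "\<forall>x. \<psi> x \<noteq> 0 \<longrightarrow> norm (x - x0) < \<rho> \<or> norm (mirror \<nu> x - x0) < \<rho>"
    have near: "\<psi> x * (2 * ?B x - ?B (x + z) - ?B (x - z)) \<le> ?C * \<bar>\<psi> x\<bar> * min 1 ((norm z)\<^sup>2)"
      if x: "norm (x - x0) < \<rho>" for x z
    proof -
      have "0 < x \<bullet> \<nu>" using sep[of x] x \<delta> by simp
      then have "0 \<le> \<psi> x" using sign by (metis zero_le_mult_iff not_le)
      then show ?thesis
        using mult_left_mono[OF odd_bump_second_difference[OF \<rho> \<delta> sep x, of z], of "\<psi> x"]
        by (simp add: algebra_simps)
    qed
    show "E ?B \<psi> \<le> ?c * (LINT x|lborel. \<bar>\<psi> x\<bar>)"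
    proof (rule E_second_difference[OF fin_energy_odd_bump[OF \<rho>] fe int abs_odd_bump_le])
      fix x z
      consider "\<psi> x = 0" | "norm (x - x0) < \<rho>" | "norm (mirror \<nu> x - x0) < \<rho>" using supp by blast
      then show "\<psi> x * (2 * ?B x - ?B (x + z) - ?B (x - z)) \<le> ?C * \<bar>\<psi> x\<bar> * min 1 ((norm z)\<^sup>2)"
      proof cases
        case 3
        have "\<psi> (mirror \<nu> x) * (2 * ?B (mirror \<nu> x) - ?B (mirror \<nu> (x + z)) - ?B (mirror \<nu> (x - z))) =
            \<psi> x * (2 * ?B x - ?B (x + z) - ?B (x - z))"
          using odd by (simp only: odd_bump_odd) (simp add: algebra_simps)
        then show ?thesis using near[OF 3, of "mirror \<nu> z"] odd by (simp add: mirror_add mirror_diff)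
      qed (use near in auto)
    qed
  qed
qed

end

subsection \<open>Maximum principles for the reflected differences\<close>

lemma AE_lborel_open:
  fixes P :: "'a::euclidean_space \<Rightarrow> bool"
  assumes ae: "AE x in lborel. P x" and "open {x. \<not> P x}"
  shows "P x"
proof (rule ccontr)
  assume "\<not> P x"
  then obtain r where r: "0 < r" "ball x r \<subseteq> {x. \<not> P x}"
    using assms(2) unfolding open_contains_ball by blast
  have "AE y in lborel. y \<notin> ball x r" using ae by eventually_elim (use r in auto)
  then have "emeasure lborel (ball x r) = 0" by (subst (asm) AE_iff_measurable[of "ball x r"]) auto
  moreover have "0 < unit_ball_vol (real DIM('a)) * r ^ DIM('a)" using r by simp
  ultimately show False using r by (simp add: emeasure_ball ennreal_eq_0_iff)
qed

text \<open>A continuous image of an interval of radii times a half space of directions.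
  \<open>J\<close> leaves out the radius 0 because the origin, even if it belongs to \<Omega>, is
  not in the open half space.\<close>

lemma connected_radial_half_space:
  fixes \<Omega> :: "'a::euclidean_space set"
  assumes conn: "connected \<Omega>" and radial: "\<And>x y. x \<in> \<Omega> \<Longrightarrow> norm y = norm x \<Longrightarrow> y \<in> \<Omega>"
  shows "connected {x \<in> \<Omega>. 0 < x \<bullet> \<nu>}"
proof -
  define J where "J = norm ` \<Omega> \<inter> {0<..}"
  define H where "H = {y. 0 < y \<bullet> \<nu>}"
  have "is_interval (norm ` \<Omega>)"
    unfolding is_interval_connected_1 by (intro connected_continuous_image conn continuous_intros)
  then have "is_interval J" unfolding J_def by (intro is_interval_Int) (auto simp: is_interval_1)
  then have "connected J" by (simp add: is_interval_connected_1)
  moreover have "connected H"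
    using convex_connected[OF convex_halfspace_gt[of 0 \<nu>]] by (simp add: H_def inner_commute)
  ultimately have JH: "connected (J \<times> H)" by (rule connected_Times)
  have "{x \<in> \<Omega>. 0 < x \<bullet> \<nu>} = (\<lambda>(r, y). (r / norm y) *\<^sub>R y) ` (J \<times> H)"
  proof (intro set_eqI iffI)
    fix x assume x: "x \<in> {x \<in> \<Omega>. 0 < x \<bullet> \<nu>}"
    then have "x \<noteq> 0" by auto
    then have "x = (\<lambda>(r, y). (r / norm y) *\<^sub>R y) (norm x, x)" "(norm x, x) \<in> J \<times> H"
      using x by (auto simp: J_def H_def)
    then show "x \<in> (\<lambda>(r, y). (r / norm y) *\<^sub>R y) ` (J \<times> H)" by (rule image_eqI)
  next
    fix x assume "x \<in> (\<lambda>(r, y). (r / norm y) *\<^sub>R y) ` (J \<times> H)"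
    then obtain r y where ry: "r \<in> J" "y \<in> H" "x = (r / norm y) *\<^sub>R y" by auto
    then have y: "0 < norm y" and r: "0 < r" by (auto simp: H_def J_def)
    have nx: "norm x = r" using y r by (simp add: ry(3))
    obtain z where "z \<in> \<Omega>" "norm z = r" using ry by (auto simp: J_def)
    then have "x \<in> \<Omega>" using radial[of z x] nx by simp
    then show "x \<in> {x \<in> \<Omega>. 0 < x \<bullet> \<nu>}" using ry y r by (simp add: H_def)
  qed
  moreover have "continuous_on (J \<times> H) (\<lambda>(r, y). (r / norm y) *\<^sub>R y)"
    unfolding case_prod_beta by (intro continuous_intros) (auto simp: H_def)
  ultimately show ?thesis using JH by (simp add: connected_continuous_image)
qed

text \<open>\<open>g\<close> stands for \<open>x \<mapsto> f\<^sub>i (\<bar>x\<bar>, u(x))\<close>; the assumptions \<open>g_lower\<close> and \<open>g_strict\<close> are what the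
  proof needs of the regularity and of the cooperativity of \<open>f\<close>.\<close>
locale symmetric_system = singular_kernel K for K :: "'a::euclidean_space \<Rightarrow> real" +
  fixes \<Omega> :: "'a set" and u g :: "'m::finite \<Rightarrow> 'a \<Rightarrow> real" and L :: real
  assumes open_\<Omega>: "open \<Omega>" and bounded_\<Omega>: "bounded \<Omega>" and connected_\<Omega>: "connected \<Omega>"
    and radial_\<Omega>: "x \<in> \<Omega> \<Longrightarrow> norm y = norm x \<Longrightarrow> y \<in> \<Omega>"
    and u_cont: "continuous_on UNIV (u i)" and u_zero: "x \<notin> \<Omega> \<Longrightarrow> u i x = 0"
    and u_energy: "fin_energy (u i)"
    and g_meas [measurable]: "g i \<in> borel_measurable borel" and g_bound: "\<exists>M. \<forall>x. \<bar>g i x\<bar> \<le> M"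
    and weak: "fin_energy \<phi> \<Longrightarrow> (\<And>x. x \<notin> \<Omega> \<Longrightarrow> \<phi> x = 0) \<Longrightarrow> (\<And>x. \<bar>\<phi> x\<bar> \<le> M) \<Longrightarrow>
      E (u i) \<phi> = (LINT x|lborel. g i x * \<phi> x)"
    and L_nonneg: "0 \<le> L"
    and g_lower: "x \<in> \<Omega> \<Longrightarrow> x \<noteq> 0 \<Longrightarrow> norm y = norm x \<Longrightarrow>
      g i y - g i x \<le> L * (\<bar>u i x - u i y\<bar> + (\<Sum>j\<in>UNIV. max 0 (u j y - u j x)))"
    and g_strict: "x \<in> \<Omega> \<Longrightarrow> x \<noteq> 0 \<Longrightarrow> norm y = norm x \<Longrightarrow> u i x = u i y \<Longrightarrow>
      (\<And>j. u j y \<le> u j x) \<Longrightarrow> u j y < u j x \<Longrightarrow> g i y < g i x"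
begin

definition w :: "'a \<Rightarrow> 'm \<Rightarrow> 'a \<Rightarrow> real" where
  "w \<nu> i x = u i x - u i (mirror \<nu> x)"

lemma mirror_in_\<Omega> [simp]: "mirror \<nu> x \<in> \<Omega> \<longleftrightarrow> x \<in> \<Omega>"
  using radial_\<Omega>[of x "mirror \<nu> x"] radial_\<Omega>[of "mirror \<nu> x" x] by auto

lemma w_odd: "w \<nu> i (mirror \<nu> x) = - w \<nu> i x"
  by (simp add: w_def)

lemma w_zero: "x \<notin> \<Omega> \<Longrightarrow> w \<nu> i x = 0"
  by (simp add: w_def u_zero)

lemma u_cont' [continuous_intros]: "continuous_on S h \<Longrightarrow> continuous_on S (\<lambda>x. u i (h x))"
  by (rule continuous_on_compose2[OF u_cont]) auto

lemma w_cont [continuous_intros]: "continuous_on S (w \<nu> i)"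
  unfolding w_def by (intro continuous_intros)

lemma w_meas [measurable]: "w \<nu> i \<in> borel_measurable borel"
  by (intro borel_measurable_continuous_onI continuous_intros)

lemma w_energy: "fin_energy (w \<nu> i)"
  unfolding w_def by (intro fin_energy_diff fin_energy_mirror u_energy)

lemma u_bounded: "\<exists>M. \<forall>x. \<bar>u i x\<bar> \<le> M"
proof -
  have "compact (closure \<Omega>)" using bounded_\<Omega> by simp
  then have "bounded (u i ` closure \<Omega>)"
    by (intro compact_imp_bounded compact_continuous_image continuous_intros)
  then obtain M where M: "\<And>x. x \<in> closure \<Omega> \<Longrightarrow> \<bar>u i x\<bar> \<le> M" by (auto simp: bounded_iff)
  have "\<bar>u i x\<bar> \<le> max 0 M" for x
  proof (cases "x \<in> \<Omega>")
    case True then show ?thesis using M[of x] closure_subset[of \<Omega>] by auto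
  qed (simp add: u_zero)
  then show ?thesis by blast
qed

lemma w_bounded: "\<exists>M. \<forall>x. \<bar>w \<nu> i x\<bar> \<le> M"
proof -
  obtain M where M: "\<And>x. \<bar>u i x\<bar> \<le> M" using u_bounded by blast
  have "\<bar>w \<nu> i x\<bar> \<le> 2 * M" for x
    using M[of x] M[of "mirror \<nu> x"] unfolding w_def by linarith
  then show ?thesis by blast
qed

lemma integrable_bounded:
  assumes [measurable]: "h \<in> borel_measurable borel" and "\<And>x. \<bar>h x\<bar> \<le> M" "\<And>x. x \<notin> \<Omega> \<Longrightarrow> h x = (0::real)"
  shows "integrable lborel h"
proof (rule Bochner_Integration.integrable_bound)
  show "integrable lborel (\<lambda>x. M * indicat_real \<Omega> x)"
    using open_\<Omega> emeasure_bounded_finite[OF bounded_\<Omega>]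
    by (intro integrable_mult_right integrable_real_indicator) auto
  show "AE x in lborel. norm (h x) \<le> norm (M * indicat_real \<Omega> x)"
  proof (rule AE_I2)
    fix x show "norm (h x) \<le> norm (M * indicat_real \<Omega> x)"
      using assms(2)[of x] assms(3)[of x] by (auto simp: indicator_def)
  qed
qed measurable

lemma g_times_integrable:
  assumes [measurable]: "\<phi> \<in> borel_measurable borel" and "\<And>x. \<bar>\<phi> x\<bar> \<le> M" "\<And>x. x \<notin> \<Omega> \<Longrightarrow> \<phi> x = 0"
  shows "integrable lborel (\<lambda>x. g i x * \<phi> x)" "integrable lborel (\<lambda>x. g i (mirror \<nu> x) * \<phi> x)"
proof -
  obtain C where C: "\<And>x. \<bar>g i x\<bar> \<le> C" using g_bound by blast
  have "\<bar>g i y * \<phi> x\<bar> \<le> C * M" for x y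
    using C[of y] assms(2)[of x] unfolding abs_mult
    by (intro mult_mono) (auto intro: order_trans[OF abs_ge_zero])
  then show "integrable lborel (\<lambda>x. g i x * \<phi> x)" "integrable lborel (\<lambda>x. g i (mirror \<nu> x) * \<phi> x)"
    using assms(3) by (auto intro!: integrable_bounded[where M = "C * M"])
qed

text \<open>An odd test function doubles both sides of the equation: E(w, \<phi>) = 2 E(u, \<phi>),
  and a reflection turns the second half of the right-hand side into another copy of the integral of
  g \<phi>.\<close>

lemma weak_odd:
  assumes fe: "fin_energy \<phi>" and supp: "\<And>x. x \<notin> \<Omega> \<Longrightarrow> \<phi> x = 0" and bd: "\<And>x. \<bar>\<phi> x\<bar> \<le> M"
    and odd: "\<And>x. \<phi> (mirror \<nu> x) = - \<phi> x"
  shows "integrable lborel (\<lambda>x. (g i x - g i (mirror \<nu> x)) * \<phi> x)"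
    "E (w \<nu> i) \<phi> = (LINT x|lborel. (g i x - g i (mirror \<nu> x)) * \<phi> x)"
proof -
  have [measurable]: "\<phi> \<in> borel_measurable borel" "u i \<in> borel_measurable borel"
    using fe u_energy by (auto simp: fin_energy_def)
  note int = g_times_integrable(1)[where i=i, OF _ bd supp] g_times_integrable(2)[where i=i and \<nu>=\<nu>, OF _ bd supp]
  show "integrable lborel (\<lambda>x. (g i x - g i (mirror \<nu> x)) * \<phi> x)"
    using int by (simp add: left_diff_distrib)
  have "(LINT x|lborel. g i (mirror \<nu> x) * \<phi> x) = (LINT x|lborel. g i (mirror \<nu> x) * - \<phi> (mirror \<nu> x))"
    by (simp add: odd)
  also have "\<dots> = (LINT x|lborel. g i x * - \<phi> x)"
    by (rule integral_mirror) measurable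
  finally have "(LINT x|lborel. g i (mirror \<nu> x) * \<phi> x) = - (LINT x|lborel. g i x * \<phi> x)" by simp
  then have "(LINT x|lborel. (g i x - g i (mirror \<nu> x)) * \<phi> x) = 2 * (LINT x|lborel. g i x * \<phi> x)"
    using int by (simp add: left_diff_distrib)
  moreover have "E (w \<nu> i) \<phi> = E (u i) \<phi> - E (\<lambda>x. u i (mirror \<nu> x)) \<phi>"
    unfolding w_def by (intro E_diff_left fin_energy_mirror u_energy fe)
  moreover have "E (\<lambda>x. u i (mirror \<nu> x)) \<phi> = - E (u i) \<phi>"
    by (rule E_mirror_odd) (use odd in auto)
  moreover have "E (u i) \<phi> = (LINT x|lborel. g i x * \<phi> x)" by (rule weak[OF fe supp bd])
  ultimately show "E (w \<nu> i) \<phi> = (LINT x|lborel. (g i x - g i (mirror \<nu> x)) * \<phi> x)" by simp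
qed

text \<open>Tested with \<psi>_i, the odd negative part of w_i, the equation bounds E(\<psi>_i,
  \<psi>_i) by terms quadratic in \<psi>; coercivity with a large constant leaves only \<psi> = 0.
  The threshold d does not depend on \<nu>, on which openness of S relies.\<close>

lemma small_volume_maximum_principle:
  "\<exists>d>0. \<forall>\<nu>. emeasure lborel {x \<in> \<Omega>. \<exists>i. (x \<bullet> \<nu>) * w \<nu> i x < 0} \<le> ennreal d \<longrightarrow>
    (\<forall>i x. 0 \<le> (x \<bullet> \<nu>) * w \<nu> i x)"
proof -
  let ?m = "real CARD('m)"
  \<comment> \<open>Summing the inequalities of \<open>step\<close> over the m components yields the
    factor L (1 + m) + L m; the extra 1 makes the comparison strict.\<close>
  define \<mu> where "\<mu> = L * (1 + 2 * ?m) + 1"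
  have "0 \<le> \<mu>" using L_nonneg by (simp add: \<mu>_def)
  then obtain d where "0 < d" and d: "\<And>\<psi> U. fin_energy \<psi> \<Longrightarrow> U \<in> sets borel \<Longrightarrow> (\<And>x. x \<notin> U \<Longrightarrow> \<psi> x = 0) \<Longrightarrow>
    emeasure lborel U \<le> ennreal d \<Longrightarrow> integrable lborel (\<lambda>x. (\<psi> x)\<^sup>2) \<Longrightarrow>
    \<mu> * (LINT x|lborel. (\<psi> x)\<^sup>2) \<le> E \<psi> \<psi>"
    using coercive[of \<mu>] by blast
  show ?thesis
  proof (intro exI[of _ d] conjI allI impI)
    show "0 < d" by fact
    fix \<nu> i0 x0
    let ?U = "{x \<in> \<Omega>. \<exists>i. (x \<bullet> \<nu>) * w \<nu> i x < 0}"
    assume small: "emeasure lborel ?U \<le> ennreal d"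
    define \<psi> where "\<psi> i = npart \<nu> (w \<nu> i)" for i
    have fe: "fin_energy (\<psi> i)" for i unfolding \<psi>_def by (intro fin_energy_npart w_energy w_odd)
    then have [measurable]: "\<psi> i \<in> borel_measurable borel" for i by (simp add: fin_energy_def)
    have odd: "\<psi> i (mirror \<nu> x) = - \<psi> i x" for i x unfolding \<psi>_def by (intro npart_odd w_odd)
    have neg: "(x \<bullet> \<nu>) * w \<nu> i x < 0" if "\<psi> i x \<noteq> 0" for i x
      using that by (auto simp: \<psi>_def npart_def mult_less_0_iff split: if_splits)
    have supp\<Omega>: "\<psi> i x = 0" if "x \<notin> \<Omega>" for i x
      using neg[of i x] w_zero[OF that] by fastforce
    have supp: "\<psi> i x = 0" if "x \<notin> ?U" for i x
      using neg[of i x] supp\<Omega>[of x i] that by blast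
    have bd: "\<exists>M. \<forall>x. \<bar>\<psi> i x\<bar> \<le> M" for i
    proof -
      obtain M where "\<And>x. \<bar>w \<nu> i x\<bar> \<le> M" using w_bounded by blast
      then show ?thesis using abs_npart_le[of \<nu> "w \<nu> i"] by (auto simp: \<psi>_def intro: order_trans)
    qed
    have sq_int: "integrable lborel (\<lambda>x. (\<psi> i x)\<^sup>2)" for i
    proof -
      obtain M where M: "\<And>x. \<bar>\<psi> i x\<bar> \<le> M" using bd by blast
      have "\<bar>(\<psi> i x)\<^sup>2\<bar> \<le> M\<^sup>2" for x using power_mono[OF M[of x], of 2] by simp
      then show ?thesis by (rule integrable_bounded[rotated]) (auto simp: supp\<Omega>)
    qed
    have U_meas: "?U \<in> sets borel"
      using open_\<Omega> by measurable
    define S where "S i = (LINT x|lborel. (\<psi> i x)\<^sup>2)" for i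
    have S0: "0 \<le> S i" for i by (simp add: S_def)
    have coer: "\<mu> * S i \<le> E (\<psi> i) (\<psi> i)" for i
      unfolding S_def by (rule d[OF fe U_meas supp small sq_int])
    let ?R = "\<lambda>i x. L * ((1 + ?m) * (\<psi> i x)\<^sup>2 + (\<Sum>j\<in>UNIV. (\<psi> j x)\<^sup>2))"
    have near: "(g i (mirror \<nu> x) - g i x) * \<psi> i x \<le> ?R i x" if x: "0 < x \<bullet> \<nu>" for i x
    proof (cases "\<psi> i x = 0")
      case True
      then show ?thesis using L_nonneg by (simp add: sum_nonneg)
    next
      case False
      then have x\<Omega>: "x \<in> \<Omega>" "x \<noteq> 0" using supp\<Omega> x by auto
      \<comment> \<open>On the half space the excess of u_j at the mirror point is exactly \<psi>_j,
        so \<open>g_lower\<close> closes up in terms of the \<psi>_j.\<close>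
      have max: "max 0 (u j (mirror \<nu> x) - u j x) = \<psi> j x" for j
        using x by (simp add: \<psi>_def npart_def w_def)
      have abs: "\<bar>u i x - u i (mirror \<nu> x)\<bar> = \<psi> i x" using False x
        by (auto simp: \<psi>_def npart_def w_def)
      have pos: "0 \<le> \<psi> i x" using x by (simp add: \<psi>_def npart_def)
      have "g i (mirror \<nu> x) - g i x \<le> L * (\<psi> i x + (\<Sum>j\<in>UNIV. \<psi> j x))"
        using g_lower[OF x\<Omega>, of "mirror \<nu> x" i] by (simp add: max abs)
      then have "(g i (mirror \<nu> x) - g i x) * \<psi> i x \<le> L * (\<psi> i x + (\<Sum>j\<in>UNIV. \<psi> j x)) * \<psi> i x"
        using pos by (intro mult_right_mono)
      also have "\<dots> = L * ((\<psi> i x)\<^sup>2 + (\<Sum>j\<in>UNIV. \<psi> j x * \<psi> i x))"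
        by (simp add: power2_eq_square algebra_simps sum_distrib_left)
      also have "\<dots> \<le> L * ((\<psi> i x)\<^sup>2 + (\<Sum>j\<in>UNIV. (\<psi> i x)\<^sup>2 + (\<psi> j x)\<^sup>2))"
      proof (intro mult_left_mono add_left_mono sum_mono L_nonneg)
        fix j
        have "(\<psi> i x)\<^sup>2 + (\<psi> j x)\<^sup>2 - \<psi> j x * \<psi> i x = (\<psi> i x - \<psi> j x / 2)\<^sup>2 + 3 / 4 * (\<psi> j x)\<^sup>2"
          by (simp add: power2_eq_square algebra_simps)
        also have "\<dots> \<ge> 0" by (intro add_nonneg_nonneg) auto
        finally show "\<psi> j x * \<psi> i x \<le> (\<psi> i x)\<^sup>2 + (\<psi> j x)\<^sup>2" by linarith
      qed
      also have "\<dots> = ?R i x" by (simp add: sum.distrib algebra_simps)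
      finally show ?thesis .
    qed
    have pt: "(g i (mirror \<nu> x) - g i x) * \<psi> i x \<le> ?R i x" for i x
    proof -
      consider "0 < x \<bullet> \<nu>" | "x \<bullet> \<nu> < 0" | "x \<bullet> \<nu> = 0" by linarith
      then show ?thesis
      proof cases
        case 2
        then have "(g i x - g i (mirror \<nu> x)) * - \<psi> i x \<le> ?R i x"
          using near[of "mirror \<nu> x" i] by (simp add: odd)
        then show ?thesis by (simp add: algebra_simps)
      next
        case 3
        then have "\<psi> i x = 0" by (simp add: \<psi>_def npart_def)
        then show ?thesis using L_nonneg by (simp add: sum_nonneg)
      qed (rule near)
    qed
    have step: "\<mu> * S i \<le> L * ((1 + ?m) * S i + (\<Sum>j\<in>UNIV. S j))" for i
    proof -
      obtain M where M: "\<And>x. \<bar>\<psi> i x\<bar> \<le> M" using bd by blast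
      note wk = weak_odd[OF fe supp\<Omega> M odd, of i]
      have "E (w \<nu> i) (\<psi> i) \<le> - E (\<psi> i) (\<psi> i)"
        using E_npart[OF w_energy w_odd, of \<nu> i] E_pos_npart_nonpos[OF w_energy w_odd, of \<nu> i]
        by (simp add: \<psi>_def)
      then have "\<mu> * S i \<le> (LINT x|lborel. - ((g i x - g i (mirror \<nu> x)) * \<psi> i x))"
        using coer[of i] wk(2) by simp
      also have "\<dots> \<le> (LINT x|lborel. ?R i x)"
      proof (rule integral_mono)
        show "integrable lborel (\<lambda>x. - ((g i x - g i (mirror \<nu> x)) * \<psi> i x))"
          by (rule Bochner_Integration.integrable_minus[OF wk(1)])
        show "integrable lborel (?R i)" using sq_int by simp
        show "- ((g i x - g i (mirror \<nu> x)) * \<psi> i x) \<le> ?R i x" for x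
          using pt[of i x] by (simp only: minus_mult_left minus_diff_eq)
      qed
      also have "\<dots> = L * ((1 + ?m) * S i + (\<Sum>j\<in>UNIV. S j))"
        using sq_int by (simp add: S_def Bochner_Integration.integral_add Bochner_Integration.integral_sum)
      finally show ?thesis .
    qed
    have "\<mu> * (\<Sum>i\<in>UNIV. S i) = (\<Sum>i\<in>UNIV. \<mu> * S i)" by (rule sum_distrib_left)
    also have "\<dots> \<le> (\<Sum>i\<in>UNIV. L * ((1 + ?m) * S i + (\<Sum>j\<in>UNIV. S j)))"
      by (rule sum_mono) (rule step)
    also have "\<dots> = L * (1 + 2 * ?m) * (\<Sum>i\<in>UNIV. S i)"
      by (simp add: sum_distrib_left[symmetric] sum_distrib_right[symmetric] sum.distrib algebra_simps)
    finally have "(\<Sum>i\<in>UNIV. S i) \<le> 0"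
      by (simp add: \<mu>_def distrib_right)
    then have "S i0 = 0"
      using S0 sum_nonneg_eq_0_iff[of UNIV S] sum_nonneg[of UNIV S] by (metis UNIV_I antisym finite)
    then have ae: "AE x in lborel. (\<psi> i0 x)\<^sup>2 = 0"
      unfolding S_def by (subst (asm) integral_nonneg_eq_0_iff_AE[OF sq_int]) auto
    have "AE x in lborel. 0 \<le> (x \<bullet> \<nu>) * w \<nu> i0 x"
      using ae
    proof eventually_elim
      case (elim x)
      then show ?case by (auto simp: \<psi>_def npart_def zero_le_mult_iff split: if_splits)
    qed
    moreover have "open {x. \<not> 0 \<le> (x \<bullet> \<nu>) * w \<nu> i0 x}"
      unfolding not_le by (intro open_Collect_less continuous_intros)
    ultimately show "0 \<le> (x0 \<bullet> \<nu>) * w \<nu> i0 x0" by (rule AE_lborel_open)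
  qed
qed

end

section \<open>Strong maximum principle and coupling of the components\<close>

context symmetric_system
begin

lemma open_half_domain: "open {x \<in> \<Omega>. 0 < x \<bullet> \<nu>}"
proof -
  have "open {x. 0 < x \<bullet> \<nu>}" by (intro open_Collect_less continuous_intros)
  then show ?thesis using open_\<Omega> by (simp add: Collect_conj_eq open_Int)
qed

lemma half_domain_ball:
  assumes "x0 \<in> \<Omega>" "0 < x0 \<bullet> \<nu>"
  obtains r where "0 < r" "\<And>y. norm (y - x0) < r \<Longrightarrow> y \<in> \<Omega> \<and> 0 < y \<bullet> \<nu>"
proof -
  obtain r where "0 < r" "ball x0 r \<subseteq> {x \<in> \<Omega>. 0 < x \<bullet> \<nu>}"
    using open_half_domain[of \<nu>] assms unfolding open_contains_ball by blast
  then show ?thesis using that[of r] by (auto simp: subset_iff dist_norm norm_minus_commute)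
qed

text \<open>If w_i were positive at points arbitrarily near its zero x0, take a ball A around such a
  point and a disjoint ball Q around x0. Through the kernel, the values on A act on the part \<psi>
  of the barrier \<epsilon> B that sticks out above w_i on Q, with a strength proportional to m,
  whereas reaction and barrier energy cost only O(\<epsilon>). For small \<epsilon> this forces
  \<psi> = 0, hence w_i(x0) >= \<epsilon>.\<close>

lemma strong_maximum_local:
  assumes nonneg: "\<And>j x. 0 \<le> (x \<bullet> \<nu>) * w \<nu> j x"
    and x0: "x0 \<in> \<Omega>" "0 < x0 \<bullet> \<nu>" "w \<nu> i x0 = 0"
  shows "\<exists>r>0. \<forall>y. norm (y - x0) < r \<longrightarrow> w \<nu> i y = 0"
proof (rule ccontr)
  assume contra: "\<not> ?thesis"
  have pos: "0 \<le> w \<nu> j x" if "0 < x \<bullet> \<nu>" for j x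
    using nonneg[of x j] that by (simp add: zero_le_mult_iff)
  obtain r1 where r1: "0 < r1" "\<And>y. norm (y - x0) < r1 \<Longrightarrow> y \<in> \<Omega> \<and> 0 < y \<bullet> \<nu>"
    using half_domain_ball[OF x0(1,2)] by blast
  obtain z1 :: 'a where z1: "norm z1 = r1 / 2" using vector_choose_size[of "r1 / 2"] r1(1) by auto
  \<comment> \<open>Mirror images of points of the half space stay out of the ball of radius r1
    around x0, so for x in half that ball the subtracted kernel is bounded by a constant.\<close>
  have Kfar: "K (x - mirror \<nu> y) \<le> K z1" if "norm (x - x0) < r1 / 2" "0 < y \<bullet> \<nu>" for x y
  proof (rule K_anti)
    have "\<not> norm (mirror \<nu> y - x0) < r1" using r1(2)[of "mirror \<nu> y"] that by auto
    then have "r1 \<le> norm ((x - x0) - (x - mirror \<nu> y))" by (simp add: norm_minus_commute)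
    also have "\<dots> \<le> norm (x - x0) + norm (x - mirror \<nu> y)" by (rule norm_triangle_ineq4)
    finally show "norm z1 \<le> norm (x - mirror \<nu> y)" using that z1 by simp
  qed (use z1 r1 in auto)
  \<comment> \<open>At distances below \<rho>0 the kernel exceeds that constant by 1, which makes
    the kernel difference at least 1 between A and Q.\<close>
  obtain \<rho>0 where \<rho>0: "0 < \<rho>0" "\<And>z. z \<noteq> 0 \<Longrightarrow> norm z < \<rho>0 \<Longrightarrow> K z1 + 1 < K z"
    using K_unbounded[of "K z1 + 1"] by blast
  define r where "r = min (r1 / 4) (\<rho>0 / 4)"
  have r: "0 < r" "r \<le> r1 / 4" "r \<le> \<rho>0 / 4" using r1 \<rho>0 by (auto simp: r_def)
  obtain y0 where y0: "norm (y0 - x0) < r" "w \<nu> i y0 \<noteq> 0" using contra r(1) by blast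
  \<comment> \<open>As |y0 - x0| = 3s, a ball of radius s around x0 and one of radius at most s
    around y0 are disjoint; both are small on the scales r1 and \<rho>0.\<close>
  define s where "s = norm (y0 - x0) / 3"
  have s: "0 < s" "norm (y0 - x0) = 3 * s" "3 * s < r" using y0 x0 by (auto simp: s_def)
  define \<delta>0 where "\<delta>0 = w \<nu> i y0 / 2"
  have "0 < w \<nu> i y0" using pos[of y0 i] r1(2)[of y0] y0 r r1(1) by force
  then have \<delta>0: "0 < \<delta>0" "\<delta>0 < w \<nu> i y0" by (auto simp: \<delta>0_def)
  have "open {x. \<delta>0 < w \<nu> i x}" by (intro open_Collect_less continuous_intros)
  then obtain t0 where t0: "0 < t0" "ball y0 t0 \<subseteq> {x. \<delta>0 < w \<nu> i x}"
    unfolding open_contains_ball using \<delta>0(2) by blast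
  define t where "t = min t0 s"
  define A where "A = ball y0 t"
  define Q where "Q = ball x0 s"
  have t: "0 < t" "t \<le> s" using t0 s by (auto simp: t_def)
  have A: "\<delta>0 < w \<nu> i x" "norm (x - y0) < s" if "x \<in> A" for x
    using that t0 by (auto simp: A_def t_def subset_iff dist_norm norm_minus_commute)
  have A': "norm (x - x0) < 4 * s" "s < norm (x - x0)" if "x \<in> A" for x
    using A(2)[OF that] s norm_triangle_ineq[of "x - y0" "y0 - x0"] norm_triangle_ineq4[of "x - y0" "x - x0"]
    by (simp_all add: norm_minus_commute)
  have Q_iff: "x \<in> Q \<longleftrightarrow> norm (x - x0) < s" for x by (simp add: Q_def dist_norm norm_minus_commute)
  have inH: "x \<in> \<Omega> \<and> 0 < x \<bullet> \<nu>" if "norm (x - x0) < 4 * s" for x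
    using r1(2)[of x] that s r r1(1) by simp
  have gap: "1 \<le> K (x - y) - K (x - mirror \<nu> y)" if "x \<in> A" "y \<in> Q" for x y
  proof -
    have y: "norm (y - x0) < s" using that by (simp add: Q_iff)
    have "x \<noteq> y" using A'(2)[OF that(1)] y by auto
    moreover have "norm (x - y) < \<rho>0"
      using norm_triangle_ineq4[of "x - x0" "y - x0"] A'(1)[OF that(1)] y s r \<rho>0(1) by simp
    ultimately have "K z1 + 1 < K (x - y)" using \<rho>0(2)[of "x - y"] by simp
    moreover have "K (x - mirror \<nu> y) \<le> K z1"
      using A'(1)[OF that(1)] s r r1(1) inH[of y] y by (intro Kfar) auto
    ultimately show ?thesis by simp
  qed
  let ?B = "odd_bump \<nu> x0 s"
  define \<delta> where "\<delta> = min 1 (r1 / 2)"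
  have \<delta>: "0 < \<delta>" "\<delta> \<le> 1" "\<delta> \<le> r1 / 2" using r1 by (auto simp: \<delta>_def)
  have sep: "0 < y \<bullet> \<nu>" if "norm (y - x0) < s + \<delta>" for y
    using r1(2)[of y] that s r \<delta> r1(1) by simp
  have "\<exists>C\<ge>0. \<forall>\<psi>. fin_energy \<psi> \<longrightarrow> integrable lborel \<psi> \<longrightarrow> (\<forall>x. \<psi> (mirror \<nu> x) = - \<psi> x) \<longrightarrow>
    (\<forall>x. 0 \<le> (x \<bullet> \<nu>) * \<psi> x) \<longrightarrow>
    (\<forall>x. \<psi> x \<noteq> 0 \<longrightarrow> norm (x - x0) < s \<or> norm (mirror \<nu> x - x0) < s) \<longrightarrow>
    E ?B \<psi> \<le> C * (LINT x|lborel. \<bar>\<psi> x\<bar>)"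
    by (rule E_odd_bump_le[OF s(1) \<delta>(1,2)]) (rule sep)
  then obtain C where C: "0 \<le> C"
    and E_le: "\<And>\<psi>. fin_energy \<psi> \<longrightarrow> integrable lborel \<psi> \<longrightarrow> (\<forall>x. \<psi> (mirror \<nu> x) = - \<psi> x) \<longrightarrow>
    (\<forall>x. 0 \<le> (x \<bullet> \<nu>) * \<psi> x) \<longrightarrow>
    (\<forall>x. \<psi> x \<noteq> 0 \<longrightarrow> norm (x - x0) < s \<or> norm (mirror \<nu> x - x0) < s) \<longrightarrow>
    E ?B \<psi> \<le> C * (LINT x|lborel. \<bar>\<psi> x\<bar>)"
    by auto
  define m where "m = \<delta>0 * measure lborel A"
  have "0 < measure lborel A" using t by (simp add: A_def content_ball_pos)
  then have m: "0 < m" using \<delta>0 by (simp add: m_def)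
  define D where "D = L + C + 1"
  \<comment> \<open>Chosen so that the final estimate reads m P / 4 <= 2 \<epsilon> D P = m P / 8,
    impossible for P > 0.\<close>
  define \<epsilon> where "\<epsilon> = m / (16 * D)"
  have LC: "0 < D" "L + C \<le> D" using L_nonneg C by (simp_all add: D_def)
  have \<epsilon>: "0 < \<epsilon>" using m LC by (simp add: \<epsilon>_def)
  define h where "h x = w \<nu> i x - \<epsilon> * ?B x" for x
  define \<psi> where "\<psi> = npart \<nu> h"
  have h_odd: "h (mirror \<nu> x) = - h x" for x by (simp add: h_def w_odd odd_bump_odd)
  have B_fe: "fin_energy ?B" by (rule fin_energy_odd_bump[OF s(1)])
  have h_fe: "fin_energy h" unfolding h_def by (intro fin_energy_diff fin_energy_scale w_energy B_fe)
  have \<psi>_fe: "fin_energy \<psi>" unfolding \<psi>_def by (intro fin_energy_npart h_fe h_odd)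
  then have [measurable]: "\<psi> \<in> borel_measurable borel" by (simp add: fin_energy_def)
  have \<psi>_odd: "\<psi> (mirror \<nu> x) = - \<psi> x" for x unfolding \<psi>_def by (intro npart_odd h_odd)
  have \<psi>_sign: "0 \<le> (x \<bullet> \<nu>) * \<psi> x" for x unfolding \<psi>_def by (rule npart_sign)
  have B_half: "?B x = bump x0 s x" if "0 \<le> x \<bullet> \<nu>" for x
    using that sep \<delta>(1) by (intro odd_bump_half_space s(1)) auto
  have near: "x \<in> Q \<and> \<psi> x \<le> \<epsilon> \<and> w \<nu> i x \<le> \<epsilon>" if x: "0 < x \<bullet> \<nu>" "\<psi> x \<noteq> 0" for x
  proof -
    have neg: "w \<nu> i x < \<epsilon> * bump x0 s x" and \<psi>x: "\<psi> x = \<epsilon> * bump x0 s x - w \<nu> i x"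
      using x B_half[of x] by (auto simp: \<psi>_def npart_def h_def max_def split: if_splits)
    have "0 < \<epsilon> * bump x0 s x" using neg pos[OF x(1), of i] by linarith
    then have "bump x0 s x \<noteq> 0" by auto
    then have "x \<in> Q" using bump_outside[OF s(1), of x x0] by (force simp: Q_iff)
    moreover have "\<epsilon> * bump x0 s x \<le> \<epsilon>" using \<epsilon> bump_le_1[of x0 s x] by simp
    ultimately show ?thesis using neg \<psi>x pos[OF x(1), of i] by linarith
  qed
  have \<psi>_pos: "0 \<le> \<psi> x" if "0 < x \<bullet> \<nu>" for x
    using \<psi>_sign[of x] that by (simp add: zero_le_mult_iff)
  have sides: "P x" if "\<And>x. 0 < x \<bullet> \<nu> \<Longrightarrow> P x" "\<And>x. P (mirror \<nu> x) \<Longrightarrow> P x" "\<And>x. x \<bullet> \<nu> = 0 \<Longrightarrow> P x" for P x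
  proof -
    consider "0 < x \<bullet> \<nu>" | "0 < mirror \<nu> x \<bullet> \<nu>" | "x \<bullet> \<nu> = 0" by fastforce
    then show ?thesis using that by cases auto
  qed
  have \<psi>_hyp: "\<psi> x = 0" if "x \<bullet> \<nu> = 0" for x using that by (simp add: \<psi>_def npart_def)
  have \<psi>_bd: "\<bar>\<psi> x\<bar> \<le> \<epsilon>" for x
  proof (rule sides[where P = "\<lambda>x. \<bar>\<psi> x\<bar> \<le> \<epsilon>"])
    show "\<bar>\<psi> x\<bar> \<le> \<epsilon>" if "0 < x \<bullet> \<nu>" for x
      using near[OF that] \<psi>_pos[OF that] \<epsilon> by (cases "\<psi> x = 0") auto
  qed (use \<psi>_odd \<psi>_hyp \<epsilon> in auto)
  have \<psi>_supp: "x \<in> Q \<or> mirror \<nu> x \<in> Q" if "\<psi> x \<noteq> 0" for x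
  proof -
    have "\<psi> x \<noteq> 0 \<longrightarrow> x \<in> Q \<or> mirror \<nu> x \<in> Q"
      by (rule sides[where P = "\<lambda>x. \<psi> x \<noteq> 0 \<longrightarrow> x \<in> Q \<or> mirror \<nu> x \<in> Q"])
        (use near \<psi>_odd \<psi>_hyp in auto)
    then show ?thesis using that by blast
  qed
  have Q\<Omega>: "x \<in> \<Omega> \<and> 0 < x \<bullet> \<nu>" if "x \<in> Q" for x using inH[of x] that s by (simp add: Q_iff)
  have \<psi>_\<Omega>: "\<psi> x = 0" if "x \<notin> \<Omega>" for x using \<psi>_supp[of x] Q\<Omega>[of x] Q\<Omega>[of "mirror \<nu> x"] that by auto
  have \<psi>_int: "integrable lborel \<psi>" by (rule integrable_bounded[OF _ \<psi>_bd \<psi>_\<Omega>]) measurable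
  define I where "I = (LINT x|lborel. \<bar>\<psi> x\<bar>)"
  \<comment> \<open>By oddness the part of \<psi> on Q carries half of its L^1 norm. It is
    nonnegative and integrable, so it can be paired with the indicator of A in a product
    integral.\<close>
  define q where "q x = indicat_real Q x * \<psi> x" for x
  have q_int: "integrable lborel q"
    unfolding q_def by (rule integrable_bounded[where M = \<epsilon>]) (use \<psi>_bd \<psi>_\<Omega> \<epsilon> in \<open>auto simp: indicator_def Q_def\<close>)
  have q0: "0 \<le> q x" for x using \<psi>_pos[of x] Q\<Omega>[of x] by (auto simp: q_def indicator_def)
  have [measurable]: "q \<in> borel_measurable borel" using q_int by auto
  define P where "P = (LINT x|lborel. q x)"
  have P0: "0 \<le> P" unfolding P_def using q0 by (intro integral_nonneg_AE) auto
  have "\<bar>\<psi> x\<bar> = q x + q (mirror \<nu> x)" for x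
  proof (rule sides[where P = "\<lambda>x. \<bar>\<psi> x\<bar> = q x + q (mirror \<nu> x)"])
    show "\<bar>\<psi> x\<bar> = q x + q (mirror \<nu> x)" if x: "0 < x \<bullet> \<nu>" for x
    proof -
      have "mirror \<nu> x \<notin> Q" using Q\<Omega>[of "mirror \<nu> x"] x by auto
      then show ?thesis
        using near[OF x] \<psi>_pos[OF x] by (cases "\<psi> x = 0") (auto simp: q_def \<psi>_odd)
    qed
  qed (use \<psi>_odd \<psi>_hyp in \<open>auto simp: q_def\<close>)
  then have I_P: "I = 2 * P"
    using q_int integrable_mirror_iff[of q \<nu>] integral_mirror[of q \<nu>] by (simp add: I_def P_def)
  note wk = weak_odd[OF \<psi>_fe \<psi>_\<Omega> \<psi>_bd \<psi>_odd, of i]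
  have pt: "- (L * \<epsilon>) * \<bar>\<psi> x\<bar> \<le> (g i x - g i (mirror \<nu> x)) * \<psi> x" for x
  proof (rule sides[where P = "\<lambda>x. - (L * \<epsilon>) * \<bar>\<psi> x\<bar> \<le> (g i x - g i (mirror \<nu> x)) * \<psi> x"])
    fix x assume x: "0 < x \<bullet> \<nu>"
    show "- (L * \<epsilon>) * \<bar>\<psi> x\<bar> \<le> (g i x - g i (mirror \<nu> x)) * \<psi> x"
    proof (cases "\<psi> x = 0")
      case False
      have nz: "x \<in> \<Omega>" "x \<noteq> 0" using \<psi>_\<Omega>[of x] False x by auto
      \<comment> \<open>All w_j are nonnegative here and w_i <= \<epsilon> where \<psi> is nonzero,
        so only the u_i-term of \<open>g_lower\<close> survives, of size at most L
        \<epsilon>.\<close>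
      have "max 0 (u j (mirror \<nu> x) - u j x) = 0" for j using pos[OF x, of j] by (simp add: w_def)
      then have "g i (mirror \<nu> x) - g i x \<le> L * \<bar>u i x - u i (mirror \<nu> x)\<bar>"
        using g_lower[OF nz, of "mirror \<nu> x" i] by simp
      also have "\<dots> \<le> L * \<epsilon>"
        using near[OF x False] pos[OF x, of i] by (intro mult_left_mono L_nonneg) (simp add: w_def)
      finally have "- (L * \<epsilon>) \<le> g i x - g i (mirror \<nu> x)" by simp
      then show ?thesis using \<psi>_pos[OF x] mult_right_mono by fastforce
    qed simp
  next
    fix x assume "- (L * \<epsilon>) * \<bar>\<psi> (mirror \<nu> x)\<bar> \<le>
      (g i (mirror \<nu> x) - g i (mirror \<nu> (mirror \<nu> x))) * \<psi> (mirror \<nu> x)"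
    then show "- (L * \<epsilon>) * \<bar>\<psi> x\<bar> \<le> (g i x - g i (mirror \<nu> x)) * \<psi> x"
      by (simp add: \<psi>_odd algebra_simps)
  qed (simp add: \<psi>_hyp)
  have "- (L * \<epsilon>) * I = (LINT x|lborel. - (L * \<epsilon>) * \<bar>\<psi> x\<bar>)" by (simp add: I_def)
  also have "\<dots> \<le> (LINT x|lborel. (g i x - g i (mirror \<nu> x)) * \<psi> x)"
    using \<psi>_int pt by (intro integral_mono wk(1)) auto
  also have "\<dots> = E (w \<nu> i) \<psi>" by (rule wk(2)[symmetric])
  finally have E1: "- (L * \<epsilon>) * I \<le> E (w \<nu> i) \<psi>" .
  have E2: "E ?B \<psi> \<le> C * I"
    unfolding I_def
    by (intro E_le[rule_format] \<psi>_fe \<psi>_int \<psi>_odd \<psi>_sign) (rule \<psi>_supp[unfolded Q_iff])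
  have E3: "E h \<psi> = E (w \<nu> i) \<psi> - \<epsilon> * E ?B \<psi>"
    unfolding h_def using E_diff_left[OF w_energy fin_energy_scale[OF B_fe] \<psi>_fe] by (simp add: E_scale_left)
  let ?a = "\<lambda>x. h x + \<psi> x"
  have a_fe: "fin_energy ?a" by (intro fin_energy_add h_fe \<psi>_fe)
  have a_odd: "?a (mirror \<nu> x) = - ?a x" for x by (simp add: h_odd \<psi>_odd)
  have a_disj: "?a x * \<psi> x = 0" for x unfolding \<psi>_def by (intro npart_disjoint h_odd)
  have a_sign: "0 \<le> (x \<bullet> \<nu>) * ?a x" for x unfolding \<psi>_def by (rule npart_sign)
  let ?F = "\<lambda>p. (?a (fst p) * \<psi> (snd p) + ?a (snd p) * \<psi> (fst p)) *
      (K (fst p - snd p) - K (fst p - mirror \<nu> (snd p)))"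
  note F = E_disjoint_odd[OF a_fe \<psi>_fe a_odd \<psi>_odd a_disj]
  have A_int: "integrable lborel (\<lambda>x. \<delta>0 * indicat_real A x)" "(LINT x|lborel. \<delta>0 * indicat_real A x) = m"
    using emeasure_bounded_finite[of A] by (auto simp: A_def m_def)
  \<comment> \<open>Only pairs from A and Q are kept. The barrier vanishes on A, so \<open>h\<close>
    exceeds \<delta>0 there, and the kernel difference is at least 1; all other pairs contribute a
    nonnegative amount.\<close>
  have G_le: "\<delta>0 * indicat_real A (fst p) * q (snd p) \<le> ?F p" for p
  proof (cases "fst p \<in> A \<and> snd p \<in> Q")
    case True
    define x y where "x = fst p" and "y = snd p"
    have x: "x \<in> A" and y: "y \<in> Q" using True by (auto simp: x_def y_def)
    have xH: "0 < x \<bullet> \<nu>" using inH A'(1)[OF x] by auto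
    have yH: "0 < y \<bullet> \<nu>" using Q\<Omega>[OF y] by auto
    have "x \<notin> Q" using A'(2)[OF x] by (simp add: Q_iff)
    then have \<psi>x: "\<psi> x = 0" using near[OF xH] by auto
    have "?B x = 0" using B_half[of x] xH bump_outside[OF s(1), of x x0] A'(2)[OF x] by simp
    then have ax: "\<delta>0 \<le> ?a x" using A(1)[OF x] \<psi>x by (simp add: h_def)
    have "\<delta>0 * \<psi> y * 1 \<le> ?a x * \<psi> y * (K (x - y) - K (x - mirror \<nu> y))"
      using ax \<delta>0(1) \<psi>_pos[OF yH] gap[OF x y] by (intro mult_mono mult_nonneg_nonneg) auto
    then show ?thesis using x y \<psi>x by (simp add: q_def x_def y_def)
  next
    case False
    then have "\<delta>0 * indicat_real A (fst p) * q (snd p) = 0" by (auto simp: q_def)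
    also have "0 \<le> ?F p" by (rule odd_kernel_nonneg[OF a_odd \<psi>_odd a_disj a_sign \<psi>_sign])
    finally show ?thesis .
  qed
  have "m * P = (LINT p|lborel2. \<delta>0 * indicat_real A (fst p) * q (snd p))"
    using integrable_product(2)[OF A_int(1) q_int] A_int(2) by (simp add: P_def)
  also have "\<dots> \<le> (LINT p|lborel2. ?F p)"
    by (rule integral_mono[OF integrable_product(1)[OF A_int(1) q_int] F(1) G_le])
  finally have "E ?a \<psi> \<le> - (m * P) / 4" using F(2) by simp
  moreover have "E h \<psi> \<le> E ?a \<psi>"
    using E_npart[OF h_fe h_odd] E_self_nonneg[of \<psi>] by (simp add: \<psi>_def)
  moreover have "\<epsilon> * E ?B \<psi> \<le> \<epsilon> * (C * I)" using E2 \<epsilon> by (intro mult_left_mono) auto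
  ultimately have "- (L * \<epsilon>) * I - \<epsilon> * (C * I) \<le> - (m * P) / 4"
    using E1 E3 by linarith
  then have "m * P / 4 \<le> 2 * \<epsilon> * (L + C) * P" by (simp add: I_P algebra_simps)
  also have "\<dots> \<le> 2 * \<epsilon> * D * P" using \<epsilon> P0 LC by (intro mult_right_mono mult_left_mono) auto
  also have "\<dots> = m / 8 * P" using LC by (simp add: \<epsilon>_def)
  finally have "m * P \<le> 0" by (simp add: mult.commute)
  then have "P = 0" using m P0 by (simp add: mult_le_0_iff)
  then have ae: "AE x in lborel. q x = 0"
    unfolding P_def by (subst (asm) integral_nonneg_eq_0_iff_AE[OF q_int]) (use q0 in auto)
  \<comment> \<open>At x0 the bump is 1 and w_i vanishes, so the inequality just excluded almost
    everywhere does hold there; the set where it holds is open.\<close>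
  have "\<not> (norm (x0 - x0) < s \<and> w \<nu> i x0 < \<epsilon> * bump x0 s x0)"
  proof (rule AE_lborel_open[where x = x0 and P = "\<lambda>x. \<not> (norm (x - x0) < s \<and> w \<nu> i x < \<epsilon> * bump x0 s x)"])
    show "AE x in lborel. \<not> (norm (x - x0) < s \<and> w \<nu> i x < \<epsilon> * bump x0 s x)"
      using ae
    proof eventually_elim
      case (elim x)
      show ?case
      proof
        assume *: "norm (x - x0) < s \<and> w \<nu> i x < \<epsilon> * bump x0 s x"
        then have xQ: "x \<in> Q" by (simp add: Q_iff)
        then have "\<psi> x = 0" using elim by (simp add: q_def)
        then show False using * Q\<Omega>[OF xQ] B_half[of x] by (simp add: \<psi>_def npart_def h_def max_def split: if_splits)
      qed
    qed
    show "open {x. \<not> \<not> (norm (x - x0) < s \<and> w \<nu> i x < \<epsilon> * bump x0 s x)}"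
      unfolding not_not
      by (intro open_Collect_conj open_Collect_less continuous_intros continuous_on_bump)
  qed
  then show False using s(1) \<epsilon> x0(3) by (simp add: bump_def)
qed

text \<open>In the half domain the zeros form an open set by the local version and the positive
  points by continuity; the half domain is connected.\<close>

lemma strong_maximum_principle:
  assumes nonneg: "\<And>j x. 0 \<le> (x \<bullet> \<nu>) * w \<nu> j x"
  shows "(\<forall>x\<in>\<Omega>. 0 < x \<bullet> \<nu> \<longrightarrow> 0 < w \<nu> i x) \<or> (\<forall>x. w \<nu> i x = 0)"
proof -
  let ?H = "{x \<in> \<Omega>. 0 < x \<bullet> \<nu>}"
  define Z where "Z = {x \<in> ?H. w \<nu> i x = 0}"
  define V where "V = {x \<in> ?H. 0 < w \<nu> i x}"
  have "connected ?H" by (rule connected_radial_half_space[OF connected_\<Omega> radial_\<Omega>])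
  moreover have V: "open V" unfolding V_def
  proof -
    have "open {x. 0 < w \<nu> i x}" by (intro open_Collect_less continuous_intros)
    then have "open (?H \<inter> {x. 0 < w \<nu> i x})" using open_half_domain by (intro open_Int)
    then show "open {x \<in> ?H. 0 < w \<nu> i x}" by (simp add: Collect_conj_eq Int_assoc)
  qed
  moreover have Z: "open Z"
    unfolding open_contains_ball
  proof
    fix x assume x: "x \<in> Z"
    then obtain r1 where r1: "0 < r1" "\<And>y. norm (y - x) < r1 \<Longrightarrow> w \<nu> i y = 0"
      using strong_maximum_local[OF nonneg, of x i] by (auto simp: Z_def)
    obtain r2 where r2: "0 < r2" "\<And>y. norm (y - x) < r2 \<Longrightarrow> y \<in> \<Omega> \<and> 0 < y \<bullet> \<nu>"
      using half_domain_ball[of x \<nu>] x by (auto simp: Z_def)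
    show "\<exists>e>0. ball x e \<subseteq> Z"
      using r1 r2 by (intro exI[of _ "min r1 r2"]) (auto simp: Z_def dist_norm norm_minus_commute)
  qed
  moreover have cover: "?H \<subseteq> Z \<union> V"
  proof
    fix x assume x: "x \<in> ?H"
    then have "0 \<le> w \<nu> i x" using nonneg[of x i] by (simp add: zero_le_mult_iff)
    then show "x \<in> Z \<union> V" using x by (auto simp: Z_def V_def)
  qed
  moreover have "Z \<inter> V \<inter> ?H = {}" by (auto simp: Z_def V_def)
  ultimately have "Z \<inter> ?H = {} \<or> V \<inter> ?H = {}" by (intro connectedD)
  then show ?thesis
  proof
    assume "Z \<inter> ?H = {}"
    then show ?thesis using \<open>?H \<subseteq> Z \<union> V\<close> by (auto simp: V_def)
  next
    assume "V \<inter> ?H = {}"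
    then have z: "w \<nu> i x = 0" if "x \<in> \<Omega>" "0 < x \<bullet> \<nu>" for x
      using \<open>?H \<subseteq> Z \<union> V\<close> that by (auto simp: Z_def)
    have "w \<nu> i x = 0" for x
    proof (cases "x \<in> \<Omega>")
      case True
      consider "0 < x \<bullet> \<nu>" | "x \<bullet> \<nu> < 0" | "x \<bullet> \<nu> = 0" by linarith
      then show ?thesis
      proof cases
        case 2
        then show ?thesis using z[of "mirror \<nu> x"] True by (simp add: w_odd)
      next
        case 3
        then show ?thesis by (simp add: w_def mirror_eq_self)
      qed (use z True in auto)
    qed (rule w_zero)
    then show ?thesis by blast
  qed
qed

text \<open>A vanishing w_i makes the left side of its equation 0 for every test function, whereas
  \<open>g_strict\<close> would make the right side positive when tested with an odd bump built on a
  ball where w_j > 0.\<close>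

lemma coupling:
  assumes nonneg: "\<And>j x. 0 \<le> (x \<bullet> \<nu>) * w \<nu> j x" and zero: "\<And>x. w \<nu> i x = 0"
  shows "w \<nu> j x = 0"
proof -
  have pos: "0 \<le> w \<nu> j x" if "0 < x \<bullet> \<nu>" for j x
    using nonneg[of x j] that by (simp add: zero_le_mult_iff)
  have "\<not> 0 < w \<nu> j x1" if x1: "x1 \<in> \<Omega>" "0 < x1 \<bullet> \<nu>" for x1
  proof
    assume wj: "0 < w \<nu> j x1"
    have "open ({x \<in> \<Omega>. 0 < x \<bullet> \<nu>} \<inter> {x. 0 < w \<nu> j x})"
      by (intro open_Int open_half_domain open_Collect_less continuous_intros)
    then obtain s where s: "0 < s" "ball x1 s \<subseteq> {x \<in> \<Omega>. 0 < x \<bullet> \<nu>} \<inter> {x. 0 < w \<nu> j x}"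
      unfolding open_contains_ball using x1 wj by blast
    have s': "y \<in> \<Omega>" "0 < y \<bullet> \<nu>" "0 < w \<nu> j y" if "norm (y - x1) < s" for y
      using s that by (auto simp: subset_iff dist_norm norm_minus_commute)
    let ?B = "odd_bump \<nu> x1 s"
    have B_half: "?B x = bump x1 s x" if "0 \<le> x \<bullet> \<nu>" for x
      using that s' by (intro odd_bump_half_space s(1)) auto
    have B_supp: "norm (x - x1) < s \<or> norm (mirror \<nu> x - x1) < s" if "?B x \<noteq> 0" for x
      using that bump_outside[OF s(1), of x x1] bump_outside[OF s(1), of "mirror \<nu> x" x1]
      by (cases "norm (x - x1) < s"; cases "norm (mirror \<nu> x - x1) < s"; simp add: odd_bump_def)
    have B_\<Omega>: "?B x = 0" if "x \<notin> \<Omega>" for x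
      using B_supp[of x] s'(1)[of x] s'(1)[of "mirror \<nu> x"] that by auto
    note wk = weak_odd[OF fin_energy_odd_bump[OF s(1)] B_\<Omega> abs_odd_bump_le odd_bump_odd, of i]
    let ?f = "\<lambda>x. (g i x - g i (mirror \<nu> x)) * ?B x"
    have pos_near: "0 < ?f x" if x: "norm (x - x1) < s" for x
    proof -
      have "g i (mirror \<nu> x) < g i x"
      proof (rule g_strict)
        show "x \<in> \<Omega>" "x \<noteq> 0" using s'[OF x] by auto
        show "u i x = u i (mirror \<nu> x)" using zero[of x] by (simp add: w_def)
        show "u l (mirror \<nu> x) \<le> u l x" for l using pos[OF s'(2)[OF x], of l] by (simp add: w_def)
        show "u j (mirror \<nu> x) < u j x" using s'(3)[OF x] by (simp add: w_def)
      qed simp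
      moreover have "0 < ?B x" using B_half[of x] s'(2)[OF x] bump_inside[OF x] by simp
      ultimately show ?thesis by simp
    qed
    have f0: "0 \<le> ?f x" for x
    proof (cases "?B x = 0")
      case False
      then consider "norm (x - x1) < s" | "norm (mirror \<nu> x - x1) < s" using B_supp by blast
      then show ?thesis
      proof cases
        case 1 then show ?thesis using pos_near[of x] by simp
      next
        case 2
        then have "0 < (g i (mirror \<nu> x) - g i x) * - ?B x" using pos_near[of "mirror \<nu> x"] by (simp add: odd_bump_odd)
        then show ?thesis by (simp add: algebra_simps)
      qed
    qed simp
    have "E (w \<nu> i) ?B = 0" by (simp add: E_def den_def zero)
    then have "(LINT x|lborel. ?f x) = 0" using wk(2) by simp
    then have "AE x in lborel. ?f x = 0"
      using integral_nonneg_eq_0_iff_AE[OF wk(1)] f0 by simp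
    then have "AE x in lborel. \<not> norm (x - x1) < s"
    proof eventually_elim
      case (elim x) then show ?case using pos_near[of x] by force
    qed
    moreover have "open {x. \<not> \<not> norm (x - x1) < s}"
      unfolding not_not by (intro open_Collect_less continuous_intros)
    ultimately have "\<not> norm (x1 - x1) < s" by (rule AE_lborel_open)
    then show False using s by simp
  qed
  then have le: "w \<nu> j x \<le> 0" if "x \<in> \<Omega>" "0 < x \<bullet> \<nu>" for x using that by (auto simp: not_less)
  consider "x \<notin> \<Omega>" | "x \<in> \<Omega>" "0 < x \<bullet> \<nu>" | "x \<in> \<Omega>" "x \<bullet> \<nu> < 0" | "x \<bullet> \<nu> = 0" by linarith
  then show ?thesis
  proof cases
    case 2
    then show ?thesis using le[of x] pos[of x j] by simp
  next
    case 3
    then show ?thesis using le[of "mirror \<nu> x"] pos[of "mirror \<nu> x" j] by (simp add: w_odd)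
  next
    case 4
    then show ?thesis by (simp add: w_def mirror_eq_self)
  qed (rule w_zero)
qed

end

subsection \<open>The set of admissible reflections\<close>

lemma AE_lborel_hyperplane:
  fixes \<nu> :: "'a::euclidean_space"
  assumes "\<nu> \<noteq> 0" shows "AE x in lborel. x \<bullet> \<nu> \<noteq> 0"
proof -
  have "{x. x \<bullet> \<nu> = 0} \<in> null_sets lebesgue"
    using negligible_hyperplane[of \<nu> 0] assms by (simp add: negligible_iff_null_sets inner_commute)
  moreover have "{x. x \<bullet> \<nu> = 0} \<in> sets lborel" by measurable
  ultimately have "{x. x \<bullet> \<nu> = 0} \<in> null_sets lborel" by (simp only: null_sets_completion_iff)
  then show ?thesis by (rule AE_I') auto
qed

context symmetric_system
begin

definition Sp :: "'a set" where
  "Sp = {\<nu>. \<nu> \<noteq> 0 \<and> (\<forall>i. \<forall>x\<in>\<Omega>. 0 < x \<bullet> \<nu> \<longrightarrow> 0 < w \<nu> i x)}"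

lemma Sp_pos: "\<nu> \<in> Sp \<Longrightarrow> x \<in> \<Omega> \<Longrightarrow> x \<bullet> \<nu> \<noteq> 0 \<Longrightarrow> 0 < (x \<bullet> \<nu>) * w \<nu> i x"
proof -
  assume \<nu>: "\<nu> \<in> Sp" and x: "x \<in> \<Omega>" "x \<bullet> \<nu> \<noteq> 0"
  show ?thesis
  proof (cases "0 < x \<bullet> \<nu>")
    case True
    then show ?thesis using \<nu> x by (simp add: Sp_def)
  next
    case False
    then have "0 < mirror \<nu> x \<bullet> \<nu>" using x by simp
    then have "0 < w \<nu> i (mirror \<nu> x)" using \<nu> x unfolding Sp_def by (simp del: mirror_inner)
    then show ?thesis using False x by (auto simp: w_odd intro: mult_neg_neg)
  qed
qed

lemma Sp_nonneg: "\<nu> \<in> Sp \<Longrightarrow> 0 \<le> (x \<bullet> \<nu>) * w \<nu> i x"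
  using Sp_pos[of \<nu> x i] w_zero[of x \<nu> i] by (cases "x \<in> \<Omega> \<and> x \<bullet> \<nu> \<noteq> 0") (auto intro: less_imp_le)

text \<open>Coupling upgrades the alternative for each single component to one for the whole
  system.\<close>

lemma Sp_dichotomy:
  assumes "\<nu> \<noteq> 0" and nonneg: "\<And>i x. 0 \<le> (x \<bullet> \<nu>) * w \<nu> i x"
  shows "\<nu> \<in> Sp \<or> (\<forall>i x. w \<nu> i x = 0)"
proof (cases "\<exists>i. \<forall>x. w \<nu> i x = 0")
  case True
  then show ?thesis using coupling[OF nonneg] by blast
next
  case False
  then show ?thesis using strong_maximum_principle[OF nonneg] assms(1) by (auto simp: Sp_def)
qed

lemma tendsto_w:
  assumes "\<nu>s \<longlonglongrightarrow> \<nu>" "\<nu> \<noteq> 0"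
  shows "(\<lambda>k. w (\<nu>s k) i x) \<longlonglongrightarrow> w \<nu> i x"
proof -
  have "(\<lambda>k. mirror (\<nu>s k) x) \<longlonglongrightarrow> mirror \<nu> x" by (rule tendsto_mirror[OF assms(1) tendsto_const assms(2)])
  then have "(\<lambda>k. u i (mirror (\<nu>s k) x)) \<longlonglongrightarrow> u i (mirror \<nu> x)"
    by (rule continuous_on_tendsto_compose[OF u_cont]) auto
  then show ?thesis unfolding w_def by (intro tendsto_intros)
qed

lemma measurable_bad_set: "{x \<in> \<Omega>. \<exists>i. (x \<bullet> \<nu>) * w \<nu> i x < 0} \<in> sets borel"
  using open_\<Omega> by measurable

text \<open>Suppose normals outside \<open>Sp\<close> converge to a member \<nu>. Off its hyperplane
  the w_i have strict signs, so almost every point eventually leaves the bad sets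
  \<open>A k\<close>, whose measure tends to 0. Below the uniform threshold all signs are right, and
  the dichotomy then makes w vanish identically along the sequence, contradicting positivity at one
  fixed point.\<close>

lemma open_Sp:
  assumes x0: "x0 \<in> \<Omega>" "x0 \<noteq> 0"
  shows "open Sp"
proof -
  have key: False if out: "\<And>k. \<nu>s k \<notin> Sp" and lim: "\<nu>s \<longlonglongrightarrow> \<nu>" and \<nu>: "\<nu> \<in> Sp" for \<nu>s \<nu>
  proof -
    have \<nu>0: "\<nu> \<noteq> 0" using \<nu> by (simp add: Sp_def)
    define A where "A k = {x \<in> \<Omega>. \<exists>i. (x \<bullet> \<nu>s k) * w (\<nu>s k) i x < 0}" for k
    have A_meas [measurable]: "A k \<in> sets borel" for k unfolding A_def by (rule measurable_bad_set)
    have \<Omega>_fin: "emeasure lborel \<Omega> < \<infinity>" by (rule emeasure_bounded_finite[OF bounded_\<Omega>])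
    have "(\<lambda>k. LINT x|lborel. indicat_real (A k) x) \<longlonglongrightarrow> (LINT x::'a|lborel. (0::real))"
    proof (rule integral_dominated_convergence[where w = "indicat_real \<Omega>"])
      show "integrable lborel (indicat_real \<Omega>)" using open_\<Omega> \<Omega>_fin by (intro integrable_real_indicator) auto
      show "AE x in lborel. (\<lambda>k. indicat_real (A k) x) \<longlonglongrightarrow> 0"
        using AE_lborel_hyperplane[OF \<nu>0]
      proof eventually_elim
        case (elim x)
        have "\<forall>\<^sub>F k in sequentially. x \<notin> A k"
        proof (cases "x \<in> \<Omega>")
          case True
          have "\<forall>\<^sub>F k in sequentially. 0 < (x \<bullet> \<nu>s k) * w (\<nu>s k) i x" for i
          proof (rule order_tendstoD(1))
            show "(\<lambda>k. (x \<bullet> \<nu>s k) * w (\<nu>s k) i x) \<longlonglongrightarrow> (x \<bullet> \<nu>) * w \<nu> i x"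
              by (intro tendsto_intros tendsto_w lim \<nu>0)
          qed (rule Sp_pos[OF \<nu> True elim])
          then have "\<forall>\<^sub>F k in sequentially. \<forall>i. 0 < (x \<bullet> \<nu>s k) * w (\<nu>s k) i x"
            by (rule eventually_all_finite)
          then show ?thesis by eventually_elim (auto simp: A_def not_less less_imp_le)
        qed (simp add: A_def)
        then have "\<forall>\<^sub>F k in sequentially. indicat_real (A k) x = 0" by eventually_elim simp
        then show ?case by (rule tendsto_eventually)
      qed
      show "AE x in lborel. norm (indicat_real (A k) x) \<le> indicat_real \<Omega> x" for k
        by (auto simp: A_def indicator_def)
    qed measurable
    then have m0: "(\<lambda>k. measure lborel (A k)) \<longlonglongrightarrow> 0" by simp
    obtain d where "0 < d" and d: "\<And>k. emeasure lborel (A k) \<le> ennreal d \<Longrightarrow> \<forall>i x. 0 \<le> (x \<bullet> \<nu>s k) * w (\<nu>s k) i x"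
      using small_volume_maximum_principle unfolding A_def by blast
    \<comment> \<open>The point of the ray spanned by \<nu> at the radius of x0 lies in \<Omega> and
      on the positive side; there w_i stays positive for normals close to \<nu>.\<close>
    define x1 where "x1 = (norm x0 / norm \<nu>) *\<^sub>R \<nu>"
    have x1: "x1 \<in> \<Omega>" using radial_\<Omega>[OF x0(1), of x1] \<nu>0 by (simp add: x1_def)
    have x1\<nu>: "0 < x1 \<bullet> \<nu>" using \<nu>0 x0 by (simp add: x1_def)
    fix i :: 'm
    have "\<forall>\<^sub>F k in sequentially. measure lborel (A k) < d" using order_tendstoD(2)[OF m0 \<open>0 < d\<close>] .
    moreover have "\<forall>\<^sub>F k in sequentially. 0 < w (\<nu>s k) i x1"
      using order_tendstoD(1)[OF tendsto_w[OF lim \<nu>0]] \<nu> x1 x1\<nu> by (simp add: Sp_def)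
    moreover have "\<forall>\<^sub>F k in sequentially. \<nu>s k \<noteq> 0" by (rule tendsto_imp_eventually_ne[OF lim \<nu>0])
    ultimately have "\<forall>\<^sub>F k in sequentially. False"
    proof eventually_elim
      case (elim k)
      have "emeasure lborel (A k) \<le> emeasure lborel \<Omega>" using open_\<Omega> by (intro emeasure_mono) (auto simp: A_def)
      then have "emeasure lborel (A k) \<noteq> top" using \<Omega>_fin by auto
      then have "emeasure lborel (A k) \<le> ennreal d" using elim(1)
        by (simp add: emeasure_eq_ennreal_measure ennreal_leI)
      then have nn: "0 \<le> (x \<bullet> \<nu>s k) * w (\<nu>s k) i x" for i x using d by blast
      have "\<forall>i x. w (\<nu>s k) i x = 0" using Sp_dichotomy[OF elim(3) nn] out[of k] by blast
      then show False using elim(2) by simp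
    qed
    then show False by simp
  qed
  have "closed (- Sp)"
    unfolding closed_sequential_limits
  proof (intro allI impI, rule ComplI)
    fix \<nu>s \<nu> assume "(\<forall>n. \<nu>s n \<in> - Sp) \<and> \<nu>s \<longlonglongrightarrow> \<nu>" "\<nu> \<in> Sp"
    then show False by (intro key[of \<nu>s \<nu>]) auto
  qed
  then show ?thesis by (simp add: open_closed)
qed

lemma symmetry_axis:
  fixes i0 :: 'm
  assumes x0: "x0 \<in> \<Omega>" "x0 \<noteq> 0" and e: "e \<in> Sp"
  shows "\<exists>p. norm p = 1 \<and> (\<forall>\<nu>. 0 < \<nu> \<bullet> p \<longrightarrow> \<nu> \<in> Sp)"
proof -
  let ?S = "sphere 0 (norm x0)"
  have "\<exists>P\<in>?S. \<forall>y\<in>?S. u i0 y \<le> u i0 P"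
  proof (rule continuous_attains_sup)
    show "continuous_on ?S (u i0)" using continuous_on_subset[OF u_cont] by blast
  qed (use x0 in auto)
  then obtain P where P: "norm P = norm x0" and max: "\<And>y. norm y = norm x0 \<Longrightarrow> u i0 y \<le> u i0 P" by auto
  have P\<Omega>: "P \<in> \<Omega>" using radial_\<Omega>[OF x0(1) P] .
  have P0: "0 < P \<bullet> P" using P x0 by auto
  have opn: "open Sp" by (rule open_Sp[OF x0])
  \<comment> \<open>If P were on the negative side, its mirror image, on the same sphere, would have
    a larger value of u_i0 than the maximum.\<close>
  have ge: "\<not> \<nu> \<bullet> P < 0" if "\<nu> \<in> Sp" for \<nu>
  proof
    assume "\<nu> \<bullet> P < 0"
    then have "P \<bullet> \<nu> < 0" by (simp add: inner_commute)
    then have "0 < mirror \<nu> P \<bullet> \<nu>" by simp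
    then have "0 < w \<nu> i0 (mirror \<nu> P)" using that P\<Omega> unfolding Sp_def by (simp del: mirror_inner)
    then show False using max[of "mirror \<nu> P"] P by (simp add: w_def)
  qed
  have gt: "0 < \<nu> \<bullet> P" if \<nu>: "\<nu> \<in> Sp" for \<nu>
  proof (rule ccontr)
    assume "\<not> 0 < \<nu> \<bullet> P"
    then have 0: "\<nu> \<bullet> P = 0" using ge[OF \<nu>] by simp
    obtain r where r: "0 < r" "ball \<nu> r \<subseteq> Sp" using opn \<nu> unfolding open_contains_ball by blast
    \<comment> \<open>Tilting \<nu> away from P by a vector of length r/2 stays in the ball
      contained in \<open>Sp\<close> but makes the inner product with P negative.\<close>
    define t where "t = r / (2 * norm P)"
    have "0 < norm P" using P x0 by simp
    then have "0 < t" "dist \<nu> (\<nu> - t *\<^sub>R P) < r" using r by (simp_all add: t_def dist_norm)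
    then have "\<nu> - t *\<^sub>R P \<in> Sp" using r by auto
    moreover have "(\<nu> - t *\<^sub>R P) \<bullet> P < 0" using \<open>0 < t\<close> P0 by (simp add: inner_diff_left 0)
    ultimately show False using ge by blast
  qed
  define D where "D = {\<nu>. 0 < \<nu> \<bullet> P}"
  have "convex D" using convex_halfspace_gt[of 0 P] by (simp add: D_def inner_commute)
  then have "connected D" by (rule convex_connected)
  have sub: "Sp \<subseteq> D" using gt by (auto simp: D_def)
  have closure: "\<nu> \<in> Sp" if \<nu>D: "\<nu> \<in> D" and \<nu>c: "\<nu> \<in> closure Sp" for \<nu>
  proof (rule ccontr)
    assume "\<nu> \<notin> Sp"
    have \<nu>P: "0 < \<nu> \<bullet> P" and \<nu>0: "\<nu> \<noteq> 0" using \<nu>D by (auto simp: D_def)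
    obtain \<nu>s where \<nu>s: "\<And>k. \<nu>s k \<in> Sp" and lim: "\<nu>s \<longlonglongrightarrow> \<nu>"
      using \<nu>c unfolding closure_sequential by blast
    have nn: "0 \<le> (x \<bullet> \<nu>) * w \<nu> i x" for i x
    proof (rule tendsto_lowerbound)
      show "(\<lambda>k. (x \<bullet> \<nu>s k) * w (\<nu>s k) i x) \<longlonglongrightarrow> (x \<bullet> \<nu>) * w \<nu> i x"
        by (intro tendsto_intros tendsto_w lim \<nu>0)
      show "\<forall>\<^sub>F k in sequentially. 0 \<le> (x \<bullet> \<nu>s k) * w (\<nu>s k) i x"
        by (intro always_eventually allI Sp_nonneg \<nu>s)
    qed simp
    have "\<forall>i x. w \<nu> i x = 0" using Sp_dichotomy[OF \<nu>0 nn] \<open>\<nu> \<notin> Sp\<close> by simp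
    then have sym: "u i (mirror \<nu> x) = u i x" for i x by (simp add: w_def)
    \<comment> \<open>Conjugation by a symmetry of all u_i maps admissible normals to admissible
      normals.\<close>
    have "mirror \<nu> (\<nu>s k) \<in> Sp" for k
      unfolding Sp_def
    proof (intro CollectI conjI allI ballI impI)
      show "mirror \<nu> (\<nu>s k) \<noteq> 0" using \<nu>s[of k] by (simp add: Sp_def)
      fix i x assume "x \<in> \<Omega>" "0 < x \<bullet> mirror \<nu> (\<nu>s k)"
      then have "0 < mirror \<nu> x \<bullet> \<nu>s k" "mirror \<nu> x \<in> \<Omega>" by (simp_all add: mirror_inner_commute)
      then have "0 < w (\<nu>s k) i (mirror \<nu> x)" using \<nu>s[of k] by (simp add: Sp_def)
      then show "0 < w (mirror \<nu> (\<nu>s k)) i x" by (simp add: w_def mirror_conj sym)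
    qed
    then have mpos: "0 < mirror \<nu> (\<nu>s k) \<bullet> P" for k by (rule gt)
    have "0 \<le> mirror \<nu> \<nu> \<bullet> P"
    proof (rule tendsto_lowerbound)
      show "(\<lambda>k. mirror \<nu> (\<nu>s k) \<bullet> P) \<longlonglongrightarrow> mirror \<nu> \<nu> \<bullet> P"
        by (intro tendsto_intros tendsto_mirror lim \<nu>0)
      show "\<forall>\<^sub>F k in sequentially. 0 \<le> mirror \<nu> (\<nu>s k) \<bullet> P"
        by (intro always_eventually allI less_imp_le mpos)
    qed simp
    moreover have "mirror \<nu> \<nu> = - \<nu>" using \<nu>0 by (simp add: mirror_def scaleR_2)
    ultimately show False using \<nu>P by simp
  qed
  have "openin (top_of_set D) Sp" by (rule open_subset[OF sub opn])
  moreover have "closedin (top_of_set D) Sp"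
    unfolding closedin_closed using closure sub closure_subset[of Sp] by (intro exI[of _ "closure Sp"]) auto
  ultimately have "Sp = {} \<or> Sp = D" using \<open>connected D\<close> unfolding connected_clopen by metis
  then have SpD: "Sp = D" using e by auto
  show ?thesis
  proof (intro exI conjI allI impI)
    show "norm (P /\<^sub>R norm P) = 1" using P0 by auto
    fix \<nu> assume "0 < \<nu> \<bullet> (P /\<^sub>R norm P)"
    then show "\<nu> \<in> Sp" by (auto simp: SpD D_def zero_less_mult_iff)
  qed
qed

section \<open>From the half space of normals to monotonicity in the polar angle\<close>

context
  fixes p :: 'a
  assumes p: "norm p = 1" "\<And>\<nu>. 0 < \<nu> \<bullet> p \<Longrightarrow> \<nu> \<in> Sp"
begin

text \<open>The reflection with normal x - y exchanges x and y, and x . (x - y) = |x - y|^2 / 2 puts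
  x on its positive side.\<close>

lemma polar_strict:
  assumes "x \<in> \<Omega>" "norm x = norm y" "y \<bullet> p < x \<bullet> p"
  shows "u i y < u i x"
proof -
  have ne: "x \<noteq> y" using assms by auto
  have "x - y \<in> Sp" using assms by (intro p) (simp add: inner_diff_left)
  moreover have "2 * (x \<bullet> (x - y)) = (x - y) \<bullet> (x - y)"
    using assms(2) by (simp add: norm_eq inner_diff_left inner_diff_right inner_commute)
  then have "0 < x \<bullet> (x - y)" using ne by (metis inner_gt_zero_iff right_minus_eq zero_less_mult_pos zero_less_numeral)
  ultimately have "0 < w (x - y) i x" using assms by (simp add: Sp_def)
  then show ?thesis by (simp add: w_def mirror_swap[OF assms(2)])
qed

text \<open>Here x - y is orthogonal to p, on the boundary of the half space of normals; tilting it
  by p/(n + 1) brings it inside, and the inequality survives the limit. Exchanging x and y gives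
  equality, so the values depend only on radius and polar angle.\<close>

lemma polar_le:
  assumes "x \<in> \<Omega>" "norm x = norm y" "y \<bullet> p = x \<bullet> p"
  shows "u i y \<le> u i x"
proof (cases "x = y")
  case False
  define \<nu>s where "\<nu>s n = (x - y) + inverse (real (Suc n)) *\<^sub>R p" for n
  have "\<nu>s \<longlonglongrightarrow> (x - y) + 0 *\<^sub>R p" unfolding \<nu>s_def by (intro tendsto_intros LIMSEQ_inverse_real_of_nat)
  then have lim: "\<nu>s \<longlonglongrightarrow> x - y" by simp
  have ne: "x - y \<noteq> 0" using False by simp
  have "p \<bullet> p = 1" using p(1) by (simp add: norm_eq_1)
  then have Sp: "\<nu>s n \<in> Sp" for n using assms(3) by (intro p) (simp add: \<nu>s_def inner_add_left inner_diff_left)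
  have "2 * (x \<bullet> (x - y)) = (x - y) \<bullet> (x - y)"
    using assms(2) by (simp add: norm_eq inner_diff_left inner_diff_right inner_commute)
  then have "0 < x \<bullet> (x - y)" using ne by (metis inner_gt_zero_iff zero_less_mult_pos zero_less_numeral)
  then have "\<forall>\<^sub>F n in sequentially. 0 < x \<bullet> \<nu>s n"
    by (rule order_tendstoD(1)[rotated]) (intro tendsto_intros lim)
  then have "\<forall>\<^sub>F n in sequentially. 0 \<le> w (\<nu>s n) i x"
    by eventually_elim (use Sp assms(1) in \<open>auto simp: Sp_def intro: less_imp_le\<close>)
  then have "0 \<le> w (x - y) i x" by (intro tendsto_lowerbound[OF tendsto_w[OF lim ne]]) auto
  then show ?thesis by (simp add: w_def mirror_swap[OF assms(2)])
qed simp

end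

end

subsection \<open>Radial kernels\<close>

text \<open>Both measures are compared on the half lines up to r: the volume of a ball on one side,
  the integral of its derivative in r on the other.\<close>

lemma distr_norm_lborel:
  defines "c \<equiv> unit_ball_vol (DIM('a::euclidean_space)) * real DIM('a)"
  shows "distr (lborel :: 'a measure) borel norm =
    density lborel (\<lambda>r. ennreal (c * r ^ (DIM('a) - 1)) * indicator {0..} r)"
proof -
  let ?N = "DIM('a)" and ?v = "unit_ball_vol DIM('a)"
  let ?\<nu> = "density lborel (\<lambda>r::real. ennreal (c * r ^ (?N - 1)) * indicator {0..} r)"
  have N: "0 < ?N" by simp
  have c0: "0 \<le> c" by (simp add: c_def)
  have dist: "emeasure (distr (lborel :: 'a measure) borel norm) {..r} = ennreal (if r < 0 then 0 else ?v * r ^ ?N)" for r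
  proof -
    have "norm -` {..r} = (cball 0 r :: 'a set)" by auto
    then have "emeasure (distr (lborel :: 'a measure) borel norm) {..r} = emeasure lborel (cball (0::'a) r)"
      by (simp add: emeasure_distr)
    then show ?thesis by (auto simp: emeasure_cball)
  qed
  have dens: "emeasure ?\<nu> {..r} = ennreal (if r < 0 then 0 else ?v * r ^ ?N)" for r
  proof -
    have "emeasure ?\<nu> {..r} = (\<integral>\<^sup>+s. ennreal (c * s ^ (?N - 1)) * indicator {0..} s * indicator {..r} s \<partial>lborel)"
      by (rule emeasure_density) measurable
    also have "\<dots> = (\<integral>\<^sup>+s. ennreal (c * s ^ (?N - 1)) * indicator {0..r} s \<partial>lborel)"
      by (intro nn_integral_cong) (auto simp: indicator_def)
    also have "\<dots> = ennreal (if r < 0 then 0 else ?v * r ^ ?N)"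
    proof (cases "r < 0")
      case False
      have "(\<integral>\<^sup>+s. ennreal (c * s ^ (?N - 1)) * indicator {0..r} s \<partial>lborel) = ?v * r ^ ?N - ?v * 0 ^ ?N"
      proof (rule nn_integral_FTC_Icc)
        show "((\<lambda>s. ?v * s ^ ?N) has_real_derivative c * s ^ (?N - 1)) (at s)" for s
          by (auto intro!: derivative_eq_intros simp: c_def)
      qed (use c0 False in auto)
      then show ?thesis using False N by simp
    qed simp
    finally show ?thesis .
  qed
  show ?thesis
  proof (rule measure_eqI_generator_eq[where E = "range (\<lambda>r::real. {..r})" and \<Omega> = UNIV and A = "\<lambda>n::nat. {..real n}"])
    show "emeasure (distr (lborel :: 'a measure) borel norm) X = emeasure ?\<nu> X"
      if "X \<in> range (\<lambda>r::real. {..r})" for X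
      using that by (elim rangeE) (simp only: dist dens)
    show "emeasure (distr (lborel :: 'a measure) borel norm) {..real n} \<noteq> \<infinity>" for n
      by (simp only: dist) simp
    show "Int_stable (range (\<lambda>r::real. {..r}))"
      by (auto simp: Int_stable_def)
    show "(\<Union>n::nat. {..real n}) = UNIV" by (auto intro: real_arch_simple)
    show "sets (distr (lborel :: 'a measure) borel norm) = sigma_sets UNIV (range (\<lambda>r::real. {..r}))"
      "sets ?\<nu> = sigma_sets UNIV (range (\<lambda>r::real. {..r}))"
      by (simp_all add: borel_eq_atMost)
  qed auto
qed

lemma nn_integral_radial:
  fixes h :: "real \<Rightarrow> ennreal"
  defines "c \<equiv> unit_ball_vol (DIM('a::euclidean_space)) * real DIM('a)"
  assumes [measurable]: "h \<in> borel_measurable borel"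
  shows "(\<integral>\<^sup>+z. h (norm (z::'a)) \<partial>lborel) =
    ennreal c * (\<integral>\<^sup>+r\<in>{0..}. h r * ennreal (r ^ (DIM('a) - 1)) \<partial>lborel)"
proof -
  have c0: "0 \<le> c" by (simp add: c_def)
  have "(\<integral>\<^sup>+z. h (norm (z::'a)) \<partial>lborel) = (\<integral>\<^sup>+r. h r \<partial>distr (lborel :: 'a measure) borel norm)"
    by (rule nn_integral_distr[symmetric]) measurable
  also have "\<dots> = (\<integral>\<^sup>+r. ennreal (c * r ^ (DIM('a) - 1)) * indicator {0..} r * h r \<partial>lborel)"
    unfolding distr_norm_lborel c_def by (rule nn_integral_density) measurable
  also have "\<dots> = (\<integral>\<^sup>+r. ennreal c * (h r * ennreal (r ^ (DIM('a) - 1)) * indicator {0..} r) \<partial>lborel)"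
    using c0 by (intro nn_integral_cong) (auto simp: ennreal_mult indicator_def mult_ac)
  also have "\<dots> = ennreal c * (\<integral>\<^sup>+r\<in>{0..}. h r * ennreal (r ^ (DIM('a) - 1)) \<partial>lborel)"
    by (rule nn_integral_cmult) measurable
  finally show ?thesis .
qed

text \<open>The value 0 at the origin removes a possible infinity of \<open>k\<^sub>0\<close> there;
  for r > 0 nothing is lost by \<open>enn2real\<close> when the profile is admissible.\<close>

definition real_profile :: "(real \<Rightarrow> ennreal) \<Rightarrow> real \<Rightarrow> real" where
  "real_profile k\<^sub>0 r = (if 0 < r then enn2real (k\<^sub>0 r) else 0)"

lemma real_profile_nonneg: "0 \<le> real_profile k\<^sub>0 r"
  by (simp add: real_profile_def)

text \<open>An infinite value at r would persist on [r/2, r] by monotonicity, where the weight is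
  nonzero, and make the weighted integral infinite.\<close>

lemma admissible_profile_finite:
  assumes k: "admissible_profile N k\<^sub>0" and r: "0 < r"
  shows "k\<^sub>0 r < \<infinity>"
proof (rule ccontr)
  assume "\<not> k\<^sub>0 r < \<infinity>"
  then have top: "k\<^sub>0 r = top" by (metis infinity_ennreal_def less_top)
  have anti: "antimono_on {0..} k\<^sub>0" using k by (simp add: admissible_profile_def)
  have "top = top * emeasure lborel {r / 2..r}" using r by (simp add: ennreal_top_mult)
  also have "\<dots> = (\<integral>\<^sup>+s. top * indicator {r / 2..r} s \<partial>lborel)"
    by (rule nn_integral_cmult_indicator[symmetric]) simp
  also have "\<dots> \<le> (\<integral>\<^sup>+s\<in>{0..}. ennreal (min 1 (s\<^sup>2)) * k\<^sub>0 s * ennreal (s ^ (N - 1)) \<partial>lborel)"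
  proof (rule nn_integral_mono)
    fix s :: real
    show "top * indicator {r / 2..r} s \<le> ennreal (min 1 (s\<^sup>2)) * k\<^sub>0 s * ennreal (s ^ (N - 1)) * indicator {0..} s"
    proof (cases "s \<in> {r / 2..r}")
      case True
      then have s: "0 < s" "s \<le> r" using r by auto
      have "k\<^sub>0 r \<le> k\<^sub>0 s" using anti s r by (auto simp: monotone_on_def)
      then have "k\<^sub>0 s = top" using top by (simp add: top_unique)
      moreover have "ennreal (min 1 (s\<^sup>2)) \<noteq> 0" "ennreal (s ^ (N - 1)) \<noteq> 0"
        using s by (auto simp: ennreal_eq_0_iff not_le)
      ultimately show ?thesis using s by (simp add: ennreal_mult_top ennreal_top_mult)
    qed simp
  qed
  also have "\<dots> < \<infinity>" using k by (simp add: admissible_profile_def)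
  finally show False by simp
qed

lemma ennreal_real_profile:
  assumes "admissible_profile N k\<^sub>0" "0 < r"
  shows "ennreal (real_profile k\<^sub>0 r) = k\<^sub>0 r"
  using admissible_profile_finite[OF assms] assms(2) by (simp add: real_profile_def less_top)

lemma real_profile_anti:
  assumes "admissible_profile N k\<^sub>0" "0 < r" "r \<le> s"
  shows "real_profile k\<^sub>0 s \<le> real_profile k\<^sub>0 r"
proof -
  have "k\<^sub>0 s \<le> k\<^sub>0 r" using assms by (auto simp: admissible_profile_def monotone_on_def)
  then show ?thesis using assms admissible_profile_finite[OF assms(1,2)]
    by (auto simp: real_profile_def less_top intro: enn2real_mono)
qed

text \<open>Monotone on the open half line and 0 elsewhere; the change of sign turns a decreasing
  function into an increasing one.\<close>

lemma real_profile_measurable: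
  assumes k: "admissible_profile N k\<^sub>0"
  shows "real_profile k\<^sub>0 \<in> borel_measurable borel"
proof -
  have "mono_on {0<..} (\<lambda>r. - real_profile k\<^sub>0 r)"
    by (intro mono_onI) (use real_profile_anti[OF k] in auto)
  then have "(\<lambda>r. - real_profile k\<^sub>0 r) \<in> borel_measurable (restrict_space borel {0<..})"
    by (rule borel_measurable_mono_on_fnc)
  then have "(\<lambda>r. - real_profile k\<^sub>0 r * indicat_real {0<..} r) \<in> borel_measurable borel"
    by (subst (asm) borel_measurable_restrict_space_iff) (auto simp: mult.commute)
  moreover have "real_profile k\<^sub>0 = (\<lambda>r. - (- real_profile k\<^sub>0 r * indicat_real {0<..} r))"
    by (auto simp: real_profile_def indicator_def)
  ultimately show ?thesis by (metis borel_measurable_uminus)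
qed

text \<open>Polar coordinates turn the two integral conditions on the profile into
  \<open>K_nonint\<close> and \<open>K_moment\<close>; the modification at r = 0 concerns a null
  set.\<close>

lemma singular_kernel_radial:
  fixes k\<^sub>0 :: "real \<Rightarrow> ennreal"
  assumes k: "admissible_profile (DIM('a::euclidean_space)) k\<^sub>0"
  shows "singular_kernel (\<lambda>z::'a. real_profile k\<^sub>0 (norm z))"
proof
  let ?\<kappa> = "real_profile k\<^sub>0"
  let ?c = "unit_ball_vol (DIM('a)) * real DIM('a)"
  note [measurable] = real_profile_measurable[OF k]
  show nonneg: "0 \<le> ?\<kappa> (norm z)" for z :: 'a by (simp add: real_profile_def)
  show meas: "(\<lambda>z::'a. ?\<kappa> (norm z)) \<in> borel_measurable borel" by measurable
  show "?\<kappa> (norm w) \<le> ?\<kappa> (norm z)" if "z \<noteq> 0" "norm z \<le> norm w" for z w :: 'a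
    using that by (intro real_profile_anti[OF k]) auto
  have ae: "AE r in lborel. (r::real) \<noteq> 0" by (rule AE_lborel_singleton)
  have "(\<integral>\<^sup>+z. ennreal (?\<kappa> (norm (z::'a))) \<partial>lborel) =
      ennreal ?c * (\<integral>\<^sup>+r\<in>{0..}. ennreal (?\<kappa> r) * ennreal (r ^ (DIM('a) - 1)) \<partial>lborel)"
    by (rule nn_integral_radial) measurable
  also have "(\<integral>\<^sup>+r\<in>{0..}. ennreal (?\<kappa> r) * ennreal (r ^ (DIM('a) - 1)) \<partial>lborel) =
      (\<integral>\<^sup>+r\<in>{0..}. k\<^sub>0 r * ennreal (r ^ (DIM('a) - 1)) \<partial>lborel)"
    using ae by (intro nn_integral_cong_AE, eventually_elim) (auto simp: ennreal_real_profile[OF k] real_profile_nonneg indicator_def)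
  also have "\<dots> = \<infinity>" using k by (simp add: admissible_profile_def)
  finally show "(\<integral>\<^sup>+z. ennreal (?\<kappa> (norm (z::'a))) \<partial>lborel) = \<infinity>"
    by (simp add: ennreal_mult_top ennreal_eq_0_iff not_le)
  show "integrable lborel (\<lambda>z::'a. min 1 ((norm z)\<^sup>2) * ?\<kappa> (norm z))"
  proof (rule integrableI_nonneg)
    have "(\<integral>\<^sup>+z. ennreal (min 1 ((norm z)\<^sup>2) * ?\<kappa> (norm (z::'a))) \<partial>lborel) =
        ennreal ?c * (\<integral>\<^sup>+r\<in>{0..}. ennreal (min 1 (r\<^sup>2) * ?\<kappa> r) * ennreal (r ^ (DIM('a) - 1)) \<partial>lborel)"
      by (rule nn_integral_radial[where h = "\<lambda>r. ennreal (min 1 (r\<^sup>2) * ?\<kappa> r)"]) measurable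
    also have "(\<integral>\<^sup>+r\<in>{0..}. ennreal (min 1 (r\<^sup>2) * ?\<kappa> r) * ennreal (r ^ (DIM('a) - 1)) \<partial>lborel) =
        (\<integral>\<^sup>+r\<in>{0..}. ennreal (min 1 (r\<^sup>2)) * k\<^sub>0 r * ennreal (r ^ (DIM('a) - 1)) \<partial>lborel)"
      using ae by (intro nn_integral_cong_AE, eventually_elim)
        (auto simp: ennreal_mult ennreal_real_profile[OF k] real_profile_nonneg indicator_def)
    also have "ennreal ?c * \<dots> < \<infinity>"
      using k by (auto simp: admissible_profile_def intro!: ennreal_mult_less_top[THEN iffD2])
    finally show "(\<integral>\<^sup>+z. ennreal (min 1 ((norm z)\<^sup>2) * ?\<kappa> (norm (z::'a))) \<partial>lborel) < \<infinity>" .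
  qed (use nonneg in auto)
qed

section \<open>From the energy space over Lebesgue measure to the product formulation\<close>

lemma borel_imp_lebesgue_integral:
  fixes h :: "'a::euclidean_space \<Rightarrow> real"
  assumes "h \<in> borel_measurable borel"
  shows "(LINT x|lebesgue. h x) = (LINT x|lborel. h x)" "integrable lebesgue h \<longleftrightarrow> integrable lborel h"
  using assms by (auto intro!: integral_completion integrable_completion)

context
  fixes k\<^sub>0 :: "real \<Rightarrow> ennreal" and K :: "real^'n \<Rightarrow> real"
  assumes k: "admissible_profile CARD('n) k\<^sub>0"
  defines "K \<equiv> \<lambda>z. real_profile k\<^sub>0 (norm z)"
begin

interpretation singular_kernel K
  unfolding K_def by (rule singular_kernel_radial) (simp add: k)

text \<open>On the diagonal, 0 times a possibly infinite kernel value is 0, so the modified kernel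
  gives the same density at every pair.\<close>

lemma ennreal_den:
  "ennreal ((u x - u y)\<^sup>2) * radial_kernel k\<^sub>0 (x - y) = ennreal (den u u (x, y))"
proof (cases "x = y")
  case False
  then have "radial_kernel k\<^sub>0 (x - y) = ennreal (K (x - y))"
    by (simp add: radial_kernel_def K_def ennreal_real_profile[OF k])
  then show ?thesis using K_nonneg by (simp add: den_def power2_eq_square ennreal_mult)
qed (simp add: den_def)

lemma energy_eq:
  assumes [measurable]: "u \<in> borel_measurable borel"
  shows "energy (radial_kernel k\<^sub>0) u = (1 / 2) * (\<integral>\<^sup>+p. ennreal (den u u p) \<partial>lborel2)"
proof -
  have "(\<integral>\<^sup>+y. (\<integral>\<^sup>+x. ennreal ((u x - u y)\<^sup>2) * radial_kernel k\<^sub>0 (x - y) \<partial>lebesgue) \<partial>lebesgue) =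
      (\<integral>\<^sup>+y. (\<integral>\<^sup>+x. ennreal (den u u (x, y)) \<partial>lborel) \<partial>lborel)"
    unfolding nn_integral_completion ennreal_den ..
  also have "\<dots> = (\<integral>\<^sup>+p. ennreal (den u u p) \<partial>lborel2)"
    by (rule lborel_pair.nn_integral_snd) measurable
  finally show ?thesis by (simp add: energy_def)
qed

lemma energy_finite_iff:
  assumes "u \<in> borel_measurable borel"
  shows "energy (radial_kernel k\<^sub>0) u < \<infinity> \<longleftrightarrow> fin_energy u"
proof -
  have half: "(1 / 2 :: ennreal) = ennreal (1 / 2)" using divide_ennreal[of 1 2] by simp
  have half_top: "(1 / 2 :: ennreal) < top" unfolding half by (rule ennreal_less_top)
  have half_0: "(1 / 2 :: ennreal) \<noteq> 0" unfolding half by (simp only: ennreal_eq_0_iff)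
  have mult_half: "(1 / 2) * X < top \<longleftrightarrow> X < top" for X :: ennreal
    using half_top half_0 by (cases "X = 0") (simp_all only: ennreal_mult_less_top simp_thms mult_zero_right)
  have "energy (radial_kernel k\<^sub>0) u < \<infinity> \<longleftrightarrow> (\<integral>\<^sup>+p. ennreal (den u u p) \<partial>lborel2) < \<infinity>"
    unfolding energy_eq[OF assms] infinity_ennreal_def by (rule mult_half)
  also have "\<dots> \<longleftrightarrow> integrable lborel2 (den u u)"
    using assms by (auto simp: integrable_iff_bounded den_nonneg)
  finally show ?thesis using assms by (simp add: fin_energy_def)
qed

lemma energy_form_eq:
  assumes u: "fin_energy u" and v: "fin_energy v"
  shows "energy_form (radial_kernel k\<^sub>0) u v = E u v"
proof -
  have [measurable]: "u \<in> borel_measurable borel" "v \<in> borel_measurable borel"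
    using u v by (auto simp: fin_energy_def)
  have ptw: "(u x - u y) * (v x - v y) * enn2real (radial_kernel k\<^sub>0 (x - y)) = den u v (x, y)" for x y
  proof (cases "x = y")
    case False
    then have "enn2real (radial_kernel k\<^sub>0 (x - y)) = K (x - y)"
      by (simp add: K_def radial_kernel_def real_profile_def)
    then show ?thesis by (simp add: den_def)
  qed (simp add: den_def)
  have m: "den u v \<in> borel_measurable (borel \<Otimes>\<^sub>M borel)" unfolding den_def by measurable
  have inner: "(LINT x|lebesgue. den u v (x, y)) = (LINT x|lborel. den u v (x, y))" for y
    by (rule borel_imp_lebesgue_integral(1)) (use m in measurable)
  have "(LINT y|lebesgue. LINT x|lborel. den u v (x, y)) = (LINT y|lborel. LINT x|lborel. den u v (x, y))"
    by (rule borel_imp_lebesgue_integral(1)) measurable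
  also have "\<dots> = (LINT p|lborel2. den u v p)"
    using lborel_pair.integral_snd[of "\<lambda>x y. den u v (x, y)"] den_integrable[OF u v] by simp
  finally show ?thesis by (simp add: energy_form_def E_def ptw inner)
qed

text \<open>A bounded function supported in the bounded set \<Omega> is square integrable, so with
  finite energy it belongs to the energy space. The indicator moves the integral over \<Omega> to
  the whole space.\<close>

lemma weak_solution_test:
  fixes u :: "'m::finite \<Rightarrow> real^'n \<Rightarrow> real" and f :: "'m::finite \<Rightarrow> real \<times> (real^'m) \<Rightarrow> real"
  assumes sol: "weak_solution (radial_kernel k\<^sub>0) \<Omega> f u" and u: "u i \<in> borel_measurable borel"
    and \<Omega>: "open \<Omega>" "bounded \<Omega>"
    and g [measurable]: "(\<lambda>x. indicat_real \<Omega> x * f i (norm x, \<chi> l. u l x)) \<in> borel_measurable borel"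
    and \<phi>: "fin_energy \<phi>" "\<And>x. x \<notin> \<Omega> \<Longrightarrow> \<phi> x = 0" "\<And>x. \<bar>\<phi> x\<bar> \<le> M"
  shows "E (u i) \<phi> = (LINT x|lborel. indicat_real \<Omega> x * f i (norm x, \<chi> l. u l x) * \<phi> x)"
proof -
  have u_fe: "fin_energy (u i)"
    using sol energy_finite_iff[OF u] by (auto simp: weak_solution_def energy_space_def)
  have [measurable]: "\<phi> \<in> borel_measurable borel" using \<phi>(1) by (simp add: fin_energy_def)
  have "integrable lborel (\<lambda>x. (\<phi> x)\<^sup>2)"
  proof (rule Bochner_Integration.integrable_bound)
    show "integrable lborel (\<lambda>x. M\<^sup>2 * indicat_real \<Omega> x)"
      using \<Omega>(1) emeasure_bounded_finite[OF \<Omega>(2)]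
      by (intro integrable_mult_right integrable_real_indicator) auto
    show "AE x in lborel. norm ((\<phi> x)\<^sup>2) \<le> norm (M\<^sup>2 * indicat_real \<Omega> x)"
    proof (rule AE_I2)
      fix x show "norm ((\<phi> x)\<^sup>2) \<le> norm (M\<^sup>2 * indicat_real \<Omega> x)"
        using \<phi>(2)[of x] power_mono[OF \<phi>(3)[of x], of 2] by (auto simp: indicator_def)
    qed
  qed measurable
  then have "\<phi> \<in> energy_space (radial_kernel k\<^sub>0) \<Omega>"
    using \<phi> energy_finite_iff[of \<phi>] by (auto simp: energy_space_def borel_imp_lebesgue_integral(2) measurable_completion)
  then have "energy_form (radial_kernel k\<^sub>0) (u i) \<phi> = (LINT x:\<Omega>|lebesgue. f i (norm x, \<chi> l. u l x) * \<phi> x)"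
    using sol by (simp add: weak_solution_def)
  also have "\<dots> = (LINT x|lebesgue. indicat_real \<Omega> x * f i (norm x, \<chi> l. u l x) * \<phi> x)"
    by (simp add: set_lebesgue_integral_def mult.assoc)
  also have "\<dots> = (LINT x|lborel. indicat_real \<Omega> x * f i (norm x, \<chi> l. u l x) * \<phi> x)"
    by (rule borel_imp_lebesgue_integral(1)) measurable
  finally show ?thesis using energy_form_eq[OF u_fe \<phi>(1)] by simp
qed

end

subsection \<open>Cooperative nonlinearities\<close>

context
  fixes F :: "real \<times> (real^'m) \<Rightarrow> real" and F' :: "real \<times> (real^'m) \<Rightarrow> (real \<times> (real^'m)) \<Rightarrow>\<^sub>L real"
  assumes F_deriv: "\<And>x. x \<in> {0..} \<times> UNIV \<Longrightarrow>
      (F has_derivative blinfun_apply (F' x)) (at x within {0..} \<times> UNIV)"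
    and F'_cont: "continuous_on ({0..} \<times> UNIV) F'"
begin

text \<open>Lines in the u-directions never leave the closed set in which derivatives are taken, so
  the derivative within that set is an ordinary one in t, also at r = 0.\<close>

lemma has_derivative_along_line:
  assumes "0 \<le> r"
  shows "((\<lambda>t. F (r, v + t *\<^sub>R d)) has_real_derivative F' (r, v + t *\<^sub>R d) (0, d)) (at t)"
proof -
  have "((\<lambda>t. (r, v + t *\<^sub>R d)) has_derivative (\<lambda>h. (0, h *\<^sub>R d))) (at t)"
    by (auto intro!: derivative_eq_intros)
  then have "((\<lambda>t. F (r, v + t *\<^sub>R d)) has_derivative (\<lambda>h. F' (r, v + t *\<^sub>R d) (0, h *\<^sub>R d))) (at t)"
    using has_derivative_in_compose2[OF F_deriv, of "\<lambda>t. (r, v + t *\<^sub>R d)" UNIV t "\<lambda>h. (0, h *\<^sub>R d)"] assms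
    by auto
  moreover have "F' (r, v + t *\<^sub>R d) (0, h *\<^sub>R d) = F' (r, v + t *\<^sub>R d) (0, d) * h" for h
    using blinfun.scaleR_right[of "F' (r, v + t *\<^sub>R d)" h "(0, d)"] by simp
  ultimately show ?thesis by (simp add: has_field_derivative_def)
qed

lemma partial_deriv_eq:
  assumes "0 \<le> r"
  shows "partial_deriv l (\<lambda>w. F (r, w)) v = F' (r, v) (0, axis l 1)"
proof -
  define v0 where "v0 = v - (v $ l) *\<^sub>R axis l 1"
  have eq: "(\<chi> l'. if l' = l then t else v $ l') = v0 + t *\<^sub>R axis l 1" for t
    by (simp add: vec_eq_iff v0_def axis_def)
  have "deriv (\<lambda>t. F (r, v0 + t *\<^sub>R axis l 1)) (v $ l) = F' (r, v0 + (v $ l) *\<^sub>R axis l 1) (0, axis l 1)"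
    by (rule DERIV_imp_deriv[OF has_derivative_along_line[OF assms]])
  then show ?thesis by (simp add: partial_deriv_def eq v0_def)
qed

text \<open>Mean value theorem along the segment from a to b, which stays in the positive cone: the
  i-th component of b - a is 0, so only the positive partial derivatives enter.\<close>

lemma cooperative_mono:
  assumes r: "0 < r"
    and coop: "\<And>l v. l \<noteq> i \<Longrightarrow> (\<forall>l. 0 < v $ l) \<Longrightarrow> 0 < partial_deriv l (\<lambda>w. F (r, w)) v"
    and a: "\<And>l. 0 < a $ l" and ab: "\<And>l. a $ l \<le> b $ l" and i: "a $ i = b $ i"
  shows "F (r, a) \<le> F (r, b)" "a $ j < b $ j \<Longrightarrow> F (r, a) < F (r, b)"
proof -
  define d where "d = b - a"
  have "\<exists>z. 0 < z \<and> z < 1 \<and> F (r, a + 1 *\<^sub>R d) - F (r, a + 0 *\<^sub>R d) = (1 - 0) * F' (r, a + z *\<^sub>R d) (0, d)"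
    by (rule MVT2) (use r in \<open>auto intro!: has_derivative_along_line\<close>)
  then obtain z where z: "0 < z" "z < 1" "F (r, b) - F (r, a) = F' (r, a + z *\<^sub>R d) (0, d)"
    by (auto simp: d_def)
  define T where "T x = F' (r, a + z *\<^sub>R d) (0, x)" for x
  have T: "linear T"
  proof (rule linearI)
    show "T (x + y) = T x + T y" for x y by (simp add: T_def flip: blinfun.add_right)
    show "T (c *\<^sub>R x) = c *\<^sub>R T x" for c x
      using blinfun.scaleR_right[of "F' (r, a + z *\<^sub>R d)" c "(0, x)"] by (simp add: T_def)
  qed
  have "d = (\<Sum>l\<in>UNIV. (d $ l) *\<^sub>R axis l 1)"
    using basis_expansion[of d] by (simp add: scalar_mult_eq_scaleR)
  then have "T d = T (\<Sum>l\<in>UNIV. (d $ l) *\<^sub>R axis l 1)" by simp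
  also have "\<dots> = (\<Sum>l\<in>UNIV. d $ l * T (axis l 1))"
    using T by (simp add: linear_sum linear_cmul)
  finally have Td: "F (r, b) - F (r, a) = (\<Sum>l\<in>UNIV. d $ l * T (axis l 1))" using z(3) by (simp add: T_def)
  have T_pos: "0 < T (axis l 1)" if "l \<noteq> i" for l
  proof -
    have "\<forall>l. 0 < (a + z *\<^sub>R d) $ l" using a ab z by (simp add: d_def add_pos_nonneg)
    from coop[OF that this] show ?thesis
      unfolding partial_deriv_eq[OF less_imp_le[OF r]] T_def .
  qed
  have term0: "0 \<le> d $ l * T (axis l 1)" for l
    using T_pos[of l] ab[of l] i by (cases "l = i") (auto simp: d_def)
  have "0 \<le> (\<Sum>l\<in>UNIV. d $ l * T (axis l 1))" by (intro sum_nonneg term0)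
  then show "F (r, a) \<le> F (r, b)" using Td by simp
  assume j: "a $ j < b $ j"
  then have "j \<noteq> i" using i by auto
  then have "0 < d $ j * T (axis j 1)" using T_pos j by (simp add: d_def)
  then have "0 < (\<Sum>l\<in>UNIV. d $ l * T (axis l 1))" by (intro sum_pos2[of UNIV j] term0) auto
  then show "F (r, a) < F (r, b)" using Td by simp
qed

lemma F_continuous: "continuous_on ({0..} \<times> UNIV) F"
  using F_deriv by (intro has_derivative_continuous_on)

lemma lipschitz_bounded:
  "\<exists>B\<ge>0. \<forall>r\<in>{0..R}. \<forall>a b. norm a \<le> M \<longrightarrow> norm b \<le> M \<longrightarrow> \<bar>F (r, a) - F (r, b)\<bar> \<le> B * norm (a - b)"
proof -
  let ?S = "{0..R} \<times> cball (0::real^'m) M"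
  have sub: "?S \<subseteq> {0..} \<times> UNIV" by auto
  have "bounded (F' ` ?S)"
    by (intro compact_imp_bounded compact_continuous_image continuous_on_subset[OF F'_cont] sub compact_Times) auto
  then obtain B where B: "\<And>x. x \<in> ?S \<Longrightarrow> norm (F' x) \<le> B" by (auto simp: bounded_iff)
  have "\<bar>F (r, a) - F (r, b)\<bar> \<le> max 0 B * norm (a - b)" if "r \<in> {0..R}" "norm a \<le> M" "norm b \<le> M" for r a b
  proof -
    have "norm (F (r, a) - F (r, b)) \<le> max 0 B * norm ((r, a) - (r, b))"
    proof (rule differentiable_bound[where S = ?S])
      show "convex ?S" by (intro convex_Times) auto
      show "(F has_derivative blinfun_apply (F' x)) (at x within ?S)" if "x \<in> ?S" for x
        using that sub by (intro has_derivative_subset[OF F_deriv sub]) auto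
      show "onorm (blinfun_apply (F' x)) \<le> max 0 B" if "x \<in> ?S" for x
        using B[OF that] by (simp add: norm_blinfun.rep_eq)
    qed (use that in \<open>auto simp: mem_cball_0\<close>)
    then show ?thesis by (simp add: norm_Pair)
  qed
  then show ?thesis by (intro exI[of _ "max 0 B"]) auto
qed

lemma bounded_on_bounded: "\<exists>B. \<forall>r\<in>{0..R}. \<forall>a. norm a \<le> M \<longrightarrow> \<bar>F (r, a)\<bar> \<le> B"
proof -
  let ?S = "{0..R} \<times> cball (0::real^'m) M"
  have sub: "?S \<subseteq> {0..} \<times> UNIV" by auto
  have "bounded (F ` ?S)"
    by (intro compact_imp_bounded compact_continuous_image continuous_on_subset[OF F_continuous] sub compact_Times) auto
  then obtain B where B: "\<And>x. x \<in> ?S \<Longrightarrow> \<bar>F x\<bar> \<le> B" by (auto simp: bounded_iff)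
  have "\<bar>F (r, a)\<bar> \<le> B" if "r \<in> {0..R}" "norm a \<le> M" for r a
    using B[of "(r, a)"] that by simp
  then show ?thesis by blast
qed

text \<open>Comparison through the componentwise minimum of \<open>a\<close> and \<open>b\<close>, with the \<open>i\<close>-th component
  replaced by \<open>a\<^sub>i\<close>: cooperativity handles one side, the Lipschitz bound the other.\<close>
lemma cooperative_lower_bound:
  assumes r: "0 < r"
    and coop: "\<And>l v. l \<noteq> i \<Longrightarrow> (\<forall>l. 0 < v $ l) \<Longrightarrow> 0 < partial_deriv l (\<lambda>w. F (r, w)) v"
    and a: "\<And>l. 0 < a $ l" "\<And>l. a $ l \<le> U l" and b: "\<And>l. 0 < b $ l" "\<And>l. b $ l \<le> U l"
    and B: "0 \<le> B" "\<And>a b. norm a \<le> sum U UNIV \<Longrightarrow> norm b \<le> sum U UNIV \<Longrightarrow>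
      \<bar>F (r, a) - F (r, b)\<bar> \<le> B * norm (a - b)"
  shows "F (r, b) - F (r, a) \<le> B * (\<bar>a $ i - b $ i\<bar> + (\<Sum>l\<in>UNIV. max 0 (b $ l - a $ l)))"
proof -
  define m where "m = (\<chi> l. if l = i then a $ i else min (a $ l) (b $ l))"
  have m: "0 < m $ l" "m $ l \<le> a $ l" "m $ i = a $ i" for l using a b by (auto simp: m_def)
  \<comment> \<open>The sum of the componentwise bounds dominates the l^1 norm and hence the
    Euclidean norm.\<close>
  have small: "norm c \<le> sum U UNIV" if "\<And>l. 0 < c $ l" "\<And>l. c $ l \<le> U l" for c :: "real^'m"
    using norm_le_l1_cart[of c] sum_mono[of UNIV "\<lambda>l. \<bar>c $ l\<bar>" U] that by (force simp: abs_of_pos)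
  have mU: "m $ l \<le> U l" for l using m(2)[of l] a(2)[of l] by linarith
  have "F (r, m) \<le> F (r, a)" by (rule cooperative_mono(1)[OF r coop]) (use m in auto)
  moreover have "\<bar>F (r, b) - F (r, m)\<bar> \<le> B * norm (b - m)"
    by (intro B small b m mU)
  moreover have "norm (b - m) \<le> \<bar>a $ i - b $ i\<bar> + (\<Sum>l\<in>UNIV. max 0 (b $ l - a $ l))"
  proof -
    have "norm (b - m) \<le> (\<Sum>l\<in>UNIV. \<bar>(b - m) $ l\<bar>)" by (rule norm_le_l1_cart)
    also have "\<dots> \<le> (\<Sum>l\<in>UNIV. (if l = i then \<bar>a $ i - b $ i\<bar> else 0) + max 0 (b $ l - a $ l))"
      by (intro sum_mono) (auto simp: m_def)
    also have "\<dots> = \<bar>a $ i - b $ i\<bar> + (\<Sum>l\<in>UNIV. max 0 (b $ l - a $ l))"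
      by (simp add: sum.distrib)
    finally show ?thesis .
  qed
  then have "B * norm (b - m) \<le> B * (\<bar>a $ i - b $ i\<bar> + (\<Sum>l\<in>UNIV. max 0 (b $ l - a $ l)))"
    using B(1) by (rule mult_left_mono)
  ultimately show ?thesis by linarith
qed

end

subsection \<open>Foliated Schwarz symmetry\<close>

text \<open>A nonempty superlevel set is compact, so x . p attains a minimum over it at some x1.
  Monotonicity makes the set consist of all points with x . p >= x1 . p, and as arccos is decreasing
  this is the closed geodesic ball with x1 on its boundary.\<close>

lemma foliated_schwarzI:
  fixes v :: "real^'n \<Rightarrow> real"
  assumes p: "norm p = 1" and cont: "continuous_on UNIV v"
    and strict: "\<And>x y. x \<in> \<Omega> \<Longrightarrow> norm x = norm y \<Longrightarrow> y \<bullet> p < x \<bullet> p \<Longrightarrow> v y < v x"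
    and eq: "\<And>x y. x \<in> \<Omega> \<Longrightarrow> norm x = norm y \<Longrightarrow> y \<bullet> p = x \<bullet> p \<Longrightarrow> v y \<le> v x"
  shows "foliated_schwarz p \<Omega> v"
  unfolding foliated_schwarz_def
proof (intro allI impI)
  fix r c :: real assume r: "0 < r" and S: "sphere 0 r \<subseteq> \<Omega>"
  define A where "A = {x \<in> sphere 0 r. c \<le> v x}"
  have "A = {} \<or> (\<exists>\<rho>\<ge>0. A = {x \<in> sphere 0 r. sphere_dist r x (r *\<^sub>R p) \<le> \<rho>})"
  proof (cases "A = {}")
    case False
    have "closed {x. c \<le> v x}" by (intro closed_Collect_le continuous_on_const cont)
    then have "compact (sphere 0 r \<inter> {x. c \<le> v x})" by (intro compact_Int_closed) auto
    moreover have "A = sphere 0 r \<inter> {x. c \<le> v x}" by (auto simp: A_def)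
    ultimately have "compact A" by simp
    moreover have "continuous_on A (\<lambda>x. x \<bullet> p)" by (intro continuous_intros)
    ultimately obtain x1 where x1: "x1 \<in> A" and min: "\<And>x. x \<in> A \<Longrightarrow> x1 \<bullet> p \<le> x \<bullet> p"
      using continuous_attains_inf[OF _ False, of "\<lambda>x. x \<bullet> p"] by blast
    have nx1: "norm x1 = r" "c \<le> v x1" using x1 by (auto simp: A_def)
    have in\<Omega>: "x \<in> \<Omega>" if "norm x = r" for x using S that by auto
    have A_iff: "x \<in> A \<longleftrightarrow> x1 \<bullet> p \<le> x \<bullet> p" if x: "norm x = r" for x
    proof
      assume le: "x1 \<bullet> p \<le> x \<bullet> p"
      have "v x1 \<le> v x"
      proof (cases "x1 \<bullet> p < x \<bullet> p")
        case True
        then show ?thesis using strict[OF in\<Omega>[OF x], of x1] x nx1 by simp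
      next
        case False
        then show ?thesis using eq[OF in\<Omega>[OF x], of x1] le x nx1 by simp
      qed
      then show "x \<in> A" using nx1 x by (simp add: A_def)
    qed (rule min)
    have bd: "\<bar>x \<bullet> (r *\<^sub>R p) / r\<^sup>2\<bar> \<le> 1" if "norm x = r" for x
      using Cauchy_Schwarz_ineq2[of x p] that p r by (simp add: power2_eq_square abs_mult field_simps)
    have dist_iff: "sphere_dist r x (r *\<^sub>R p) \<le> sphere_dist r x1 (r *\<^sub>R p) \<longleftrightarrow> x1 \<bullet> p \<le> x \<bullet> p"
      if x: "norm x = r" for x
    proof -
      have "sphere_dist r x (r *\<^sub>R p) \<le> sphere_dist r x1 (r *\<^sub>R p) \<longleftrightarrow>
          arccos (x \<bullet> (r *\<^sub>R p) / r\<^sup>2) \<le> arccos (x1 \<bullet> (r *\<^sub>R p) / r\<^sup>2)"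
        unfolding sphere_dist_def by (rule mult_le_cancel_left_pos[OF r])
      also have "\<dots> \<longleftrightarrow> x1 \<bullet> (r *\<^sub>R p) / r\<^sup>2 \<le> x \<bullet> (r *\<^sub>R p) / r\<^sup>2"
        by (rule arccos_le_mono[OF bd[OF x] bd[OF nx1(1)]])
      also have "\<dots> \<longleftrightarrow> x1 \<bullet> p \<le> x \<bullet> p"
        using r by (simp add: divide_le_cancel mult_le_cancel_left)
      finally show ?thesis .
    qed
    have "0 \<le> sphere_dist r x1 (r *\<^sub>R p)"
      unfolding sphere_dist_def using r bd[OF nx1(1)]
      by (intro mult_nonneg_nonneg arccos_lbound) linarith+
    moreover have "A = {x \<in> sphere 0 r. sphere_dist r x (r *\<^sub>R p) \<le> sphere_dist r x1 (r *\<^sub>R p)}"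
      using A_iff dist_iff by (auto simp: A_def)
    ultimately show ?thesis by blast
  qed simp
  then show "{x \<in> sphere 0 r. c \<le> v x} = sphere 0 r \<or> {x \<in> sphere 0 r. c \<le> v x} = {} \<or>
      (\<exists>\<rho>\<ge>0. {x \<in> sphere 0 r. c \<le> v x} = {x \<in> sphere 0 r. sphere_dist r x (r *\<^sub>R p) \<le> \<rho>})"
    unfolding A_def by blast
qed

lemma mirror_axis: "mirror (axis e 1) x = reflect_coord e x"
proof -
  have "mirror (axis e 1) x = x - (2 * x $ e) *\<^sub>R axis e 1" by (simp add: mirror_def inner_axis)
  then show ?thesis by (simp add: vec_eq_iff reflect_coord_def axis_def)
qed

text \<open>In dimension at least 2 the rotations act transitively on each sphere.\<close>

lemma radial_domain_norm:
  fixes \<Omega> :: "(real^'n) set"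
  assumes "2 \<le> CARD('n)" and \<Omega>: "radial_domain \<Omega>" and "x \<in> \<Omega>" "norm y = norm x"
  shows "y \<in> \<Omega>"
proof -
  obtain T where T: "orthogonal_transformation T" "det (matrix T) = 1" "T x = y"
    using rotation_exists[OF assms(1) assms(4)[symmetric]] by blast
  then have "rotation_matrix (matrix T)"
    by (simp add: rotation_matrix_def orthogonal_transformation_matrix)
  then have "(\<lambda>x. matrix T *v x) ` \<Omega> = \<Omega>" using \<Omega> by (simp add: radial_domain_def)
  moreover have "matrix T *v x = y"
    using T matrix_works[of T x] by (simp add: orthogonal_transformation_linear linear_matrix_vector_mul_eq)
  ultimately show ?thesis using assms(3) by blast
qed

theorem theorem1p2:
  fixes \<Omega> :: "(real^'n) set"
    and k\<^sub>0 :: "real \<Rightarrow> ennreal"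
    and f :: "'m::finite \<Rightarrow> real \<times> (real^'m) \<Rightarrow> real"
    and u :: "'m \<Rightarrow> real^'n \<Rightarrow> real"
    and e :: "'n" and one :: "'m"
  assumes "CARD('n) \<ge> 2"
    and "admissible_profile CARD('n) k\<^sub>0"
    and "radial_domain \<Omega>" and "bounded \<Omega>"
    and "\<And>i. C1_on ({0..} \<times> UNIV) (f i)"
    and "\<And>i j r v. i \<noteq> j \<Longrightarrow> r > 0 \<Longrightarrow> (\<forall>l. v $ l > 0) \<Longrightarrow>
           partial_deriv i (\<lambda>w. f j (r, w)) v > 0"
    and "\<And>i. continuous_on UNIV (u i)" and "\<And>i. bounded (range (u i))"
    and "weak_solution (radial_kernel k\<^sub>0) \<Omega> f u"
    and "\<And>i x. x \<notin> \<Omega> \<Longrightarrow> u i x = 0"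
    and "\<And>i x. x \<in> \<Omega> \<Longrightarrow> u i x > 0"
    and "\<And>i x. x $ e > 0 \<Longrightarrow> u i x \<ge> u i (reflect_coord e x)"
    and "\<exists>x. x $ e > 0 \<and> u one x > u one (reflect_coord e x)"
  shows "\<exists>p. norm p = 1 \<and>
    (\<forall>i. foliated_schwarz p \<Omega> (u i) \<and> strictly_decreasing_polar p \<Omega> (u i))"
proof -
  note N = assms(1) and k = assms(2) and \<Omega> = assms(3,4) and coop = assms(6) and cont = assms(7)
    and sol = assms(9) and zero = assms(10) and pos = assms(11)
  define K :: "real^'n \<Rightarrow> real" where "K = (\<lambda>z. real_profile k\<^sub>0 (norm z))"
  interpret sk: singular_kernel K unfolding K_def by (rule singular_kernel_radial) (simp add: k)
  have open_\<Omega>: "open \<Omega>" and conn: "connected \<Omega>" using \<Omega> by (simp_all add: radial_domain_def)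
  note radial = radial_domain_norm[OF N \<Omega>(1)]
  obtain R where R: "\<And>x. x \<in> \<Omega> \<Longrightarrow> norm x \<le> R" using \<Omega>(2) by (auto simp: bounded_iff)
  have "\<exists>b. \<forall>x. \<bar>u i x\<bar> \<le> b" for i using assms(8)[of i] by (auto simp: bounded_iff)
  then obtain U where U: "\<And>i x. \<bar>u i x\<bar> \<le> U i" by metis
  have "\<exists>F'. (\<forall>x\<in>{0..} \<times> UNIV. (f i has_derivative blinfun_apply (F' x)) (at x within {0..} \<times> UNIV)) \<and>
      continuous_on ({0..} \<times> UNIV) F'" for i
    using assms(5)[of i] by (simp add: C1_on_def)
  then obtain F' where F'_all: "\<And>i. (\<forall>x\<in>{0..} \<times> UNIV. (f i has_derivative blinfun_apply (F' i x)) (at x within {0..} \<times> UNIV)) \<and>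
      continuous_on ({0..} \<times> UNIV) (F' i)" by metis
  have F': "x \<in> {0..} \<times> UNIV \<Longrightarrow> (f i has_derivative blinfun_apply (F' i x)) (at x within {0..} \<times> UNIV)"
    "continuous_on ({0..} \<times> UNIV) (F' i)" for i x using F'_all by blast+
  \<comment> \<open>Every vector of values (u_1(x), ..., u_m(x)) has norm at most this M, so bounds
    for f on compact sets apply along the solution.\<close>
  define M where "M = sum U UNIV"
  have "\<exists>B\<ge>0. \<forall>r\<in>{0..R}. \<forall>a b. norm a \<le> M \<longrightarrow> norm b \<le> M \<longrightarrow> \<bar>f i (r, a) - f i (r, b)\<bar> \<le> B * norm (a - b)" for i
    by (rule lipschitz_bounded[OF F'])
  then obtain B where B0: "\<And>i. 0 \<le> B i" and B: "\<And>i r a b. r \<in> {0..R} \<Longrightarrow> norm a \<le> M \<Longrightarrow> norm b \<le> M \<Longrightarrow>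
      \<bar>f i (r, a) - f i (r, b)\<bar> \<le> B i * norm (a - b)" by metis
  define V where "V x = (\<chi> l. u l x)" for x
  \<comment> \<open>Cut off outside \<Omega>, where |x| is unbounded and f may be unbounded
    too.\<close>
  define g where "g i x = indicat_real \<Omega> x * f i (norm x, V x)" for i x
  define L where "L = sum B UNIV"
  have BL: "B i \<le> L" for i unfolding L_def by (intro member_le_sum B0) auto
  have V_bd: "norm (V x) \<le> M" for x
    using norm_le_l1_cart[of "V x"] sum_mono[of UNIV "\<lambda>l. \<bar>V x $ l\<bar>" U] U by (simp add: M_def V_def)
  have V_cont: "continuous_on UNIV V" unfolding V_def by (intro continuous_intros cont)
  have f_cont: "continuous_on UNIV (\<lambda>x. f i (norm x, V x))" for i
  proof (rule continuous_on_compose2[OF F_continuous[OF F']])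
    show "continuous_on UNIV (\<lambda>x. (norm x, V x))" by (intro continuous_intros V_cont)
  qed auto
  have g_meas: "g i \<in> borel_measurable borel" for i
    unfolding g_def using open_\<Omega> f_cont
    by (intro borel_measurable_times borel_measurable_indicator borel_measurable_continuous_onI) auto
  have u_meas: "u i \<in> borel_measurable borel" for i
    using cont by (rule borel_measurable_continuous_onI)
  have g_bound: "\<exists>C. \<forall>x. \<bar>g i x\<bar> \<le> C" for i
  proof -
    obtain C where C: "\<And>r a. r \<in> {0..R} \<Longrightarrow> norm a \<le> M \<Longrightarrow> \<bar>f i (r, a)\<bar> \<le> C"
      using bounded_on_bounded[OF F'] by metis
    have "\<bar>g i x\<bar> \<le> max 0 C" for x
      using C[of "norm x" "V x"] R[of x] V_bd[of x] by (cases "x \<in> \<Omega>") (auto simp: g_def)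
    then show ?thesis by blast
  qed
  interpret symmetric_system K \<Omega> u g L
  proof
    show "x \<in> \<Omega> \<Longrightarrow> norm y = norm x \<Longrightarrow> y \<in> \<Omega>" for x y by (rule radial)
    show "sk.fin_energy (u i)" for i
      using sol energy_finite_iff[OF k u_meas[of i]] unfolding K_def
      by (auto simp: weak_solution_def energy_space_def)
    show "sk.E (u i) \<phi> = (LINT x|lborel. g i x * \<phi> x)"
      if "sk.fin_energy \<phi>" "\<And>x. x \<notin> \<Omega> \<Longrightarrow> \<phi> x = 0" "\<And>x. \<bar>\<phi> x\<bar> \<le> C" for i \<phi> C
      using weak_solution_test[OF k sol u_meas open_\<Omega> \<Omega>(2), of i \<phi> C] g_meas[of i] that
      unfolding g_def V_def K_def by blast
    show "0 \<le> L" unfolding L_def by (intro sum_nonneg B0)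
    show "g i y - g i x \<le> L * (\<bar>u i x - u i y\<bar> + (\<Sum>j\<in>UNIV. max 0 (u j y - u j x)))"
      if x: "x \<in> \<Omega>" "x \<noteq> 0" "norm y = norm x" for i x y
    proof -
      have y: "y \<in> \<Omega>" using radial x by blast
      have "f i (norm x, V y) - f i (norm x, V x) \<le>
          B i * (\<bar>V x $ i - V y $ i\<bar> + (\<Sum>l\<in>UNIV. max 0 (V y $ l - V x $ l)))"
      proof (rule cooperative_lower_bound[OF F'])
        show "0 < partial_deriv l (\<lambda>w. f i (norm x, w)) v" if "l \<noteq> i" "\<forall>l. 0 < v $ l" for l v
          using that x by (intro coop) auto
        show "V x $ l \<le> U l" "V y $ l \<le> U l" for l using U[of l x] U[of l y] by (simp_all add: V_def abs_le_iff)
        show "\<bar>f i (norm x, a) - f i (norm x, b)\<bar> \<le> B i * norm (a - b)"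
          if "norm a \<le> sum U UNIV" "norm b \<le> sum U UNIV" for a b
          using that R[OF x(1)] by (intro B) (auto simp: M_def)
      qed (use x y pos B0 in \<open>auto simp: V_def\<close>)
      also have "\<dots> \<le> L * (\<bar>V x $ i - V y $ i\<bar> + (\<Sum>l\<in>UNIV. max 0 (V y $ l - V x $ l)))"
        by (intro mult_right_mono BL add_nonneg_nonneg sum_nonneg) auto
      finally show ?thesis using x y by (simp add: g_def V_def)
    qed
    show "g i y < g i x"
      if x: "x \<in> \<Omega>" "x \<noteq> 0" "norm y = norm x" and ui: "u i x = u i y"
        and le: "\<And>j. u j y \<le> u j x" and less: "u j y < u j x" for i j x y
    proof -
      have y: "y \<in> \<Omega>" using radial x by blast
      have "f i (norm x, V y) < f i (norm x, V x)"
      proof (rule cooperative_mono(2)[OF F'])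
        show "0 < partial_deriv l (\<lambda>w. f i (norm x, w)) v" if "l \<noteq> i" "\<forall>l. 0 < v $ l" for l v
          using that x by (intro coop) auto
      qed (use x y pos ui le less in \<open>auto simp: V_def\<close>)
      then show ?thesis using x y by (simp add: g_def)
    qed
  qed (use open_\<Omega> \<Omega>(2) conn cont zero g_meas g_bound in auto)
  obtain x0 where x0: "x0 $ e > 0" "u one x0 > u one (reflect_coord e x0)" using assms(13) by blast
  have refl_norm: "norm (reflect_coord e x) = norm x" for x :: "real^'n" by (simp add: mirror_axis[symmetric])
  have "x0 \<in> \<Omega>"
  proof (rule ccontr)
    assume "x0 \<notin> \<Omega>"
    then have "reflect_coord e x0 \<notin> \<Omega>" using radial[of "reflect_coord e x0" x0] refl_norm by auto
    then show False using x0 zero \<open>x0 \<notin> \<Omega>\<close> by simp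
  qed
  have "x0 \<noteq> 0" using x0 by auto
  have "0 \<le> (x \<bullet> axis e 1) * w (axis e 1) i x" for i x
  proof -
    have p: "0 \<le> w (axis e 1) i x" if "0 < x $ e" for x
      using assms(12)[OF that, of i] by (simp add: w_def mirror_axis)
    consider "0 < x $ e" | "x $ e < 0" | "x $ e = 0" by linarith
    then show ?thesis
    proof cases
      case 2
      then have "0 \<le> w (axis e 1) i (mirror (axis e 1) x)"
        by (intro p) (simp add: mirror_axis reflect_coord_def)
      then show ?thesis using 2 by (simp add: w_odd inner_axis mult_nonpos_nonpos)
    qed (use p in \<open>auto simp: inner_axis\<close>)
  qed
  then have "axis e 1 \<in> Sp \<or> (\<forall>i x. w (axis e 1) i x = 0)" by (intro Sp_dichotomy) (auto simp: axis_eq_0_iff)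
  \<comment> \<open>The strict inequality in the hypothesis excludes the alternative that all
    components are symmetric.\<close>
  moreover have "w (axis e 1) one x0 \<noteq> 0" using x0 by (simp add: w_def mirror_axis)
  ultimately have "axis e 1 \<in> Sp" by blast
  then obtain p where p: "norm p = 1" "\<And>\<nu>. 0 < \<nu> \<bullet> p \<Longrightarrow> \<nu> \<in> Sp"
    using symmetry_axis[OF \<open>x0 \<in> \<Omega>\<close> \<open>x0 \<noteq> 0\<close>] by blast
  have "foliated_schwarz p \<Omega> (u i)" for i
    by (rule foliated_schwarzI[OF p(1) cont]) (auto intro: polar_strict[OF p] polar_le[OF p])
  moreover have "strictly_decreasing_polar p \<Omega> (u i)" for i
    unfolding strictly_decreasing_polar_def by (auto intro!: polar_strict[OF p])
  ultimately show ?thesis using p(1) by blast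
qed

end
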